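(* Let $f:Y\to X$ be a nonconstant holomorphic map of compact connected Riemann surfaces, let $E_*$ be a parabolic vector bundle on $(X,D)$, let $L_*$ be a parabolic line bundle of parabolic degree $0$ on $(X,D)$, and let $\phi:E_*\otimes E_*\to L_*$ be an $L_*$-valued parabolic symplectic (respectively, parabolic orthogonal) structure on $E_*$. Then $f^*\phi$ is an $f^*L_*$-valued parabolic symplectic (respectively, parabolic orthogonal) structure on the pulled back parabolic vector bundle $f^*E_*$. In particular, the pullback of an $\mathcal O_X$-valued parabolic orthogonal (respectively, symplectic) structure on $E_*$ is an $\mathcal O_Y$-valued parabolic orthogonal (respectively, symplectic) structure on $f^*E_*$.
   Context: **Parabolic bundles.** $X$ is a compact connected Riemann surface, $D=\{x_1,\dots,x_\ell\}\subset X$ a finite subset. A parabolic vector bundle $E_*$ on $(X,D)$ is a holomorphic vector bundle $E$ on $X$ with, for each $i$, a filtration $E_{x_i}=E_i^1\supsetneq\cdots\supsetneq E_i^{n_i}\supsetneq E_i^{n_i+1}=0$ and weights $0\le\alpha_{i,1}<\cdots<\alpha_{i,n_i}<1$. Parabolic degree: $\deg E+\sum_{i,j}\alpha_{i,j}\dim(E_i^j/E_i^{j+1})$. Equivalently: for $x=x_i$ with local coordinate $z$ and $t\in[0,1)$, $E_{x,t}$ is the module of germs $s$ of sections of $E$ at $x$ with $s(x)\in E_i^j$, $j$ the smallest index with $\alpha_{i,j}\ge t$ ($j=n_i+1$ if none); $E_{x,t+1}=zE_{x,t}$ for all $t\in\mathbb R$. The $t=0$ terms recover $E$ and the jumps recover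 the weights. Homomorphisms are bundle maps with $E_{x,t}\to E'_{x,t}$. $(E_*\otimes E'_* )_{x,t}=\sum_{a+b=t}E_{x,a}\otimes E'_{x,b}$; $(E_*^* )_{x,t}$ consists of germs of meromorphic functionals (poles only at $x$) mapping $E_{x,a}$ to $z^{\lceil a+t\rceil}\mathcal O_{X,x}$ for all $a$. $\mathcal O_X$, $\mathcal O_Y$ carry the trivial parabolic structure. **Structures.** For $L_*$ a parabolic line bundle of parabolic degree $0$, a homomorphism $\phi:E_*\otimes E_*\to L_*$ is an $L_*$-valued parabolic orthogonal (respectively, symplectic) structure on $E_*$ if $\phi|_{X\setminus D}$ is symmetric (respectively, anti-symmetric) and $\widehat\phi:E_*\to E_*^*\otimes L_*$, $u\mapsto\phi(u\otimes\cdot)$, is an isomorphism of parabolic vector bundles. **Pullback.** Let $B=f^{-1}(D)_{\rm red}\subset Y$. The parabolic bundle $f^*E_*$ on $(Y,B)$ restricts to $f^*(E|_{X\setminus D})$ on $Y\setminus B$, and for $y\in B$ with local coordinate $w$ and multiplicity $m_y$ of $f$ at $y$, $(f^*E_* )_{y,s}$ is the $\mathcal O_{Y,y}$-module generated by $w^kf^*u$ with $u\in E_{f(y),t}$, $k\in\mathbb Z$, $t\in\mathbb R$, $m_yt+k\ge s$. One has $f^*(E_*\otimes F_* )=f^*E_*\otimes f^*F_*$, and $f^*\phi:f^*E_*\otimes f^*E_*\to f^*L_*$ is the homomorphism extending the usual pullback of $\phi|_{X\setminus D}$. *)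

theory Defs
  imports "HOL-Complex_Analysis.Complex_Analysis"
begin

section \<open>Riemann surfaces\<close>

text \<open>
  A Riemann surface is a Hausdorff space, given as a type, with a holomorphic atlas. A chart is a
  pair of an open domain and a coordinate function that is meaningful on this domain only. The atlas
  need not be maximal.
\<close>

type_synonym 'a atlas = "('a set \<times> ('a \<Rightarrow> complex)) set"

definition riemann_surface :: "'a::t2_space atlas \<Rightarrow> bool" where
  "riemann_surface X \<longleftrightarrow>
     (\<forall>(U, z)\<in>X. open U \<and> open (z ` U) \<and> homeomorphism U (z ` U) z (inv_into U z)) \<and>
     (\<Union>(U, z)\<in>X. U) = UNIV \<and>
     (\<forall>(U, z)\<in>X. \<forall>(V, w)\<in>X. (w \<circ> inv_into U z) holomorphic_on z ` (U \<inter> V))"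

text \<open>Second countability is not required, as it follows from compactness.\<close>

definition compact_connected_riemann_surface :: "'a::t2_space atlas \<Rightarrow> bool" where
  "compact_connected_riemann_surface X \<longleftrightarrow>
     riemann_surface X \<and> compact (UNIV :: 'a set) \<and> connected (UNIV :: 'a set)"

definition holomorphic_map ::
    "'b::t2_space atlas \<Rightarrow> 'a::t2_space atlas \<Rightarrow> ('b \<Rightarrow> 'a) \<Rightarrow> bool" where
  "holomorphic_map Y X f \<longleftrightarrow> continuous_on UNIV f \<and>
     (\<forall>(V, w)\<in>Y. \<forall>(U, z)\<in>X. (z \<circ> f \<circ> inv_into V w) holomorphic_on w ` (V \<inter> f -` U))"

definition hol_fun :: "'a::t2_space atlas \<Rightarrow> 'a set \<Rightarrow> ('a \<Rightarrow> complex) \<Rightarrow> bool" where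
  "hol_fun X W g \<longleftrightarrow> (\<forall>(U, z)\<in>X. (g \<circ> inv_into U z) holomorphic_on z ` (U \<inter> W))"

definition hol_matrix ::
    "'a::t2_space atlas \<Rightarrow> 'a set \<Rightarrow> ('a \<Rightarrow> complex^'n^'m) \<Rightarrow> bool" where
  "hol_matrix X W A \<longleftrightarrow> (\<forall>i j. hol_fun X W (\<lambda>p. A p $ i $ j))"

text \<open>Germs of sections of the structure sheaf at a point.\<close>

definition hol_at :: "'a::t2_space atlas \<Rightarrow> 'a \<Rightarrow> ('a \<Rightarrow> complex) \<Rightarrow> bool" where
  "hol_at X x g \<longleftrightarrow> (\<exists>W. open W \<and> x \<in> W \<and> hol_fun X W g)"

text \<open>
  One chart, and one coordinate centred at \<open>x\<close>, is selected at each point. Nothing below depends on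
  the selection: only \<open>z\<^sup>k \<O>\<^sub>x\<close> and orders of vanishing are used.
\<close>

definition chart_at :: "'a atlas \<Rightarrow> 'a \<Rightarrow> 'a set \<times> ('a \<Rightarrow> complex)" where
  "chart_at X x = (SOME c. c \<in> X \<and> x \<in> fst c)"

definition coord_at :: "'a atlas \<Rightarrow> 'a \<Rightarrow> 'a \<Rightarrow> complex" where
  "coord_at X x p = snd (chart_at X x) p - snd (chart_at X x) x"

definition in_chart_at :: "'a atlas \<Rightarrow> 'a \<Rightarrow> ('a \<Rightarrow> complex) \<Rightarrow> complex \<Rightarrow> complex" where
  "in_chart_at X x g = (case chart_at X x of (U, z) \<Rightarrow> g \<circ> inv_into U z)"

definition mero_at :: "'a atlas \<Rightarrow> 'a \<Rightarrow> ('a \<Rightarrow> complex) \<Rightarrow> bool" where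
  "mero_at X x g \<longleftrightarrow> in_chart_at X x g meromorphic_on {snd (chart_at X x) x}"

text \<open>Meaningful for functions that are meromorphic at \<open>x\<close> and not identically zero near \<open>x\<close>.\<close>

definition ord_at :: "'a atlas \<Rightarrow> 'a \<Rightarrow> ('a \<Rightarrow> complex) \<Rightarrow> int" where
  "ord_at X x g = zorder (in_chart_at X x g) (snd (chart_at X x) x)"

definition multiplicity_at ::
    "'b atlas \<Rightarrow> 'a atlas \<Rightarrow> ('b \<Rightarrow> 'a) \<Rightarrow> 'b \<Rightarrow> int" where
  "multiplicity_at Y X f y = ord_at Y y (coord_at X (f y) \<circ> f)"

text \<open>
  The module \<open>z\<^sup>k \<O>\<^sub>x\<close>. Meromorphic germs at \<open>x\<close>, here and below, are represented by functions on the
  whole surface that matter only on punctured neighbourhoods of \<open>x\<close>, that is, up to the filter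
  \<open>at x\<close>.
\<close>

definition zpow_module :: "'a::t2_space atlas \<Rightarrow> 'a \<Rightarrow> int \<Rightarrow> ('a \<Rightarrow> complex) set" where
  "zpow_module X x k =
     {g. \<exists>h. hol_at X x h \<and> (\<forall>\<^sub>F p in at x. g p = coord_at X x p powi k * h p)}"

text \<open>The \<open>\<O>\<^sub>x\<close>-module of germs at \<open>x\<close> generated by \<open>S\<close>.\<close>

definition germ_span ::
    "'a::t2_space atlas \<Rightarrow> 'a \<Rightarrow> ('a \<Rightarrow> complex^'n) set \<Rightarrow> ('a \<Rightarrow> complex^'n) set" where
  "germ_span X x S =
     {v. \<exists>(N::nat) g u. (\<forall>i<N. hol_at X x (g i) \<and> u i \<in> S) \<and>
           (\<forall>\<^sub>F p in at x. v p = (\<Sum>i<N. g i p *s u i p))}"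

section \<open>Parabolic bundles\<close>

text \<open>
  A parabolic bundle \<open>E\<^sub>*\<close> of rank \<open>CARD('n)\<close> on \<open>(X, D)\<close> is given by the holomorphic vector bundle
  \<open>E|\<^bsub>X - D\<^esub>\<close> together with the modules \<open>E\<^bsub>x,t\<^esub>\<close> for \<open>x \<in> D\<close>; the bundle \<open>E\<close> on all of \<open>X\<close> is
  recovered from the modules \<open>E\<^bsub>x,0\<^esub>\<close>.

  Each fibre over \<open>X - D\<close> is identified with \<open>complex^'n\<close> by an arbitrary choice of basis, with no
  continuity in the point; the holomorphic structure is carried by the local frames \<open>(U, \<tau>)\<close>, where
  the columns of \<open>\<tau> p\<close> are the frame vectors in the fibre at \<open>p\<close>. Elements of \<open>stalk E x t\<close> are
  sections of \<open>E|\<^bsub>X - D\<^esub>\<close> on punctured neighbourhoods of \<open>x\<close>.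
\<close>

record ('a, 'n::finite) parabolic_data =
  frames :: "('a set \<times> ('a \<Rightarrow> complex^'n^'n)) set"
  stalk :: "'a \<Rightarrow> real \<Rightarrow> ('a \<Rightarrow> complex^'n) set"

definition holomorphic_bundle_off ::
    "'a::t2_space atlas \<Rightarrow> 'a set \<Rightarrow> ('a, 'n::finite) parabolic_data \<Rightarrow> bool" where
  "holomorphic_bundle_off X D E \<longleftrightarrow>
     (\<forall>(U, \<tau>)\<in>frames E. open U \<and> (\<forall>p\<in>U. invertible (\<tau> p))) \<and>
     (\<Union>(U, \<tau>)\<in>frames E. U) = - D \<and>
     (\<forall>(U, \<tau>)\<in>frames E. \<forall>(W, \<sigma>)\<in>frames E.
        hol_matrix X (U \<inter> W) (\<lambda>p. matrix_inv (\<sigma> p) ** \<tau> p))"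

definition punctured_frame ::
    "'a::t2_space atlas \<Rightarrow> 'a set \<Rightarrow> ('a, 'n::finite) parabolic_data \<Rightarrow> 'a
       \<Rightarrow> ('a \<Rightarrow> complex^'n^'n) \<Rightarrow> bool" where
  "punctured_frame X D E x \<tau> \<longleftrightarrow>
     (\<exists>U. open U \<and> x \<in> U \<and> U - {x} \<subseteq> - D \<and> (\<forall>p\<in>U - {x}. invertible (\<tau> p)) \<and>
        (\<forall>(W, \<sigma>)\<in>frames E.
           hol_matrix X (W \<inter> U - {x}) (\<lambda>p. matrix_inv (\<sigma> p) ** \<tau> p)))"

text \<open>
  For a punctured frame \<open>\<tau>\<close> that serves as a frame of an extension of the bundle across \<open>x\<close>, the
  germs at \<open>x\<close> of sections of this extension whose value at \<open>x\<close>, expressed in the frame \<open>\<tau>\<close>, lies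
  in \<open>V\<close>.
\<close>

definition frame_germs ::
    "'a::t2_space atlas \<Rightarrow> 'a \<Rightarrow> ('a \<Rightarrow> complex^'n^'n) \<Rightarrow> (complex^'n) set
       \<Rightarrow> ('a \<Rightarrow> complex^'n) set" where
  "frame_germs X x \<tau> V =
     {s. \<exists>c. (\<forall>i. hol_at X x (\<lambda>p. c p $ i)) \<and> c x \<in> V \<and> (\<forall>\<^sub>F p in at x. s p = \<tau> p *v c p)}"

definition is_weighted_flag ::
    "nat \<Rightarrow> (nat \<Rightarrow> (complex^'n) set) \<Rightarrow> (nat \<Rightarrow> real) \<Rightarrow> bool" where
  "is_weighted_flag n V \<alpha> \<longleftrightarrow>
     V 1 = UNIV \<and> V (Suc n) = {0} \<and>
     (\<forall>j\<in>{1..n}. vec.subspace (V j) \<and> V (Suc j) \<subset> V j) \<and>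
     (\<forall>j\<in>{1..n}. 0 \<le> \<alpha> j \<and> \<alpha> j < 1) \<and> strict_mono_on {1..n} \<alpha>"

text \<open>Equals \<open>Suc n\<close> if there is no \<open>j \<le> n\<close> with \<open>\<alpha> j \<ge> t\<close>.\<close>

definition weight_index :: "nat \<Rightarrow> (nat \<Rightarrow> real) \<Rightarrow> real \<Rightarrow> nat" where
  "weight_index n \<alpha> t = (LEAST j. 1 \<le> j \<and> (j \<le> n \<longrightarrow> t \<le> \<alpha> j))"

text \<open>
  The frame \<open>\<tau>\<close> at \<open>x\<close> of the underlying bundle \<open>E\<close>, the flag \<open>V\<close> in its fibre at \<open>x\<close> and the
  weights \<open>\<alpha>\<close> give rise to the modules \<open>E\<^bsub>x,t\<^esub>\<close>.
\<close>

definition parabolic_presentation ::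
    "'a::t2_space atlas \<Rightarrow> 'a set \<Rightarrow> ('a, 'n::finite) parabolic_data \<Rightarrow> 'a
       \<Rightarrow> ('a \<Rightarrow> complex^'n^'n) \<Rightarrow> nat \<Rightarrow> (nat \<Rightarrow> (complex^'n) set) \<Rightarrow> (nat \<Rightarrow> real) \<Rightarrow> bool" where
  "parabolic_presentation X D E x \<tau> n V \<alpha> \<longleftrightarrow>
     punctured_frame X D E x \<tau> \<and> is_weighted_flag n V \<alpha> \<and>
     (\<forall>t. 0 \<le> t \<and> t < 1 \<longrightarrow> stalk E x t = frame_germs X x \<tau> (V (weight_index n \<alpha> t))) \<and>
     (\<forall>t. stalk E x (t + 1) =
        {s. \<exists>u\<in>stalk E x t. \<forall>\<^sub>F p in at x. s p = coord_at X x p *s u p})"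

definition parabolic_bundle ::
    "'a::t2_space atlas \<Rightarrow> 'a set \<Rightarrow> ('a, 'n::finite) parabolic_data \<Rightarrow> bool" where
  "parabolic_bundle X D E \<longleftrightarrow>
     holomorphic_bundle_off X D E \<and>
     (\<forall>x\<in>D. \<exists>\<tau> n V \<alpha>. parabolic_presentation X D E x \<tau> n V \<alpha>)"

section \<open>Parabolic degree\<close>

text \<open>Local frames near \<open>x\<close> of the underlying bundle \<open>E\<close> on \<open>X\<close>.\<close>

definition frame_at ::
    "'a::t2_space atlas \<Rightarrow> 'a set \<Rightarrow> ('a, 'n::finite) parabolic_data \<Rightarrow> 'a
       \<Rightarrow> ('a \<Rightarrow> complex^'n^'n) \<Rightarrow> bool" where
  "frame_at X D E x \<tau> \<longleftrightarrow>
     (if x \<in> D then punctured_frame X D E x \<tau> \<and> stalk E x 0 = frame_germs X x \<tau> UNIV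
      else \<exists>U. (U, \<tau>) \<in> frames E \<and> x \<in> U)"

text \<open>
  A function \<open>h\<close> represents the section \<open>h \<cdot> e\<^sub>1 \<and> \<dots> \<and> e\<^sub>r\<close> of \<open>det E\<close>, where \<open>e\<^sub>1, \<dots>, e\<^sub>r\<close> is the
  standard basis of \<open>complex^'n\<close>; its coefficient in a frame \<open>\<tau>\<close> is \<open>h / det \<tau>\<close>. The section is
  required to be meromorphic, and nonzero (equivalently, on a connected surface, not identically
  zero near any point).
\<close>

definition mero_det_section ::
    "'a::t2_space atlas \<Rightarrow> 'a set \<Rightarrow> ('a, 'n::finite) parabolic_data \<Rightarrow> ('a \<Rightarrow> complex) \<Rightarrow> bool" where
  "mero_det_section X D E h \<longleftrightarrow>
     (\<forall>x \<tau>. frame_at X D E x \<tau> \<longrightarrow>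
        mero_at X x (\<lambda>p. h p / det (\<tau> p)) \<and> (\<exists>\<^sub>F p in at x. h p \<noteq> 0))"

definition det_section_ord ::
    "'a::t2_space atlas \<Rightarrow> 'a set \<Rightarrow> ('a, 'n::finite) parabolic_data \<Rightarrow> ('a \<Rightarrow> complex) \<Rightarrow> 'a
       \<Rightarrow> int" where
  "det_section_ord X D E h x = ord_at X x (\<lambda>p. h p / det ((SOME \<tau>. frame_at X D E x \<tau>) p))"

text \<open>
  The degree of \<open>E\<close> is the degree of the divisor of any nonzero meromorphic section of \<open>det E\<close>.
  On a compact connected Riemann surface, such a section exists and the degree does not depend on
  it; the degree is rendered as a relation so that these two theorems are not presupposed.
\<close>

definition has_degree ::
    "'a::t2_space atlas \<Rightarrow> 'a set \<Rightarrow> ('a, 'n::finite) parabolic_data \<Rightarrow> int \<Rightarrow> bool" where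
  "has_degree X D E d \<longleftrightarrow>
     (\<exists>h. mero_det_section X D E h \<and>
        d = (\<Sum>x | det_section_ord X D E h x \<noteq> 0. det_section_ord X D E h x))"

definition has_weight_sum ::
    "'a::t2_space atlas \<Rightarrow> 'a set \<Rightarrow> ('a, 'n::finite) parabolic_data \<Rightarrow> 'a \<Rightarrow> real \<Rightarrow> bool" where
  "has_weight_sum X D E x w \<longleftrightarrow>
     (\<exists>\<tau> n V \<alpha>. parabolic_presentation X D E x \<tau> n V \<alpha> \<and>
        w = (\<Sum>j=1..n. \<alpha> j * (real (vec.dim (V j)) - real (vec.dim (V (Suc j))))))"

definition has_parabolic_degree ::
    "'a::t2_space atlas \<Rightarrow> 'a set \<Rightarrow> ('a, 'n::finite) parabolic_data \<Rightarrow> real \<Rightarrow> bool" where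
  "has_parabolic_degree X D E \<delta> \<longleftrightarrow>
     (\<exists>d w. has_degree X D E d \<and> (\<forall>x\<in>D. has_weight_sum X D E x (w x)) \<and>
        \<delta> = real_of_int d + (\<Sum>x\<in>D. w x))"

section \<open>Homomorphisms, tensor products, duals\<close>

text \<open>
  A homomorphism is given by its restriction to \<open>X - D\<close>. At \<open>x \<in> D\<close>, the condition at \<open>t = 0\<close>
  expresses that it extends to a map of the underlying bundles.
\<close>

definition parabolic_hom ::
    "'a::t2_space atlas \<Rightarrow> 'a set \<Rightarrow> ('a, 'n::finite) parabolic_data \<Rightarrow> ('a, 'm::finite) parabolic_data
       \<Rightarrow> ('a \<Rightarrow> complex^'n^'m) \<Rightarrow> bool" where
  "parabolic_hom X D E F \<phi> \<longleftrightarrow>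
     (\<forall>(U, \<tau>)\<in>frames E. \<forall>(W, \<sigma>)\<in>frames F.
        hol_matrix X (U \<inter> W) (\<lambda>p. matrix_inv (\<sigma> p) ** \<phi> p ** \<tau> p)) \<and>
     (\<forall>x\<in>D. \<forall>t. \<forall>s\<in>stalk E x t. (\<lambda>p. \<phi> p *v s p) \<in> stalk F x t)"

definition parabolic_iso ::
    "'a::t2_space atlas \<Rightarrow> 'a set \<Rightarrow> ('a, 'n::finite) parabolic_data \<Rightarrow> ('a, 'm::finite) parabolic_data
       \<Rightarrow> ('a \<Rightarrow> complex^'n^'m) \<Rightarrow> bool" where
  "parabolic_iso X D E F \<phi> \<longleftrightarrow>
     parabolic_hom X D E F \<phi> \<and>
     (\<exists>\<psi>. parabolic_hom X D F E \<psi> \<and> (\<forall>p\<in>- D. \<psi> p ** \<phi> p = mat 1 \<and> \<phi> p ** \<psi> p = mat 1))"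

definition tensor_vec :: "complex^'n \<Rightarrow> complex^'m \<Rightarrow> complex^('n::finite \<times> 'm::finite)" where
  "tensor_vec u v = (\<chi> ij. u $ fst ij * v $ snd ij)"

definition tensor_matrix ::
    "complex^'n^'n \<Rightarrow> complex^'m^'m \<Rightarrow> complex^('n::finite \<times> 'm::finite)^('n \<times> 'm)" where
  "tensor_matrix A B = (\<chi> ij kl. A $ fst ij $ fst kl * B $ snd ij $ snd kl)"

definition parabolic_tensor ::
    "'a::t2_space atlas \<Rightarrow> ('a, 'n::finite) parabolic_data \<Rightarrow> ('a, 'm::finite) parabolic_data
       \<Rightarrow> ('a, 'n \<times> 'm) parabolic_data" where
  "parabolic_tensor X E F =
     \<lparr>frames = {(U \<inter> W, \<lambda>p. tensor_matrix (\<tau> p) (\<sigma> p)) | U \<tau> W \<sigma>.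
                  (U, \<tau>) \<in> frames E \<and> (W, \<sigma>) \<in> frames F},
      stalk = (\<lambda>x t. germ_span X x
        {\<lambda>p. tensor_vec (u p) (v p) | u v. \<exists>a b. a + b = t \<and> u \<in> stalk E x a \<and> v \<in> stalk F x b})\<rparr>"

text \<open>
  A functional \<open>\<xi>\<close> on the fibre \<open>complex^'n\<close> is represented by its coefficients in the dual of the
  standard basis, so that its value at \<open>s\<close> is \<open>\<Sum>i. \<xi>$i * s$i\<close>. In the definition of the stalks it
  need not be required separately that \<open>\<xi>\<close> is a meromorphic section of the dual bundle: this follows
  from the displayed condition, applied to a local frame of \<open>E\<close>.
\<close>

definition parabolic_dual ::
    "'a::t2_space atlas \<Rightarrow> ('a, 'n::finite) parabolic_data \<Rightarrow> ('a, 'n) parabolic_data" where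
  "parabolic_dual X E =
     \<lparr>frames = {(U, \<lambda>p. transpose (matrix_inv (\<tau> p))) | U \<tau>. (U, \<tau>) \<in> frames E},
      stalk = (\<lambda>x t. {\<xi>. \<forall>a. \<forall>s\<in>stalk E x a.
        (\<lambda>p. \<Sum>i\<in>UNIV. \<xi> p $ i * s p $ i) \<in> zpow_module X x \<lceil>a + t\<rceil>})\<rparr>"

definition trivial_line_bundle :: "'a::t2_space atlas \<Rightarrow> 'a set \<Rightarrow> ('a, 1) parabolic_data" where
  "trivial_line_bundle X D =
     \<lparr>frames = {(- D, \<lambda>_. mat 1)},
      stalk = (\<lambda>x t. {s. (\<lambda>p. s p $ 1) \<in> zpow_module X x \<lceil>t\<rceil>})\<rparr>"

section \<open>Orthogonal and symplectic structures\<close>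

text \<open>
  The map \<open>u \<mapsto> \<phi> (u \<otimes> \<cdot>)\<close> from \<open>E\<close> to \<open>E\<^sup>* \<otimes> L\<close> at one point: the coefficient of its value at
  \<open>e\<^sub>i\<close> with respect to \<open>e\<^sub>j\<^sup>* \<otimes> l\<^sub>k\<close>.
\<close>

definition adjoint_matrix ::
    "complex^('n::finite \<times> 'n)^'m \<Rightarrow> complex^'n^('n \<times> 'm::finite)" where
  "adjoint_matrix A = (\<chi> jk i. A $ snd jk $ (i, fst jk))"

definition nondegenerate_parabolic_form ::
    "'a::t2_space atlas \<Rightarrow> 'a set \<Rightarrow> ('a, 'n::finite) parabolic_data \<Rightarrow> ('a, 1) parabolic_data
       \<Rightarrow> ('a \<Rightarrow> complex^('n \<times> 'n)^1) \<Rightarrow> bool" where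
  "nondegenerate_parabolic_form X D E L \<phi> \<longleftrightarrow>
     parabolic_bundle X D E \<and> parabolic_bundle X D L \<and> has_parabolic_degree X D L 0 \<and>
     parabolic_hom X D (parabolic_tensor X E E) L \<phi> \<and>
     parabolic_iso X D E (parabolic_tensor X (parabolic_dual X E) L) (\<lambda>p. adjoint_matrix (\<phi> p))"

definition parabolic_orthogonal ::
    "'a::t2_space atlas \<Rightarrow> 'a set \<Rightarrow> ('a, 'n::finite) parabolic_data \<Rightarrow> ('a, 1) parabolic_data
       \<Rightarrow> ('a \<Rightarrow> complex^('n \<times> 'n)^1) \<Rightarrow> bool" where
  "parabolic_orthogonal X D E L \<phi> \<longleftrightarrow>
     nondegenerate_parabolic_form X D E L \<phi> \<and>
     (\<forall>p\<in>- D. \<forall>u v. \<phi> p *v tensor_vec v u = \<phi> p *v tensor_vec u v)"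

definition parabolic_symplectic ::
    "'a::t2_space atlas \<Rightarrow> 'a set \<Rightarrow> ('a, 'n::finite) parabolic_data \<Rightarrow> ('a, 1) parabolic_data
       \<Rightarrow> ('a \<Rightarrow> complex^('n \<times> 'n)^1) \<Rightarrow> bool" where
  "parabolic_symplectic X D E L \<phi> \<longleftrightarrow>
     nondegenerate_parabolic_form X D E L \<phi> \<and>
     (\<forall>p\<in>- D. \<forall>u v. \<phi> p *v tensor_vec v u = - (\<phi> p *v tensor_vec u v))"

section \<open>Pullback\<close>

text \<open>
  The pullback to \<open>Y\<close> of a parabolic bundle on \<open>(X, D)\<close>; its parabolic divisor is \<open>f -` D\<close>. The
  fibre of the pullback at \<open>y\<close> outside \<open>f -` D\<close> is the fibre of \<open>E\<close> at \<open>f y\<close>, so the pullback of a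
  homomorphism is its composition with \<open>f\<close>.
\<close>

definition parabolic_pullback ::
    "'b::t2_space atlas \<Rightarrow> 'a::t2_space atlas \<Rightarrow> ('b \<Rightarrow> 'a) \<Rightarrow> ('a, 'n::finite) parabolic_data
       \<Rightarrow> ('b, 'n) parabolic_data" where
  "parabolic_pullback Y X f E =
     \<lparr>frames = {(f -` U, \<tau> \<circ> f) | U \<tau>. (U, \<tau>) \<in> frames E},
      stalk = (\<lambda>y s. germ_span Y y
        {\<lambda>p. (coord_at Y y p powi k) *s u (f p) | (k::int) u.
           \<exists>t. u \<in> stalk E (f y) t \<and> real_of_int (multiplicity_at Y X f y) * t + real_of_int k \<ge> s})\<rparr>"

end

theory Submission
  imports Defs
begin

text \<open>
  Near a parabolic point \<open>x\<close> choose a frame \<open>\<sigma>\<close> adapted to the flag, so that \<open>E\<^bsub>x,t\<^esub>\<close> is the direct sum of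
  the \<open>z\<^bsup>\<lceil>t - \<beta>\<^sub>i\<rceil>\<^esup> \<O>\<^sub>x \<sigma>\<^sub>i\<close>. At a point \<open>y\<close> over \<open>x\<close> of multiplicity \<open>m\<close>, the pullback is then the direct
  sum of the \<open>w\<^bsup>\<lceil>s - m \<beta>\<^sub>i\<rceil>\<^esup> \<O>\<^sub>y f\<^sup>* \<sigma>\<^sub>i\<close>. Twisting \<open>f\<^sup>* \<sigma>\<^sub>i\<close> by \<open>w\<^bsup>- \<lfloor>m \<beta>\<^sub>i\<rfloor>\<^esup>\<close> moves the weights into \<open>[0, 1)\<close>,
  so the pullback is a parabolic bundle. The same description shows that pullback commutes with
  duals and tensor products, so it carries the isomorphism \<open>E\<^sub>* \<rightarrow> E\<^sub>*\<^sup>* \<otimes> L\<^sub>*\<close> and its inverse to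
  mutually inverse homomorphisms. The parabolic degree of \<open>f\<^sup>* L\<^sub>*\<close> is \<open>\<Sum>\<^sub>y m\<^sub>y (ord\<^bsub>f y\<^esub> h + \<beta>\<^bsub>f y\<^esub>)\<close> for a
  meromorphic section \<open>h\<close> of \<open>L\<close>; as \<open>\<Sum>\<^bsub>f y = x\<^esub> m\<^sub>y\<close> does not depend on \<open>x\<close> (by Rouche's theorem it is
  locally constant), this is a multiple of the parabolic degree of \<open>L\<^sub>*\<close>.
\<close>

section \<open>Charts and germs of holomorphic functions\<close>

text \<open>Germs matter only on punctured neighbourhoods, and for \<open>t < 0\<close> a module
  \<open>stalk E x t\<close> need not be closed under equality of germs. On \<open>X\<close> an
  adapted frame therefore records only two facts: its i-th column lies in the module of weight
  \<open>\<beta> i\<close>, and each module is contained in the expected direct sum. These suffice,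
  because the modules of a pullback are spans of germs: the columns supply generators, and the
  inclusion bounds them from above. Commutation with tensor products is formal, by comparing
  generators. For duals only one inclusion is formal. The other must turn a functional, known by its
  values, into a finite sum of pulled back functionals; there the rows of
  \<open>matrix_inv \<sigma>\<close> act as the dual basis. For the degree,
  \<open>has_degree\<close> asks for a single section, so \<open>h \<circ> f\<close> is enough. At a
  point over \<open>D\<close> the integer part of \<open>m y * w\<close> enters the order of this
  section and the fractional part becomes the new weight. Neither part is well behaved under
  pullback; their sum is.\<close>

lemma riemann_surfaceD:
  assumes "riemann_surface X" "(U, z) \<in> X"
  shows "open U" "open (z ` U)" "inj_on z U" "continuous_on U z"
    "continuous_on (z ` U) (inv_into U z)"
proof -
  have "\<forall>(U, z)\<in>X. open U \<and> open (z ` U) \<and> homeomorphism U (z ` U) z (inv_into U z)"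
    using assms(1) unfolding riemann_surface_def by (rule conjunct1)
  from bspec[OF this assms(2)]
  have c: "open U" "open (z ` U)" "homeomorphism U (z ` U) z (inv_into U z)"
    by auto
  show "open U" "open (z ` U)" by fact+
  show "inj_on z U"
    using homeomorphism_apply1[OF c(3)] by (rule inj_on_inverseI)
  show "continuous_on U z" "continuous_on (z ` U) (inv_into U z)"
    by (fact homeomorphism_cont1[OF c(3)], fact homeomorphism_cont2[OF c(3)])
qed

lemma transition_holomorphic:
  assumes "riemann_surface X" "(U, z) \<in> X" "(V, w) \<in> X"
  shows "(w \<circ> inv_into U z) holomorphic_on z ` (U \<inter> V)"
  using assms unfolding riemann_surface_def by blast

lemma open_chart_image:
  assumes X: "riemann_surface X" "(U, z) \<in> X" and W: "open W"
  shows "open (z ` (U \<inter> W))"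
proof -
  note c = riemann_surfaceD[OF X]
  have "z ` (U \<inter> W) = z ` U \<inter> inv_into U z -` (U \<inter> W)"
    using c(3) by (force simp: inv_into_into)
  also have "open \<dots>"
    using continuous_on_open_vimage[OF c(2)] c(1,5) W by (metis Int_commute open_Int)
  finally show ?thesis .
qed

lemma open_chart_vimage:
  assumes "riemann_surface X" "(U, z) \<in> X" and "open S"
  shows "open (U \<inter> z -` S)"
  using riemann_surfaceD[OF assms(1,2)] assms(3) continuous_open_preimage by blast

lemma eventually_nhds_chart:
  assumes X: "riemann_surface X" "(U, z) \<in> X" and x: "x \<in> U"
  shows "eventually P (nhds x) \<longleftrightarrow> eventually (\<lambda>\<zeta>. P (inv_into U z \<zeta>)) (nhds (z x))"
proof -
  note c = riemann_surfaceD[OF X]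
  show ?thesis
  proof
    assume "eventually P (nhds x)"
    then obtain W where W: "open W" "x \<in> W" "\<forall>p\<in>W. P p" by (auto simp: eventually_nhds)
    have "\<forall>\<zeta>\<in>z ` (U \<inter> W). P (inv_into U z \<zeta>)" using W(3) c(3) by auto
    then show "eventually (\<lambda>\<zeta>. P (inv_into U z \<zeta>)) (nhds (z x))"
      using open_chart_image[OF X W(1)] x W(2) unfolding eventually_nhds by blast
  next
    assume "eventually (\<lambda>\<zeta>. P (inv_into U z \<zeta>)) (nhds (z x))"
    then obtain S where S: "open S" "z x \<in> S" "\<forall>\<zeta>\<in>S. P (inv_into U z \<zeta>)"
      by (auto simp: eventually_nhds)
    have "\<forall>p\<in>U \<inter> z -` S. P p"
      using S(3) c(3) by (metis IntD1 IntD2 inv_into_f_f vimageD)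
    then show "eventually P (nhds x)"
      using open_chart_vimage[OF X S(1)] x S(2) unfolding eventually_nhds by blast
  qed
qed

lemma eventually_at_chart:
  assumes X: "riemann_surface X" "(U, z) \<in> X" and x: "x \<in> U"
  shows "eventually P (at x) \<longleftrightarrow> eventually (\<lambda>\<zeta>. P (inv_into U z \<zeta>)) (at (z x))"
proof -
  note c = riemann_surfaceD[OF X]
  have "eventually P (at x) \<longleftrightarrow> eventually (\<lambda>p. p \<noteq> x \<longrightarrow> P p) (nhds x)"
    by (simp add: eventually_at_filter)
  also have "\<dots> \<longleftrightarrow> eventually (\<lambda>\<zeta>. inv_into U z \<zeta> \<noteq> x \<longrightarrow> P (inv_into U z \<zeta>)) (nhds (z x))"
    by (rule eventually_nhds_chart[OF assms])
  also have "\<dots> \<longleftrightarrow> eventually (\<lambda>\<zeta>. \<zeta> \<noteq> z x \<longrightarrow> P (inv_into U z \<zeta>)) (nhds (z x))"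
  proof (rule eventually_cong[OF eventually_nhds_in_open[OF c(2)]])
    fix \<zeta> assume "\<zeta> \<in> z ` U"
    then have "inv_into U z \<zeta> = x \<longleftrightarrow> \<zeta> = z x"
      using x c(3) by (auto simp: f_inv_into_f)
    then show "(inv_into U z \<zeta> \<noteq> x \<longrightarrow> P (inv_into U z \<zeta>)) = (\<zeta> \<noteq> z x \<longrightarrow> P (inv_into U z \<zeta>))"
      by simp
  qed (use x in auto)
  finally show ?thesis by (simp add: eventually_at_filter)
qed

text \<open>Charts are homeomorphisms onto open subsets of the plane, which have no isolated points.
  This gives uniqueness of limits along \<open>at x\<close> and lets \<open>eventually\<close> imply
  \<open>frequently\<close>.\<close>

lemma at_neq_bot:
  fixes X :: "'a::t2_space atlas"
  assumes X: "riemann_surface X"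
  shows "at (x::'a) \<noteq> bot"
proof -
  obtain U z where "(U, z) \<in> X" "x \<in> U"
    using X unfolding riemann_surface_def by blast
  from eventually_at_chart[OF X this, of "\<lambda>_. False"] show ?thesis
    by (auto simp: trivial_limit_def[symmetric])
qed

section \<open>Holomorphic germs in charts\<close>

lemma analytic_at_transform:
  assumes "f analytic_on {x}" "\<forall>\<^sub>F y in nhds x. f y = g y"
  shows "g analytic_on {x}"
  using analytic_at_cong[OF assms(2) refl] assms(1) by simp

text \<open>Transition maps are holomorphic, so a single chart around x decides, although
  \<open>hol_fun\<close> quantifies over all charts.\<close>

lemma hol_at_iff_analytic:
  assumes X: "riemann_surface X" "(U, z) \<in> X" and x: "x \<in> U"
  shows "hol_at X x g \<longleftrightarrow> (g \<circ> inv_into U z) analytic_on {z x}"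
proof
  assume "hol_at X x g"
  then obtain W where W: "open W" "x \<in> W" "hol_fun X W g" by (auto simp: hol_at_def)
  then have "(g \<circ> inv_into U z) holomorphic_on z ` (U \<inter> W)"
    using X by (auto simp: hol_fun_def)
  then show "(g \<circ> inv_into U z) analytic_on {z x}"
    unfolding analytic_at using open_chart_image[OF X W(1)] x W(2) by blast
next
  note c = riemann_surfaceD[OF X]
  assume "(g \<circ> inv_into U z) analytic_on {z x}"
  then obtain S where S: "open S" "z x \<in> S" "(g \<circ> inv_into U z) holomorphic_on S"
    unfolding analytic_at by blast
  have "hol_fun X (U \<inter> z -` S) g"
    unfolding hol_fun_def
  proof clarify
    fix V w assume V: "(V, w) \<in> X"
    note d = riemann_surfaceD[OF X(1) V]
    let ?A = "w ` (V \<inter> (U \<inter> z -` S))"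
    have "(z \<circ> inv_into V w) holomorphic_on ?A"
      by (rule holomorphic_on_subset[OF transition_holomorphic[OF X(1) V X(2)]]) auto
    moreover have "(z \<circ> inv_into V w) ` ?A \<subseteq> S" using d(3) by auto
    ultimately have "(g \<circ> inv_into U z) \<circ> (z \<circ> inv_into V w) holomorphic_on ?A"
      using S(3) holomorphic_on_compose_gen by blast
    moreover have "((g \<circ> inv_into U z) \<circ> (z \<circ> inv_into V w)) \<zeta> = (g \<circ> inv_into V w) \<zeta>"
      if "\<zeta> \<in> ?A" for \<zeta> using that c(3) d(3) by auto
    ultimately show "(g \<circ> inv_into V w) holomorphic_on ?A"
      by (rule holomorphic_transform)
  qed
  then show "hol_at X x g"
    unfolding hol_at_def using open_chart_vimage[OF X S(1)] x S(2) by blast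
qed

lemma chart_exists:
  assumes "riemann_surface X"
  obtains U z where "(U, z) \<in> X" "x \<in> U"
  using assms unfolding riemann_surface_def by blast

lemma hol_fun_iff_hol_at:
  assumes X: "riemann_surface X" and W: "open W"
  shows "hol_fun X W g \<longleftrightarrow> (\<forall>x\<in>W. hol_at X x g)"
proof
  assume "hol_fun X W g" then show "\<forall>x\<in>W. hol_at X x g" using W by (auto simp: hol_at_def)
next
  assume h: "\<forall>x\<in>W. hol_at X x g"
  show "hol_fun X W g"
    unfolding hol_fun_def
  proof clarify
    fix U z assume U: "(U, z) \<in> X"
    have "(g \<circ> inv_into U z) analytic_on {z x}" if "x \<in> U \<inter> W" for x
      using hol_at_iff_analytic[OF X U] h that by auto
    then have "(g \<circ> inv_into U z) analytic_on z ` (U \<inter> W)"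
      using analytic_on_analytic_at by blast
    then show "(g \<circ> inv_into U z) holomorphic_on z ` (U \<inter> W)"
      by (rule analytic_imp_holomorphic)
  qed
qed

lemma hol_at_const [simp]: "riemann_surface X \<Longrightarrow> hol_at X x (\<lambda>_. c)"
  by (rule chart_exists[of X x]) (auto simp: hol_at_iff_analytic o_def)

lemma hol_at_add:
  assumes "riemann_surface X" "hol_at X x g" "hol_at X x h"
  shows "hol_at X x (\<lambda>p. g p + h p)"
proof -
  obtain U z where U: "(U, z) \<in> X" "x \<in> U" using chart_exists assms(1) .
  show ?thesis using assms unfolding hol_at_iff_analytic[OF assms(1) U]
    by (auto simp: o_def intro: analytic_on_add)
qed

lemma hol_at_mult:
  assumes "riemann_surface X" "hol_at X x g" "hol_at X x h"
  shows "hol_at X x (\<lambda>p. g p * h p)"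
proof -
  obtain U z where U: "(U, z) \<in> X" "x \<in> U" using chart_exists assms(1) .
  show ?thesis using assms unfolding hol_at_iff_analytic[OF assms(1) U]
    by (auto simp: o_def intro: analytic_on_mult)
qed

lemma hol_at_sum:
  assumes "riemann_surface X" "\<And>i. i \<in> I \<Longrightarrow> hol_at X x (g i)"
  shows "hol_at X x (\<lambda>p. \<Sum>i\<in>I. g i p)"
  using assms(2)
  by (induction I rule: infinite_finite_induct) (auto simp: assms(1) intro: hol_at_add)

lemma hol_at_inverse:
  assumes "riemann_surface X" "hol_at X x g" "g x \<noteq> 0"
  shows "hol_at X x (\<lambda>p. inverse (g p))"
proof -
  obtain U z where U: "(U, z) \<in> X" "x \<in> U" using chart_exists assms(1) .
  have "inv_into U z (z x) = x" using riemann_surfaceD(3)[OF assms(1) U(1)] U(2) by simp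
  then show ?thesis using assms unfolding hol_at_iff_analytic[OF assms(1) U]
    by (auto simp: o_def intro: analytic_on_inverse)
qed

lemma hol_at_power:
  assumes "riemann_surface X" "hol_at X x g"
  shows "hol_at X x (\<lambda>p. g p ^ n)"
  by (induction n) (use assms in \<open>auto intro: hol_at_mult\<close>)

lemma hol_at_powi:
  assumes "riemann_surface X" "hol_at X x g" "g x \<noteq> 0"
  shows "hol_at X x (\<lambda>p. g p powi k)"
  unfolding power_int_def using assms hol_at_inverse hol_at_power
  by (cases "k \<ge> 0") (auto simp: hol_at_power hol_at_inverse)

lemma hol_at_isCont:
  assumes X: "riemann_surface X" and g: "hol_at X x g"
  shows "isCont g x"
proof -
  obtain U z where U: "(U, z) \<in> X" "x \<in> U" using chart_exists X .
  note c = riemann_surfaceD[OF X U(1)]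
  have 1: "isCont (g \<circ> inv_into U z) (z x)"
    using g unfolding hol_at_iff_analytic[OF X U] by (rule analytic_at_imp_isCont)
  have 2: "isCont z x" using c U(2) continuous_on_eq_continuous_at by blast
  have i: "isCont ((g \<circ> inv_into U z) \<circ> z) x"
    using isCont_o2[OF 2 1] by (simp add: o_def)
  have "\<forall>\<^sub>F p in nhds x. ((g \<circ> inv_into U z) \<circ> z) p = g p"
    using eventually_nhds_in_open[OF c(1) U(2)] by eventually_elim (use c(3) in auto)
  with i show ?thesis using isCont_cong[of "(g \<circ> inv_into U z) \<circ> z" g x] by simp
qed

lemma hol_at_eventually_nonzero:
  assumes "riemann_surface X" "hol_at X x g" "g x \<noteq> 0"
  shows "\<forall>\<^sub>F p in nhds x. g p \<noteq> 0"
proof -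
  have "(g \<longlongrightarrow> g x) (at x)" using hol_at_isCont[OF assms(1,2)] by (simp add: isCont_def)
  then have "(g \<longlongrightarrow> g x) (nhds x)" by (simp add: tendsto_at_iff_tendsto_nhds)
  then show ?thesis using assms(3) tendsto_imp_eventually_ne by blast
qed

lemma hol_at_chart:
  assumes "riemann_surface X" "(U, z) \<in> X" "x \<in> U"
  shows "hol_at X x z"
proof -
  note c = riemann_surfaceD[OF assms(1,2)]
  have "(\<lambda>\<zeta>. \<zeta>) analytic_on {z x}" by simp
  moreover have "\<forall>\<^sub>F \<zeta> in nhds (z x). \<zeta> = (z \<circ> inv_into U z) \<zeta>"
    using eventually_nhds_in_open[OF c(2), of "z x"] assms(3)
    by (auto elim!: eventually_mono simp: f_inv_into_f)
  ultimately show ?thesis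
    unfolding hol_at_iff_analytic[OF assms] by (rule analytic_at_transform)
qed

section \<open>Composition with holomorphic maps\<close>

lemma holomorphic_mapD:
  assumes "holomorphic_map Y X f"
  shows "continuous_on UNIV f"
    "(V, w) \<in> Y \<Longrightarrow> (U, z) \<in> X \<Longrightarrow> (z \<circ> f \<circ> inv_into V w) holomorphic_on w ` (V \<inter> f -` U)"
    "open S \<Longrightarrow> open (f -` S)" "isCont f y"
  using assms unfolding holomorphic_map_def
  by (auto simp: continuous_on_eq_continuous_at intro: open_vimage)

lemma hol_at_compose:
  assumes X: "riemann_surface X" and Y: "riemann_surface Y" and f: "holomorphic_map Y X f"
    and g: "hol_at X (f y) g"
  shows "hol_at Y y (\<lambda>p. g (f p))"
proof -
  obtain U z where U: "(U, z) \<in> X" "f y \<in> U" using chart_exists X .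
  obtain V w where V: "(V, w) \<in> Y" "y \<in> V" using chart_exists Y .
  note c = riemann_surfaceD[OF X U(1)]
  note d = riemann_surfaceD[OF Y V(1)]
  have o: "open (w ` (V \<inter> f -` U))"
    by (rule open_chart_image[OF Y V(1)]) (use holomorphic_mapD(3)[OF f c(1)] in auto)
  have m: "w y \<in> w ` (V \<inter> f -` U)" using U V by auto
  have "(z \<circ> f \<circ> inv_into V w) analytic_on {w y}"
    using holomorphic_mapD(2)[OF f V(1) U(1)] o m unfolding analytic_at by blast
  moreover have "(g \<circ> inv_into U z) analytic_on (z \<circ> f \<circ> inv_into V w) ` {w y}"
    using g V(2) d(3) unfolding hol_at_iff_analytic[OF X U] by simp
  ultimately have "((g \<circ> inv_into U z) \<circ> (z \<circ> f \<circ> inv_into V w)) analytic_on {w y}"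
    by (rule analytic_on_compose)
  moreover have "\<forall>\<^sub>F \<zeta> in nhds (w y).
      ((g \<circ> inv_into U z) \<circ> (z \<circ> f \<circ> inv_into V w)) \<zeta> = ((\<lambda>p. g (f p)) \<circ> inv_into V w) \<zeta>"
    using eventually_nhds_in_open[OF o m] by eventually_elim (use c(3) d(3) in auto)
  ultimately show ?thesis
    unfolding hol_at_iff_analytic[OF Y V] by (rule analytic_at_transform)
qed

section \<open>The selected coordinate at a point\<close>

lemma chart_at_mem:
  assumes "riemann_surface X"
  shows "(fst (chart_at X x), snd (chart_at X x)) \<in> X" "x \<in> fst (chart_at X x)"
proof -
  obtain U z where "(U, z) \<in> X" "x \<in> U" using chart_exists assms .
  then have "\<exists>c. c \<in> X \<and> x \<in> fst c" by (intro exI[of _ "(U, z)"]) simp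
  from someI_ex[OF this] show "(fst (chart_at X x), snd (chart_at X x)) \<in> X" "x \<in> fst (chart_at X x)"
    unfolding chart_at_def by simp_all
qed

lemma hol_at_coord_at:
  assumes X: "riemann_surface X" and p: "p \<in> fst (chart_at X x)"
  shows "hol_at X p (coord_at X x)"
proof -
  have "hol_at X p (\<lambda>q. snd (chart_at X x) q + (- snd (chart_at X x) x))"
    by (intro hol_at_add hol_at_const X hol_at_chart[OF X chart_at_mem(1)[OF X] p])
  then show ?thesis by (simp add: coord_at_def[abs_def])
qed

lemma coord_at_self [simp]: "coord_at X x x = 0"
  by (simp add: coord_at_def)

lemma coord_at_nonzero:
  assumes X: "riemann_surface X" and p: "p \<in> fst (chart_at X x)" "p \<noteq> x"
  shows "coord_at X x p \<noteq> 0"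
  using riemann_surfaceD(3)[OF X chart_at_mem(1)[OF X, of x]] p chart_at_mem(2)[OF X, of x]
  by (auto simp: coord_at_def inj_on_def)

lemma eventually_chart_at:
  assumes X: "riemann_surface X"
  shows "\<forall>\<^sub>F p in nhds x. p \<in> fst (chart_at X x)"
  by (rule eventually_nhds_in_open)
    (use riemann_surfaceD(1)[OF X chart_at_mem(1)[OF X]] chart_at_mem(2)[OF X] in auto)

lemma eventually_coord_at_nonzero:
  assumes X: "riemann_surface X"
  shows "\<forall>\<^sub>F p in at x. coord_at X x p \<noteq> 0"
  using eventually_chart_at[OF X] unfolding eventually_at_filter
  by eventually_elim (use coord_at_nonzero[OF X] in auto)

section \<open>Orders of vanishing\<close>

text \<open>With its converse \<open>meromorphic_factor\<close>, this lets orders of vanishing be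
  handled through factorizations into a power and a unit, which multiply and compose well.\<close>

lemma zorder_factor:
  fixes G H :: "complex \<Rightarrow> complex"
  assumes H: "H analytic_on {a}" "H a \<noteq> 0"
    and G: "\<forall>\<^sub>F \<zeta> in at a. G \<zeta> = (\<zeta> - a) powi k * H \<zeta>"
  shows "zorder G a = k" "G meromorphic_on {a}"
proof -
  obtain S where S: "open S" "a \<in> S" "H holomorphic_on S"
    using H(1) unfolding analytic_at by blast
  obtain T where T: "open T" "a \<in> T" "\<And>\<zeta>. \<zeta> \<in> T \<Longrightarrow> \<zeta> \<noteq> a \<Longrightarrow> G \<zeta> = (\<zeta> - a) powi k * H \<zeta>"
    using G unfolding eventually_at_topological by blast
  show "zorder G a = k"
    by (rule zorder_eqI[of "S \<inter> T" a H])
      (use S T H in \<open>auto simp: mult.commute intro: holomorphic_on_subset\<close>)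
  have "(\<lambda>\<zeta>. (\<zeta> - a) powi k * H \<zeta>) meromorphic_on {a}"
    by (intro meromorphic_intros analytic_on_imp_meromorphic_on H)
  then show "G meromorphic_on {a}"
    using meromorphic_on_cong[of "{a}" G "\<lambda>\<zeta>. (\<zeta> - a) powi k * H \<zeta>" "{a}"] G by simp
qed

lemma meromorphic_factor:
  fixes G :: "complex \<Rightarrow> complex"
  assumes "G meromorphic_on {a}" "\<exists>\<^sub>F \<zeta> in at a. G \<zeta> \<noteq> 0"
  obtains H where "H analytic_on {a}" "H a \<noteq> 0"
    "\<forall>\<^sub>F \<zeta> in at a. G \<zeta> = (\<zeta> - a) powi zorder G a * H \<zeta>"
proof -
  from zorder_exist[OF meromorphic_on_isolated_singularity[OF assms(1)]
      meromorphic_on_not_essential[OF assms(1)] assms(2)]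
  obtain r where r: "zor_poly G a a \<noteq> 0" "r > 0" "zor_poly G a holomorphic_on cball a r"
    "\<forall>w\<in>cball a r - {a}. G w = zor_poly G a w * (w - a) powi zorder G a"
    by auto
  show ?thesis
  proof
    show "zor_poly G a analytic_on {a}"
      unfolding analytic_at using r holomorphic_on_subset[OF r(3) ball_subset_cball]
      by (intro exI[of _ "ball a r"]) auto
    show "zor_poly G a a \<noteq> 0" by fact
    show "\<forall>\<^sub>F \<zeta> in at a. G \<zeta> = (\<zeta> - a) powi zorder G a * zor_poly G a \<zeta>"
      unfolding eventually_at_topological using r
      by (intro exI[of _ "ball a r"]) (auto simp: mult.commute)
  qed
qed

lemma zorder_pos:
  fixes G :: "complex \<Rightarrow> complex"
  assumes "G analytic_on {a}" "G a = 0" "\<exists>\<^sub>F \<zeta> in at a. G \<zeta> \<noteq> 0"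
  shows "zorder G a > 0"
proof -
  obtain S where S: "open S" "a \<in> S" "G holomorphic_on S"
    using assms(1) unfolding analytic_at by blast
  obtain r where r: "r > 0" "ball a r \<subseteq> S" using S openE by blast
  have "\<exists>w\<in>ball a r. G w \<noteq> 0"
  proof (rule ccontr)
    assume "\<not> ?thesis"
    then have "\<forall>\<^sub>F \<zeta> in at a. G \<zeta> = 0"
      unfolding eventually_at_topological using r(1) by (intro exI[of _ "ball a r"]) auto
    then show False using assms(3) by (simp add: frequently_def)
  qed
  from zorder_exist_zero[OF holomorphic_on_subset[OF S(3) r(2)] _ _ _ this]
  show ?thesis using r(1) assms(2) by simp
qed

text \<open>A relation instead of the function \<open>ord_at\<close>: the value of
  \<open>ord_at\<close> means something only for meromorphic germs that are not identically zero
  near x, and the factorization carries this condition along with the order.\<close>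

definition has_order_at :: "'a::t2_space atlas \<Rightarrow> 'a \<Rightarrow> ('a \<Rightarrow> complex) \<Rightarrow> int \<Rightarrow> bool" where
  "has_order_at X x g k \<longleftrightarrow>
     (\<exists>h. hol_at X x h \<and> h x \<noteq> 0 \<and> (\<forall>\<^sub>F p in at x. g p = coord_at X x p powi k * h p))"

lemma has_order_atI:
  assumes "hol_at X x h" "h x \<noteq> 0" "\<forall>\<^sub>F p in at x. g p = coord_at X x p powi k * h p"
  shows "has_order_at X x g k"
  using assms unfolding has_order_at_def by blast

lemma has_order_atE:
  assumes "has_order_at X x g k"
  obtains h where "hol_at X x h" "h x \<noteq> 0" "\<forall>\<^sub>F p in at x. g p = coord_at X x p powi k * h p"
  using assms unfolding has_order_at_def by blast

lemma in_chart_at_eq: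
  "in_chart_at X x g = g \<circ> inv_into (fst (chart_at X x)) (snd (chart_at X x))"
  by (simp add: in_chart_at_def case_prod_beta)

text \<open>In the selected chart the coordinate centred at x becomes \<open>\<zeta> - z x\<close>,
  so factorizations on the surface and in the plane correspond term by term.\<close>

lemma has_order_at_iff:
  assumes X: "riemann_surface X"
  shows "has_order_at X x g k \<longleftrightarrow>
    (\<exists>H. H analytic_on {snd (chart_at X x) x} \<and> H (snd (chart_at X x) x) \<noteq> 0 \<and>
      (\<forall>\<^sub>F \<zeta> in at (snd (chart_at X x) x).
        in_chart_at X x g \<zeta> = (\<zeta> - snd (chart_at X x) x) powi k * H \<zeta>))"
proof -
  define U z where "U = fst (chart_at X x)" "z = snd (chart_at X x)"
  note U = chart_at_mem[OF X, of x, folded U_z_def]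
  note c = riemann_surfaceD[OF X U(1)]
  note ev = eventually_at_chart[OF X U]
  have coord: "\<forall>\<^sub>F \<zeta> in at (z x). \<zeta> \<in> z ` U"
    using eventually_nhds_in_open[OF c(2), of "z x"] U(2)
    by (auto simp: eventually_at_filter elim: eventually_mono)
  have iz: "coord_at X x (inv_into U z \<zeta>) = \<zeta> - z x" if "\<zeta> \<in> z ` U" for \<zeta>
    using that unfolding coord_at_def U_z_def[symmetric] by (simp add: f_inv_into_f)
  have fx: "inv_into U z (z x) = x" using U(2) c(3) by simp
  show ?thesis
    unfolding U_z_def[symmetric] in_chart_at_eq
  proof
    assume "has_order_at X x g k"
    then obtain h where h: "hol_at X x h" "h x \<noteq> 0"
        "\<forall>\<^sub>F p in at x. g p = coord_at X x p powi k * h p"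
      by (rule has_order_atE)
    show "\<exists>H. H analytic_on {z x} \<and> H (z x) \<noteq> 0 \<and>
        (\<forall>\<^sub>F \<zeta> in at (z x). (g \<circ> inv_into U z) \<zeta> = (\<zeta> - z x) powi k * H \<zeta>)"
    proof (intro exI[of _ "h \<circ> inv_into U z"] conjI)
      show "(h \<circ> inv_into U z) analytic_on {z x}"
        using h(1) hol_at_iff_analytic[OF X U] by simp
      show "(h \<circ> inv_into U z) (z x) \<noteq> 0" using h(2) fx by simp
      show "\<forall>\<^sub>F \<zeta> in at (z x).
          (g \<circ> inv_into U z) \<zeta> = (\<zeta> - z x) powi k * (h \<circ> inv_into U z) \<zeta>"
        using h(3)[unfolded ev] coord by eventually_elim (simp add: iz)
    qed
  next
    assume "\<exists>H. H analytic_on {z x} \<and> H (z x) \<noteq> 0 \<and>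
        (\<forall>\<^sub>F \<zeta> in at (z x). (g \<circ> inv_into U z) \<zeta> = (\<zeta> - z x) powi k * H \<zeta>)"
    then obtain H where H: "H analytic_on {z x}" "H (z x) \<noteq> 0"
        "\<forall>\<^sub>F \<zeta> in at (z x). (g \<circ> inv_into U z) \<zeta> = (\<zeta> - z x) powi k * H \<zeta>"
      by blast
    show "has_order_at X x g k"
    proof (rule has_order_atI[of X x "H \<circ> z"])
      have "\<forall>\<^sub>F \<zeta> in nhds (z x). H \<zeta> = (H \<circ> z \<circ> inv_into U z) \<zeta>"
        using eventually_nhds_in_open[OF c(2), of "z x"] U(2)
        by (auto elim!: eventually_mono simp: f_inv_into_f)
      then show "hol_at X x (H \<circ> z)"
        unfolding hol_at_iff_analytic[OF X U] using H(1) by (rule analytic_at_transform[rotated])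
      show "(H \<circ> z) x \<noteq> 0" using H(2) by simp
      show "\<forall>\<^sub>F p in at x. g p = coord_at X x p powi k * (H \<circ> z) p"
        unfolding ev using H(3) coord by eventually_elim (simp add: iz f_inv_into_f)
    qed
  qed
qed

lemma has_order_at_imp_ord_at:
  assumes "riemann_surface X" "has_order_at X x g k"
  shows "ord_at X x g = k"
  using assms(2) unfolding has_order_at_iff[OF assms(1)] ord_at_def by (elim exE conjE) (rule zorder_factor(1))

lemma has_order_at_imp_mero_at:
  assumes "riemann_surface X" "has_order_at X x g k"
  shows "mero_at X x g"
  using assms(2) unfolding has_order_at_iff[OF assms(1)] mero_at_def by (elim exE conjE) (rule zorder_factor(2))

lemma has_order_at_ord_at:
  assumes X: "riemann_surface X" and g: "mero_at X x g" "\<exists>\<^sub>F p in at x. g p \<noteq> 0"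
  shows "has_order_at X x g (ord_at X x g)"
proof -
  have "\<exists>\<^sub>F \<zeta> in at (snd (chart_at X x) x). in_chart_at X x g \<zeta> \<noteq> 0"
    using g(2) unfolding frequently_def eventually_at_chart[OF X chart_at_mem[OF X, of x]] in_chart_at_eq
    by simp
  from g(1)[unfolded mero_at_def] this obtain H where "H analytic_on {snd (chart_at X x) x}"
    "H (snd (chart_at X x) x) \<noteq> 0" "\<forall>\<^sub>F \<zeta> in at (snd (chart_at X x) x). in_chart_at X x g \<zeta> =
      (\<zeta> - snd (chart_at X x) x) powi zorder (in_chart_at X x g) (snd (chart_at X x) x) * H \<zeta>"
    by (rule meromorphic_factor)
  then show ?thesis
    unfolding has_order_at_iff[OF X] ord_at_def by (intro exI[of _ H] conjI)
qed

lemma has_order_at_cong: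
  assumes "\<forall>\<^sub>F p in at x. g p = h p" "has_order_at X x g k"
  shows "has_order_at X x h k"
proof -
  obtain u where u: "hol_at X x u" "u x \<noteq> 0" "\<forall>\<^sub>F p in at x. g p = coord_at X x p powi k * u p"
    using assms(2) by (rule has_order_atE)
  show ?thesis
    by (rule has_order_atI[OF u(1,2)]) (use u(3) assms(1) in eventually_elim, simp)
qed

lemma has_order_at_unit:
  assumes "hol_at X x g" "g x \<noteq> 0"
  shows "has_order_at X x g 0"
  by (rule has_order_atI[OF assms]) simp

lemma has_order_at_coord:
  assumes "riemann_surface X"
  shows "has_order_at X x (\<lambda>p. coord_at X x p powi k) k"
  by (rule has_order_atI[of _ _ "\<lambda>_. 1"]) (use assms in auto)

lemma has_order_at_mult:
  assumes X: "riemann_surface X" and g: "has_order_at X x g k" and h: "has_order_at X x h l"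
  shows "has_order_at X x (\<lambda>p. g p * h p) (k + l)"
proof -
  obtain u where u: "hol_at X x u" "u x \<noteq> 0" "\<forall>\<^sub>F p in at x. g p = coord_at X x p powi k * u p"
    using g by (rule has_order_atE)
  obtain v where v: "hol_at X x v" "v x \<noteq> 0" "\<forall>\<^sub>F p in at x. h p = coord_at X x p powi l * v p"
    using h by (rule has_order_atE)
  show ?thesis
  proof (rule has_order_atI)
    show "hol_at X x (\<lambda>p. u p * v p)" by (rule hol_at_mult[OF X u(1) v(1)])
    show "u x * v x \<noteq> 0" using u v by simp
    show "\<forall>\<^sub>F p in at x. g p * h p = coord_at X x p powi (k + l) * (u p * v p)"
      using u(3) v(3) eventually_coord_at_nonzero[OF X, of x]
      by eventually_elim (simp add: power_int_add)
  qed
qed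

lemma has_order_at_inverse:
  assumes X: "riemann_surface X" and g: "has_order_at X x g k"
  shows "has_order_at X x (\<lambda>p. inverse (g p)) (- k)"
proof -
  obtain u where u: "hol_at X x u" "u x \<noteq> 0" "\<forall>\<^sub>F p in at x. g p = coord_at X x p powi k * u p"
    using g by (rule has_order_atE)
  show ?thesis
  proof (rule has_order_atI)
    show "hol_at X x (\<lambda>p. inverse (u p))" by (rule hol_at_inverse[OF X u(1,2)])
    show "inverse (u x) \<noteq> 0" using u by simp
    show "\<forall>\<^sub>F p in at x. inverse (g p) = coord_at X x p powi (- k) * inverse (u p)"
      using u(3) by eventually_elim (simp add: power_int_minus)
  qed
qed

lemma has_order_at_power:
  assumes "riemann_surface X" "has_order_at X x g k"
  shows "has_order_at X x (\<lambda>p. g p ^ n) (int n * k)"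
proof (induction n)
  case 0
  show ?case using has_order_at_unit[of X x "\<lambda>_. 1"] assms(1) by simp
next
  case (Suc n)
  show ?case using has_order_at_mult[OF assms Suc] by (simp add: algebra_simps)
qed

lemma has_order_at_powi:
  assumes "riemann_surface X" "has_order_at X x g k"
  shows "has_order_at X x (\<lambda>p. g p powi n) (n * k)"
proof (cases "n \<ge> 0")
  case True
  then show ?thesis using has_order_at_power[OF assms, of "nat n"] by (simp add: power_int_def)
next
  case False
  then show ?thesis
    using has_order_at_power[OF assms(1) has_order_at_inverse[OF assms], of "nat (- n)"]
    by (simp add: power_int_def)
qed

lemma has_order_at_nonzero:
  assumes X: "riemann_surface X" and g: "has_order_at X x g k"
  shows "\<forall>\<^sub>F p in at x. g p \<noteq> 0"
proof -
  obtain u where u: "hol_at X x u" "u x \<noteq> 0" "\<forall>\<^sub>F p in at x. g p = coord_at X x p powi k * u p"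
    using g by (rule has_order_atE)
  have "\<forall>\<^sub>F p in at x. u p \<noteq> 0"
    using hol_at_eventually_nonzero[OF X u(1,2)] by (auto simp: eventually_at_filter elim: eventually_mono)
  with u(3) eventually_coord_at_nonzero[OF X, of x] show ?thesis
    by eventually_elim simp
qed

lemma has_order_at_frequently:
  assumes "riemann_surface X" "has_order_at X x g k"
  shows "\<exists>\<^sub>F p in at x. g p \<noteq> 0"
  using has_order_at_nonzero[OF assms] at_neq_bot[OF assms(1)] eventually_frequently by blast

text \<open>An injective holomorphic function has nowhere vanishing derivative; applied to the
  transition map, this shows that every chart, and not only the selected one, gives a coordinate of
  order 1.\<close>

lemma has_order_at_chart:
  assumes X: "riemann_surface X" and U: "(U, z) \<in> X" "x \<in> U"
  shows "has_order_at X x (\<lambda>p. z p - z x) 1"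
proof -
  define V w where "V = fst (chart_at X x)" "w = snd (chart_at X x)"
  note V = chart_at_mem[OF X, of x, folded V_w_def]
  note c = riemann_surfaceD[OF X U(1)] and d = riemann_surfaceD[OF X V(1)]
  define T where "T = (\<lambda>\<zeta>. z (inv_into V w \<zeta>) - z x)"
  let ?S = "w ` (V \<inter> U)"
  have S: "open ?S" "w x \<in> ?S" using open_chart_image[OF X V(1) c(1)] U(2) V(2) by auto
  have hol: "T holomorphic_on ?S"
    using transition_holomorphic[OF X V(1) U(1)] unfolding T_def o_def by (intro holomorphic_intros)
  have inj: "inj_on T ?S" unfolding T_def using c(3) d(3) by (auto simp: inj_on_def)
  have T: "in_chart_at X x (\<lambda>p. z p - z x) = T"
    by (simp add: in_chart_at_eq V_w_def T_def fun_eq_iff)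
  have Tw: "T (w x) = 0" using V(2) d(3) by (simp add: T_def)
  have "zorder T (w x) = 1"
  proof (rule zorder_zero_eqI[OF hol S])
    show "(deriv ^^ nat 1) T (w x) \<noteq> 0"
      using holomorphic_injective_imp_regular[OF hol S(1) inj S(2)] by simp
  qed (auto simp: Tw)
  then have o: "ord_at X x (\<lambda>p. z p - z x) = 1" by (simp add: ord_at_def T V_w_def(2)[symmetric])
  have "mero_at X x (\<lambda>p. z p - z x)"
    unfolding mero_at_def T V_w_def(2)[symmetric]
    by (rule analytic_on_imp_meromorphic_on) (use hol S in \<open>auto simp: analytic_at\<close>)
  moreover have "\<forall>\<^sub>F p in at x. z p - z x \<noteq> 0"
    using eventually_nhds_in_open[OF c(1) U(2)] unfolding eventually_at_filter
    by eventually_elim (use c(3) U(2) in \<open>auto simp: inj_on_def\<close>)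
  then have "\<exists>\<^sub>F p in at x. z p - z x \<noteq> 0"
    using at_neq_bot[OF X] eventually_frequently by blast
  ultimately show ?thesis using has_order_at_ord_at[OF X] o by metis
qed

text \<open>\<open>ord_at\<close> is measured in the chart selected at x. Rouche's theorem counts
  zeros at many points inside one fixed chart, so orders must be readable in any chart.\<close>

lemma zorder_in_chart:
  assumes X: "riemann_surface X" and U: "(U, z) \<in> X" "x \<in> U" and g: "has_order_at X x g k"
  shows "zorder (\<lambda>\<zeta>. g (inv_into U z \<zeta>)) (z x) = k"
proof -
  note c = riemann_surfaceD[OF X U(1)]
  \<comment> \<open>Dividing by the k-th power of the given coordinate leaves order 0, that is, a
    unit u.\<close>
  have "has_order_at X x (\<lambda>p. g p * (z p - z x) powi (- k)) (k + - k * 1)"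
    by (intro has_order_at_mult has_order_at_powi has_order_at_chart[OF X U] X g)
  then obtain u where u: "hol_at X x u" "u x \<noteq> 0"
      "\<forall>\<^sub>F p in at x. g p * (z p - z x) powi (- k) = coord_at X x p powi 0 * u p"
    by (auto elim: has_order_atE)
  have "\<forall>\<^sub>F p in at x. g p = (z p - z x) powi k * u p"
    using u(3) has_order_at_nonzero[OF X has_order_at_chart[OF X U]]
    by eventually_elim (simp add: power_int_minus field_simps)
  then have "\<forall>\<^sub>F \<zeta> in at (z x). g (inv_into U z \<zeta>) =
      (z (inv_into U z \<zeta>) - z x) powi k * u (inv_into U z \<zeta>)"
    unfolding eventually_at_chart[OF X U] .
  moreover have "\<forall>\<^sub>F \<zeta> in at (z x). \<zeta> \<in> z ` U"
    using eventually_nhds_in_open[OF c(2), of "z x"] U(2)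
    by (auto simp: eventually_at_filter elim: eventually_mono)
  ultimately have "\<forall>\<^sub>F \<zeta> in at (z x). g (inv_into U z \<zeta>) = (\<zeta> - z x) powi k * (u \<circ> inv_into U z) \<zeta>"
    by eventually_elim (simp add: f_inv_into_f)
  then show ?thesis
    by (rule zorder_factor(1)[rotated 2]) (use u(1,2) U(2) c(3) hol_at_iff_analytic[OF X U, of u] in \<open>auto simp: o_def\<close>)
qed

section \<open>Nonconstant holomorphic maps\<close>

text \<open>The identity theorem on a disc in a chart. The last clause of the second case, that no
  nearby point is a point of local constancy, is what makes the set of such points closed.\<close>

lemma locally_constant_or_isolated:
  assumes X: "riemann_surface X" and Y: "riemann_surface Y" and f: "holomorphic_map Y X f"
  obtains "\<forall>\<^sub>F p in nhds y. f p = f y"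
  | N where "open N" "y \<in> N" "\<And>p. p \<in> N \<Longrightarrow> p \<noteq> y \<Longrightarrow> f p \<noteq> f y"
      "\<And>p. p \<in> N \<Longrightarrow> p \<noteq> y \<Longrightarrow> \<not> (\<forall>\<^sub>F q in nhds p. f q = f p)"
proof -
  obtain U z where U: "(U, z) \<in> X" "f y \<in> U" using chart_exists X .
  obtain V w where V: "(V, w) \<in> Y" "y \<in> V" using chart_exists Y .
  note c = riemann_surfaceD[OF X U(1)]
  note d = riemann_surfaceD[OF Y V(1)]
  define g where "g = z \<circ> f \<circ> inv_into V w"
  have "open (w ` (V \<inter> f -` U))"
    by (rule open_chart_image[OF Y V(1)]) (use holomorphic_mapD(3)[OF f c(1)] in auto)
  moreover have "w y \<in> w ` (V \<inter> f -` U)" using U V by auto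
  ultimately obtain r where r: "r > 0" "ball (w y) r \<subseteq> w ` (V \<inter> f -` U)"
    by (rule openE)
  have fU: "f p \<in> U" if p: "p \<in> V" "w p \<in> ball (w y) r" for p
  proof -
    obtain q where "q \<in> V" "f q \<in> U" "w p = w q" using p(2) r(2) by auto
    then show ?thesis using inj_onD[OF d(3), of p q] p(1) by simp
  qed
  have g: "g (w p) = z (f p)" if "p \<in> V" for p using that d(3) by (simp add: g_def)
  have feq: "f p = f q \<longleftrightarrow> g (w p) = g (w q)"
    if "p \<in> V" "w p \<in> ball (w y) r" "q \<in> V" "w q \<in> ball (w y) r" for p q
    using inj_on_eq_iff[OF c(3) fU fU] that by (simp add: g)
  have hol: "g holomorphic_on ball (w y) r"
    using holomorphic_mapD(2)[OF f V(1) U(1)] r(2) unfolding g_def by (rule holomorphic_on_subset)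
  have wy: "w y \<in> ball (w y) r" using r(1) by simp
  show ?thesis
  proof (cases "\<forall>\<zeta>\<in>ball (w y) r. g \<zeta> = g (w y)")
    case True
    have "\<forall>\<^sub>F p in nhds y. p \<in> V \<inter> w -` ball (w y) r"
      by (rule eventually_nhds_in_open) (use open_chart_vimage[OF Y V(1) open_ball] V(2) wy in simp_all)
    then have "\<forall>\<^sub>F p in nhds y. f p = f y"
    proof eventually_elim
      case (elim p)
      then show ?case using bspec[OF True, of "w p"] V(2) wy feq[of p y] by simp
    qed
    then show ?thesis by (rule that(1))
  next
    case False
    \<comment> \<open>The point \<open>\<beta>\<close> witnesses that g is not constant on the disc.
      It is needed for the isolation of zeros here and for the contradiction by continuation
      below.\<close>
    then obtain \<beta> where \<beta>: "\<beta> \<in> ball (w y) r" "g \<beta> \<noteq> g (w y)" by auto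
    obtain e where e: "e > 0" "ball (w y) e \<subseteq> ball (w y) r"
        "\<And>\<zeta>. \<zeta> \<in> ball (w y) e - {w y} \<Longrightarrow> g \<zeta> - g (w y) \<noteq> 0"
      by (rule isolated_zeros[of "\<lambda>\<zeta>. g \<zeta> - g (w y)" "ball (w y) r" "w y" \<beta>])
        (use hol \<beta> wy in \<open>auto intro!: holomorphic_intros\<close>)
    show ?thesis
    proof (rule that(2)[of "V \<inter> w -` ball (w y) e"])
      show "open (V \<inter> w -` ball (w y) e)" using open_chart_vimage[OF Y V(1)] by simp
      show "y \<in> V \<inter> w -` ball (w y) e" using V(2) e(1) by simp
      fix p assume p: "p \<in> V \<inter> w -` ball (w y) e" "p \<noteq> y"
      then have wp: "w p \<in> ball (w y) r" "w p \<noteq> w y"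
        using e(2) d(3) V(2) by (auto simp: inj_on_def)
      show "f p \<noteq> f y"
        using feq[of p y] e(3)[of "w p"] p wp V(2) wy by auto
      show "\<not> (\<forall>\<^sub>F q in nhds p. f q = f p)"
      proof
        assume "\<forall>\<^sub>F q in nhds p. f q = f p"
        then obtain S where S: "open S" "w p \<in> S" "\<And>\<zeta>. \<zeta> \<in> S \<Longrightarrow> f (inv_into V w \<zeta>) = f p"
          using eventually_nhds_chart[OF Y V(1), of p "\<lambda>q. f q = f p"] p
          by (auto simp: eventually_nhds)
        \<comment> \<open>Constancy of f near p would spread by analytic continuation to the whole
          disc.\<close>
        have "g \<zeta> = g (w p)" if "\<zeta> \<in> ball (w y) r" for \<zeta>
        proof (rule analytic_continuation_open[of "S \<inter> ball (w y) r" "ball (w y) r" g "\<lambda>_. g (w p)"])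
          show "S \<inter> ball (w y) r \<noteq> {}" using S(2) wp by auto
          show "g \<zeta> = g (w p)" if "\<zeta> \<in> S \<inter> ball (w y) r" for \<zeta>
            using S(3)[of \<zeta>] that p d(3) by (simp add: g_def)
        qed (use S hol that in auto)
        from this[OF \<beta>(1)] this[OF wy] show False using \<beta>(2) by simp
      qed
    qed
  qed
qed

text \<open>The set of points where f is locally constant is open and closed. If it were everything,
  connectedness would make f constant; so it is empty, and every point is isolated in its
  fibre.\<close>

lemma eventually_neq_of_nonconstant:
  fixes f :: "'b::t2_space \<Rightarrow> 'a::t2_space"
  assumes X: "riemann_surface X" and Y: "riemann_surface Y" and f: "holomorphic_map Y X f"
    and con: "connected (UNIV :: 'b set)" and nc: "\<not> f constant_on UNIV"
  shows "\<forall>\<^sub>F p in at y. f p \<noteq> f y"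
proof -
  define A where "A = {y. \<forall>\<^sub>F p in nhds y. f p = f y}"
  have "open A"
    unfolding open_subopen[of A]
  proof
    fix y assume "y \<in> A"
    then obtain W where W: "open W" "y \<in> W" "\<forall>p\<in>W. f p = f y"
      by (auto simp: A_def eventually_nhds)
    have "W \<subseteq> A"
    proof
      fix p assume p: "p \<in> W"
      have "\<forall>\<^sub>F q in nhds p. f q = f p"
        using eventually_nhds_in_open[OF W(1) p]
      proof eventually_elim
        case (elim q)
        then show ?case using bspec[OF W(3) p] bspec[OF W(3), of q] by simp
      qed
      then show "p \<in> A" by (simp add: A_def)
    qed
    then show "\<exists>T. open T \<and> y \<in> T \<and> T \<subseteq> A" using W by blast
  qed
  have isol: "\<exists>N. open N \<and> y \<in> N \<and> N \<inter> A = {} \<and> (\<forall>p\<in>N - {y}. f p \<noteq> f y)" if "y \<notin> A" for y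
  proof (rule locally_constant_or_isolated[OF X Y f, of y])
    assume "\<forall>\<^sub>F p in nhds y. f p = f y"
    then show ?thesis using that by (simp add: A_def)
  next
    fix N assume N: "open N" "y \<in> N" "\<And>p. p \<in> N \<Longrightarrow> p \<noteq> y \<Longrightarrow> f p \<noteq> f y"
      "\<And>p. p \<in> N \<Longrightarrow> p \<noteq> y \<Longrightarrow> \<not> (\<forall>\<^sub>F q in nhds p. f q = f p)"
    have "p \<notin> A" if "p \<in> N" for p
      using N(4)[of p] \<open>y \<notin> A\<close> that by (cases "p = y") (auto simp: A_def)
    then show ?thesis using N(1-3) by (intro exI[of _ N]) auto
  qed
  have "open (- A)"
    unfolding open_subopen[of "- A"]
  proof
    fix y assume "y \<in> - A"
    then obtain N where "open N" "y \<in> N" "N \<inter> A = {}" using isol[of y] by auto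
    then show "\<exists>T. open T \<and> y \<in> T \<and> T \<subseteq> - A" by (intro exI[of _ N]) auto
  qed
  then have "A = {} \<or> - A = {}"
    using connectedD[OF con \<open>open A\<close>, of "- A"] by auto
  moreover have "- A \<noteq> {}"
  proof
    assume "- A = {}"
    then have all: "y \<in> A" for y by blast
    have "f a = f b" for a b
    proof (rule connected_local_const[OF con])
      show "\<forall>a\<in>UNIV. \<forall>\<^sub>F b in at a. f a = f b"
      proof
        fix a
        have "\<forall>\<^sub>F b in nhds a. f b = f a" using all[of a] by (simp add: A_def)
        then show "\<forall>\<^sub>F b in at a. f a = f b"
          unfolding eventually_at_filter by eventually_elim simp
      qed
    qed auto
    then have "f constant_on UNIV" unfolding constant_on_def by blast
    then show False using nc by simp
  qed
  ultimately have "y \<notin> A" by simp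
  from isol[OF this] obtain N where "open N" "y \<in> N" "\<forall>p\<in>N - {y}. f p \<noteq> f y" by auto
  then show ?thesis
    unfolding eventually_at_topological by (intro exI[of _ N]) auto
qed

section \<open>The modules \<open>z\<^sup>k \<O>\<^sub>x\<close>\<close>

lemma zpow_moduleI:
  assumes "hol_at X x h" "\<forall>\<^sub>F p in at x. g p = coord_at X x p powi k * h p"
  shows "g \<in> zpow_module X x k"
  using assms by (auto simp: zpow_module_def)

lemma zpow_moduleE:
  assumes "g \<in> zpow_module X x k"
  obtains h where "hol_at X x h" "\<forall>\<^sub>F p in at x. g p = coord_at X x p powi k * h p"
  using assms by (auto simp: zpow_module_def)

lemma zpow_module_cong:
  assumes "g \<in> zpow_module X x k" "\<forall>\<^sub>F p in at x. g p = h p"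
  shows "h \<in> zpow_module X x k"
proof -
  obtain u where u: "hol_at X x u" "\<forall>\<^sub>F p in at x. g p = coord_at X x p powi k * u p"
    using assms(1) by (rule zpow_moduleE)
  show ?thesis
    by (rule zpow_moduleI[OF u(1)]) (use u(2) assms(2) in eventually_elim, simp)
qed

lemma zpow_module_0I: "hol_at X x g \<Longrightarrow> g \<in> zpow_module X x 0"
  by (rule zpow_moduleI) auto

lemma zpow_module_0E:
  assumes "g \<in> zpow_module X x 0"
  obtains h where "hol_at X x h" "\<forall>\<^sub>F p in at x. g p = h p"
  using assms by (auto elim: zpow_moduleE)

lemma has_order_at_imp_zpow_module: "has_order_at X x g k \<Longrightarrow> g \<in> zpow_module X x k"
  by (auto elim: has_order_atE intro: zpow_moduleI)

lemma coord_powi_in_zpow_module: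
  "riemann_surface X \<Longrightarrow> (\<lambda>p. coord_at X x p powi k) \<in> zpow_module X x k"
  by (intro has_order_at_imp_zpow_module has_order_at_coord)

lemma zpow_module_mult:
  assumes X: "riemann_surface X" and "g \<in> zpow_module X x k" "h \<in> zpow_module X x l"
  shows "(\<lambda>p. g p * h p) \<in> zpow_module X x (k + l)"
proof -
  obtain u where u: "hol_at X x u" "\<forall>\<^sub>F p in at x. g p = coord_at X x p powi k * u p"
    using assms(2) by (rule zpow_moduleE)
  obtain v where v: "hol_at X x v" "\<forall>\<^sub>F p in at x. h p = coord_at X x p powi l * v p"
    using assms(3) by (rule zpow_moduleE)
  show ?thesis
  proof (rule zpow_moduleI[OF hol_at_mult[OF X u(1) v(1)]])
    show "\<forall>\<^sub>F p in at x. g p * h p = coord_at X x p powi (k + l) * (u p * v p)"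
      using u(2) v(2) eventually_coord_at_nonzero[OF X, of x]
      by eventually_elim (simp add: power_int_add)
  qed
qed

lemma zpow_module_mono:
  assumes X: "riemann_surface X" and g: "g \<in> zpow_module X x k" and "l \<le> k"
  shows "g \<in> zpow_module X x l"
proof -
  obtain u where u: "hol_at X x u" "\<forall>\<^sub>F p in at x. g p = coord_at X x p powi k * u p"
    using g by (rule zpow_moduleE)
  have "hol_at X x (\<lambda>p. coord_at X x p ^ nat (k - l) * u p)"
    by (intro hol_at_mult hol_at_power hol_at_coord_at X u(1) chart_at_mem)
  then show ?thesis
  proof (rule zpow_moduleI)
    show "\<forall>\<^sub>F p in at x. g p = coord_at X x p powi l * (coord_at X x p ^ nat (k - l) * u p)"
      using u(2) eventually_coord_at_nonzero[OF X, of x]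
    proof eventually_elim
      case (elim p)
      have "coord_at X x p powi k = coord_at X x p powi l * coord_at X x p powi (k - l)"
        using elim(2) by (simp flip: power_int_add)
      also have "coord_at X x p powi (k - l) = coord_at X x p ^ nat (k - l)"
        using \<open>l \<le> k\<close> by (simp add: power_int_def)
      finally show ?case using elim(1) by simp
    qed
  qed
qed

lemma zpow_module_add:
  assumes X: "riemann_surface X" and "g \<in> zpow_module X x k" "h \<in> zpow_module X x k"
  shows "(\<lambda>p. g p + h p) \<in> zpow_module X x k"
proof -
  obtain u where u: "hol_at X x u" "\<forall>\<^sub>F p in at x. g p = coord_at X x p powi k * u p"
    using assms(2) by (rule zpow_moduleE)
  obtain v where v: "hol_at X x v" "\<forall>\<^sub>F p in at x. h p = coord_at X x p powi k * v p"
    using assms(3) by (rule zpow_moduleE)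
  show ?thesis
    by (rule zpow_moduleI[OF hol_at_add[OF X u(1) v(1)]])
      (use u(2) v(2) in eventually_elim, simp add: algebra_simps)
qed

lemma zpow_module_zero: "riemann_surface X \<Longrightarrow> (\<lambda>p. 0) \<in> zpow_module X x k"
  by (rule zpow_moduleI[of _ _ "\<lambda>_. 0"]) auto

lemma zpow_module_sum:
  assumes "riemann_surface X" "\<And>i. i \<in> I \<Longrightarrow> g i \<in> zpow_module X x k"
  shows "(\<lambda>p. \<Sum>i\<in>I. g i p) \<in> zpow_module X x k"
  using assms(2)
  by (induction I rule: infinite_finite_induct)
    (auto simp: assms(1) zpow_module_zero intro: zpow_module_add)

lemma zpow_module_mult_coord:
  assumes X: "riemann_surface X"
  shows "(\<lambda>p. coord_at X x p powi l * g p) \<in> zpow_module X x k \<longleftrightarrow> g \<in> zpow_module X x (k - l)"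
proof
  assume "(\<lambda>p. coord_at X x p powi l * g p) \<in> zpow_module X x k"
  from zpow_module_mult[OF X coord_powi_in_zpow_module[OF X, of x "- l"] this]
  have "(\<lambda>p. coord_at X x p powi - l * (coord_at X x p powi l * g p)) \<in> zpow_module X x (k - l)"
    by simp
  then show "g \<in> zpow_module X x (k - l)"
    by (rule zpow_module_cong)
      (use eventually_coord_at_nonzero[OF X, of x] in eventually_elim, simp add: power_int_minus)
next
  assume "g \<in> zpow_module X x (k - l)"
  from zpow_module_mult[OF X coord_powi_in_zpow_module[OF X, of x "l"] this]
  show "(\<lambda>p. coord_at X x p powi l * g p) \<in> zpow_module X x k" by simp
qed

lemma has_order_at_zero:
  assumes X: "riemann_surface X" and g: "hol_at X x g" "g x = 0" and fr: "\<exists>\<^sub>F p in at x. g p \<noteq> 0"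
  shows "has_order_at X x g (ord_at X x g)" "ord_at X x g > 0"
proof -
  note V = chart_at_mem[OF X, of x]
  have g': "in_chart_at X x g analytic_on {snd (chart_at X x) x}"
    using g(1) unfolding hol_at_iff_analytic[OF X V] in_chart_at_eq .
  have "mero_at X x g"
    unfolding mero_at_def by (rule analytic_on_imp_meromorphic_on[OF g'])
  from has_order_at_ord_at[OF X this fr] show "has_order_at X x g (ord_at X x g)" .
  have "in_chart_at X x g (snd (chart_at X x) x) = 0"
    using riemann_surfaceD(3)[OF X V(1)] V(2) g(2) by (simp add: in_chart_at_eq)
  moreover have "\<exists>\<^sub>F \<zeta> in at (snd (chart_at X x) x). in_chart_at X x g \<zeta> \<noteq> 0"
    using fr unfolding frequently_def eventually_at_chart[OF X V] in_chart_at_eq by simp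
  ultimately show "ord_at X x g > 0"
    using zorder_pos[OF g'] by (simp add: ord_at_def)
qed

text \<open>Nonconstancy enters in the local form \<open>eventually_neq\<close>, because most of
  what follows concerns germs at one point; compactness and connectedness are added where global
  sums occur.\<close>

locale nonconstant_map =
  fixes X :: "'a::t2_space atlas" and Y :: "'b::t2_space atlas" and f :: "'b \<Rightarrow> 'a"
  assumes X: "riemann_surface X" and Y: "riemann_surface Y" and f: "holomorphic_map Y X f"
    and eventually_neq: "\<And>y. \<forall>\<^sub>F p in at y. f p \<noteq> f y"
begin

abbreviation m :: "'b \<Rightarrow> int" where "m y \<equiv> multiplicity_at Y X f y"

text \<open>Germs are known only along the punctured filter. Pulling them back makes sense because f
  maps a punctured neighbourhood of y into a punctured neighbourhood of \<open>f y\<close>.\<close>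

lemma filterlim_at_f: "filterlim f (at (f y)) (at y)"
  using holomorphic_mapD(4)[OF f, of y] eventually_neq[of y] by (simp add: filterlim_at isCont_def)

lemma eventually_at_f: "eventually P (at (f y)) \<Longrightarrow> \<forall>\<^sub>F p in at y. P (f p)"
  using filterlim_at_f[of y] by (simp add: filterlim_iff)

lemma hol_at_f: "hol_at X (f y) g \<Longrightarrow> hol_at Y y (\<lambda>p. g (f p))"
  by (rule hol_at_compose[OF X Y f])

lemma multiplicity_order: "has_order_at Y y (\<lambda>p. coord_at X (f y) (f p)) (m y)"
  and multiplicity_pos: "m y > 0"
proof -
  have h: "hol_at Y y (\<lambda>p. coord_at X (f y) (f p))"
    by (intro hol_at_f hol_at_coord_at X chart_at_mem)
  have fr: "\<exists>\<^sub>F p in at y. coord_at X (f y) (f p) \<noteq> 0"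
    using eventually_at_f[OF eventually_coord_at_nonzero[OF X]] at_neq_bot[OF Y] eventually_frequently
    by blast
  show "has_order_at Y y (\<lambda>p. coord_at X (f y) (f p)) (m y)" "m y > 0"
    using has_order_at_zero[OF Y h _ fr] by (simp_all add: multiplicity_at_def o_def)
qed

text \<open>The coordinate at \<open>f y\<close> pulls back to a germ of order \<open>m y\<close>,
  and units pull back to units.\<close>

lemma has_order_at_f:
  assumes "has_order_at X (f y) g k"
  shows "has_order_at Y y (\<lambda>p. g (f p)) (m y * k)"
proof -
  obtain h where h: "hol_at X (f y) h" "h (f y) \<noteq> 0"
      "\<forall>\<^sub>F p in at (f y). g p = coord_at X (f y) p powi k * h p"
    using assms by (rule has_order_atE)
  have "has_order_at Y y (\<lambda>p. coord_at X (f y) (f p) powi k * h (f p)) (k * m y + 0)"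
    by (intro has_order_at_mult has_order_at_powi has_order_at_unit Y multiplicity_order hol_at_f h)
  then have "has_order_at Y y (\<lambda>p. g (f p)) (k * m y + 0)"
    by (rule has_order_at_cong[rotated]) (use eventually_at_f[OF h(3)] in eventually_elim, simp)
  then show ?thesis by (simp add: mult.commute)
qed

lemma zpow_module_f:
  assumes "g \<in> zpow_module X (f y) k"
  shows "(\<lambda>p. g (f p)) \<in> zpow_module Y y (m y * k)"
proof -
  obtain h where h: "hol_at X (f y) h"
      "\<forall>\<^sub>F p in at (f y). g p = coord_at X (f y) p powi k * h p"
    using assms by (rule zpow_moduleE)
  have "(\<lambda>p. coord_at X (f y) (f p) powi k * h (f p)) \<in> zpow_module Y y (k * m y + 0)"
    by (intro zpow_module_mult Y has_order_at_imp_zpow_module has_order_at_powi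
        multiplicity_order zpow_module_0I hol_at_f h)
  then have "(\<lambda>p. g (f p)) \<in> zpow_module Y y (k * m y + 0)"
    by (rule zpow_module_cong) (use eventually_at_f[OF h(2)] in eventually_elim, simp)
  then show ?thesis by (simp add: mult.commute)
qed

end

section \<open>The degree of a map\<close>

context nonconstant_map
begin

text \<open>An infinite fibre would accumulate at some point by compactness; that point lies in the
  fibre too, but points are isolated in their fibres.\<close>

lemma finite_fibre:
  assumes "compact (UNIV :: 'b set)"
  shows "finite (f -` {x})"
proof (rule ccontr)
  assume "infinite (f -` {x})"
  then obtain y where y: "y islimpt f -` {x}"
    using Heine_Borel_imp_Bolzano_Weierstrass[OF assms, of "f -` {x}"] by auto
  have "closed (f -` {x})"
    using holomorphic_mapD(1)[OF f] by (intro closed_vimage) auto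
  then have "f y = x" using y closed_limpt[of "f -` {x}"] by auto
  moreover obtain W where "open W" "y \<in> W" "\<forall>p\<in>W. p \<noteq> y \<longrightarrow> f p \<noteq> f y"
    using eventually_neq[of y] unfolding eventually_at_topological by auto
  ultimately show False using islimptE[OF y, of W] by auto
qed

lemma zorder_chart_f:
  assumes V: "(V, w) \<in> Y" "y \<in> V" and U: "(U, z) \<in> X" "f y \<in> U"
  shows "zorder (\<lambda>\<zeta>. z (f (inv_into V w \<zeta>)) - z (f y)) (w y) = m y"
  using zorder_in_chart[OF Y V has_order_at_f[OF has_order_at_chart[OF X U]]] by simp

text \<open>In charts f becomes g. On a small circle around a the function \<open>g - g a\<close>
  dominates a small constant, so by Rouche's theorem \<open>g - b\<close> has as many zeros inside,
  counted with order, as \<open>g - g a\<close>, whose only zero is a. The prescribed N allows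
  neighbourhoods of different preimages to be kept disjoint later.\<close>

lemma local_degree:
  assumes com: "compact (UNIV :: 'b set)" and N: "open N" "y \<in> N"
  obtains N' W where "open N'" "y \<in> N'" "N' \<subseteq> N" "open W" "f y \<in> W"
    "\<forall>x\<in>W. (\<Sum>y'\<in>f -` {x} \<inter> N'. m y') = m y"
proof -
  obtain U z where U: "(U, z) \<in> X" "f y \<in> U" using chart_exists X .
  obtain V w where V: "(V, w) \<in> Y" "y \<in> V" using chart_exists Y .
  note c = riemann_surfaceD[OF X U(1)]
  note d = riemann_surfaceD[OF Y V(1)]
  define g where "g = z \<circ> f \<circ> inv_into V w"
  define a where "a = w y"
  \<comment> \<open>K excludes the other points of the fibre of \<open>f y\<close>, so that
    \<open>g - g a\<close> vanishes at a only.\<close>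
  obtain K where K: "open K" "y \<in> K" "\<And>p. p \<in> K \<Longrightarrow> p \<noteq> y \<Longrightarrow> f p \<noteq> f y"
    using eventually_neq[of y] unfolding eventually_at_topological by auto
  have "open (w ` (V \<inter> (f -` U \<inter> N \<inter> K)))"
    by (rule open_chart_image[OF Y V(1)])
      (use holomorphic_mapD(3)[OF f c(1)] N(1) K(1) in \<open>simp add: open_Int\<close>)
  moreover have "a \<in> w ` (V \<inter> (f -` U \<inter> N \<inter> K))" using U V N K by (simp add: a_def)
  ultimately obtain e where e: "e > 0" "ball a e \<subseteq> w ` (V \<inter> (f -` U \<inter> N \<inter> K))"
    by (rule openE)
  have ball_e: "p \<in> N \<and> p \<in> K \<and> f p \<in> U" if p: "p \<in> V" "w p \<in> ball a e" for p
  proof -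
    obtain q where q: "q \<in> V" "q \<in> f -` U \<inter> N \<inter> K" "w p = w q" using p(2) e(2) by auto
    then have "p = q" using inj_onD[OF d(3), of p q] p(1) by simp
    then show ?thesis using q(2) by simp
  qed
  have in_ball_e: "\<exists>p\<in>V. \<zeta> = w p" if "\<zeta> \<in> ball a e" for \<zeta>
    using that e(2) by auto
  have gw: "g (w p) = z (f p)" if "p \<in> V" for p using that d(3) by (simp add: g_def)
  have hol: "g holomorphic_on ball a e"
    using holomorphic_mapD(2)[OF f V(1) U(1)] e(2) unfolding g_def
    by (elim holomorphic_on_subset) auto
  have ga: "g a = z (f y)" using gw V(2) by (simp add: a_def)
  have g_neq: "g \<zeta> \<noteq> g a" if \<zeta>: "\<zeta> \<in> ball a e" "\<zeta> \<noteq> a" for \<zeta>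
  proof -
    obtain p where p: "p \<in> V" "\<zeta> = w p" using in_ball_e[OF \<zeta>(1)] by auto
    then have "f p \<noteq> f y" using K(3)[of p] ball_e[of p] \<zeta> by (auto simp: a_def)
    then show ?thesis using inj_onD[OF c(3), of "f p" "f y"] ball_e[of p] p \<zeta>(1) U(2) ga gw by auto
  qed
  \<comment> \<open>Halving leaves the closed disc inside the open disc where g is holomorphic and
    avoids \<open>g a\<close> away from the centre.\<close>
  define r where "r = e / 2"
  have r: "r > 0" "cball a r \<subseteq> ball a e" "ball a r \<subseteq> ball a e"
    using e(1) by (auto simp: r_def)
  have "continuous_on (sphere a r) g"
    by (rule continuous_on_subset[OF holomorphic_on_imp_continuous_on[OF hol]]) (use r(2) in auto)
  then have "continuous_on (sphere a r) (\<lambda>\<zeta>. norm (g \<zeta> - g a))"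
    by (intro continuous_intros)
  moreover have "sphere a r \<noteq> {}" using r(1) by simp
  \<comment> \<open>The minimum of \<open>norm (g \<zeta> - g a)\<close> over the circle, attained
    at \<open>\<xi>\<close>, becomes the radius \<open>\<delta>\<close> of the target disc: closer
    values b satisfy the strict inequality of Rouche's theorem and are not attained on the
    circle.\<close>
  ultimately obtain \<xi> where \<xi>: "\<xi> \<in> sphere a r" "\<And>\<zeta>. \<zeta> \<in> sphere a r \<Longrightarrow> norm (g \<xi> - g a) \<le> norm (g \<zeta> - g a)"
    using continuous_attains_inf[of "sphere a r" "\<lambda>\<zeta>. norm (g \<zeta> - g a)"] by auto
  define \<delta> where "\<delta> = norm (g \<xi> - g a)"
  have "\<xi> \<in> ball a e" "\<xi> \<noteq> a" using \<xi>(1) r by auto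
  then have \<delta>: "\<delta> > 0" using g_neq by (simp add: \<delta>_def)
  define N' where "N' = V \<inter> w -` ball a r"
  define W where "W = U \<inter> z -` ball (g a) \<delta>"
  show ?thesis
  proof (rule that[of N' W])
    show "open N'" unfolding N'_def by (rule open_chart_vimage[OF Y V(1) open_ball])
    show "y \<in> N'" using V(2) r(1) by (simp add: N'_def a_def)
    show "N' \<subseteq> N" using ball_e r(3) by (auto simp: N'_def subset_iff)
    show "open W" unfolding W_def by (rule open_chart_vimage[OF X U(1) open_ball])
    show "f y \<in> W" using U(2) \<delta> by (simp add: W_def ga)
    show "\<forall>x\<in>W. (\<Sum>y'\<in>f -` {x} \<inter> N'. m y') = m y"
    proof
      fix x assume x: "x \<in> W"
      define b where "b = z x"
      have b: "norm (g a - b) < \<delta>" and xU: "x \<in> U" using x by (auto simp: W_def b_def dist_norm)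
      have g_eq: "g (w p) = b \<longleftrightarrow> f p = x" if "p \<in> V" "w p \<in> ball a e" for p
        using gw[of p] that ball_e[of p] inj_on_eq_iff[OF c(3), of "f p" x] xU by (simp add: b_def)
      \<comment> \<open>Rouche's theorem wants finitely many zeros in the whole open disc; each of
        them is the image of a point of the fibre over x, which is finite.\<close>
      have fin: "finite {\<zeta> \<in> ball a e. (g \<zeta> - g a) + (g a - b) = 0}"
      proof (rule finite_subset)
        show "{\<zeta> \<in> ball a e. (g \<zeta> - g a) + (g a - b) = 0} \<subseteq> w ` (f -` {x})"
        proof
          fix \<zeta> assume "\<zeta> \<in> {\<zeta> \<in> ball a e. (g \<zeta> - g a) + (g a - b) = 0}"
          then have \<zeta>: "\<zeta> \<in> ball a e" "g \<zeta> = b" by auto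
          obtain p where "p \<in> V" "\<zeta> = w p" using in_ball_e[OF \<zeta>(1)] by auto
          then show "\<zeta> \<in> w ` (f -` {x})" using g_eq[of p] \<zeta> by auto
        qed
        show "finite (w ` (f -` {x}))" using finite_fibre[OF com] by simp
      qed
      have zf: "{\<zeta> \<in> ball a e. g \<zeta> - g a = 0} = {a}" using g_neq e(1) by auto
      have wn: "winding_number (circlepath a r) \<zeta> = (if \<zeta> \<in> ball a r then 1 else 0)"
        if "\<zeta> \<notin> sphere a r" for \<zeta>
      proof (cases "\<zeta> \<in> ball a r")
        case True
        then show ?thesis by (simp add: winding_number_circlepath dist_norm norm_minus_commute)
      next
        case False
        have "winding_number (circlepath a r) \<zeta> = 0"
          by (rule winding_number_zero_outside[of _ "cball a r"]) (use that False r(1) in auto)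
        then show ?thesis using False by simp
      qed
      have no_sphere: "g \<zeta> \<noteq> b" if "\<zeta> \<in> sphere a r" for \<zeta>
        using \<xi>(2)[OF that] b by (auto simp: \<delta>_def norm_minus_commute)
      define Z where "Z = {\<zeta> \<in> ball a e. (g \<zeta> - g a) + (g a - b) = 0}"
      \<comment> \<open>The function \<open>g - b\<close> is split as
        \<open>(g - g a) + (g a - b)\<close>, a perturbation of \<open>g - g a\<close> by a
        constant.\<close>
      have "(\<Sum>p\<in>Z. winding_number (circlepath a r) p * zorder (\<lambda>p. (g p - g a) + (g a - b)) p)
          = (\<Sum>p\<in>{\<zeta> \<in> ball a e. g \<zeta> - g a = 0}.
              winding_number (circlepath a r) p * zorder (\<lambda>p. g p - g a) p)"
        unfolding Z_def
      proof (rule Rouche_theorem)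
        show "finite {p \<in> ball a e. g p - g a = 0}" unfolding zf by simp
        show "\<forall>\<zeta>\<in>path_image (circlepath a r). cmod (g a - b) < cmod (g \<zeta> - g a)"
          using \<xi>(2) b r(1) by (auto simp: \<delta>_def intro: less_le_trans)
        show "\<forall>\<zeta>. \<zeta> \<notin> ball a e \<longrightarrow> winding_number (circlepath a r) \<zeta> = 0"
        proof (intro allI impI)
          fix \<zeta> assume "\<zeta> \<notin> ball a e"
          then have "\<zeta> \<notin> cball a r" using r(2) by auto
          then show "winding_number (circlepath a r) \<zeta> = 0" using wn[of \<zeta>] by simp
        qed
        show "path_image (circlepath a r) \<subseteq> ball a e" using r by auto
      qed (use fin hol in \<open>auto intro!: holomorphic_intros\<close>)
      also have "\<dots> = of_int (zorder (\<lambda>p. g p - g a) a)"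
        unfolding zf using wn[of a] r(1) by simp
      also have "zorder (\<lambda>p. g p - g a) a = m y"
        using zorder_chart_f[OF V U] unfolding ga by (simp add: g_def a_def)
      finally have eq: "(\<Sum>p\<in>Z. winding_number (circlepath a r) p *
          zorder (\<lambda>p. (g p - g a) + (g a - b)) p) = of_int (m y)" .
      \<comment> \<open>Zeros outside the circle have winding number 0, zeros inside have 1, and
        none lie on it.\<close>
      have "(\<Sum>p\<in>Z. winding_number (circlepath a r) p * zorder (\<lambda>p. (g p - g a) + (g a - b)) p)
          = (\<Sum>p\<in>Z \<inter> ball a r. of_int (zorder (\<lambda>p. g p - b) p))"
      proof (rule sum.mono_neutral_cong_right)
        show "finite Z" using fin by (simp add: Z_def)
        show "\<forall>i\<in>Z - Z \<inter> ball a r. winding_number (circlepath a r) i *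
            of_int (zorder (\<lambda>p. (g p - g a) + (g a - b)) i) = 0"
        proof
          fix \<zeta> assume "\<zeta> \<in> Z - Z \<inter> ball a r"
          then have "\<zeta> \<notin> ball a r" "g \<zeta> = b" by (auto simp: Z_def)
          then have "winding_number (circlepath a r) \<zeta> = 0" using wn[of \<zeta>] no_sphere[of \<zeta>] by auto
          then show "winding_number (circlepath a r) \<zeta> *
            of_int (zorder (\<lambda>p. (g p - g a) + (g a - b)) \<zeta>) = 0" by simp
        qed
        show "winding_number (circlepath a r) \<zeta> * of_int (zorder (\<lambda>p. (g p - g a) + (g a - b)) \<zeta>)
            = of_int (zorder (\<lambda>p. g p - b) \<zeta>)" if "\<zeta> \<in> Z \<inter> ball a r" for \<zeta>
          using that wn[of \<zeta>] by simp
      qed simp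
      also have "\<dots> = (\<Sum>y'\<in>f -` {x} \<inter> N'. of_int (m y'))"
      proof -
        \<comment> \<open>The chart w matches the zeros inside the circle with the points of the
          fibre over x in N'; the order of each zero is the multiplicity of f there.\<close>
        have im: "w ` (f -` {x} \<inter> N') = Z \<inter> ball a r"
        proof (intro equalityI subsetI)
          fix \<zeta> assume "\<zeta> \<in> w ` (f -` {x} \<inter> N')"
          then obtain p where p: "p \<in> V" "f p = x" "\<zeta> = w p" "w p \<in> ball a r" by (auto simp: N'_def)
          moreover have "w p \<in> ball a e" using subsetD[OF r(3) p(4)] .
          ultimately show "\<zeta> \<in> Z \<inter> ball a r" using g_eq[of p] by (simp add: Z_def)
        next
          fix \<zeta> assume "\<zeta> \<in> Z \<inter> ball a r"
          then have \<zeta>: "\<zeta> \<in> ball a e" "\<zeta> \<in> ball a r" "g \<zeta> = b" by (auto simp: Z_def)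
          obtain p where p: "p \<in> V" "\<zeta> = w p" using in_ball_e[OF \<zeta>(1)] by auto
          then have "f p = x" using g_eq[of p] \<zeta> by simp
          then show "\<zeta> \<in> w ` (f -` {x} \<inter> N')" using p \<zeta>(2) by (auto simp: N'_def)
        qed
        moreover have "inj_on w (f -` {x} \<inter> N')"
          by (rule inj_on_subset[OF d(3)]) (auto simp: N'_def)
        ultimately have "bij_betw w (f -` {x} \<inter> N') (Z \<inter> ball a r)" by (simp add: bij_betw_def)
        from sum.reindex_bij_betw[OF this, of "\<lambda>p. of_int (zorder (\<lambda>p. g p - b) p)"]
        have "(\<Sum>p\<in>Z \<inter> ball a r. complex_of_int (zorder (\<lambda>p. g p - b) p)) =
            (\<Sum>y'\<in>f -` {x} \<inter> N'. of_int (zorder (\<lambda>p. g p - b) (w y')))" by (rule sym)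
        also have "\<dots> = (\<Sum>y'\<in>f -` {x} \<inter> N'. of_int (m y'))"
        proof (rule sum.cong[OF refl])
          fix y' assume y': "y' \<in> f -` {x} \<inter> N'"
          then have "y' \<in> V" by (simp add: N'_def)
          moreover have "(\<lambda>p. g p - b) = (\<lambda>\<zeta>. z (f (inv_into V w \<zeta>)) - z (f y'))"
            using y' by (simp add: g_def b_def)
          ultimately show "of_int (zorder (\<lambda>p. g p - b) (w y')) = complex_of_int (m y')"
            using zorder_chart_f[OF V(1) _ U(1), of y'] y' xU by simp
        qed
        finally show ?thesis .
      qed
      \<comment> \<open>Winding numbers are complex, so the two integers are compared after
        embedding into the complex numbers.\<close>
      finally have "of_int (\<Sum>y'\<in>f -` {x} \<inter> N'. m y') = (of_int (m y) :: complex)"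
        using eq by simp
      then show "(\<Sum>y'\<in>f -` {x} \<inter> N'. m y') = m y" by (simp only: of_int_eq_iff)
    qed
  qed
qed

lemma finite_disjoint_neighbourhoods:
  fixes F :: "'b set"
  assumes "finite F"
  shows "\<exists>N. (\<forall>y\<in>F. open (N y) \<and> y \<in> N y) \<and>
    (\<forall>y\<in>F. \<forall>y'\<in>F. y \<noteq> y' \<longrightarrow> N y \<inter> N y' = {})"
proof -
  have "\<forall>(y :: 'b) y'. \<exists>A B. y \<noteq> y' \<longrightarrow> open A \<and> open B \<and> y \<in> A \<and> y' \<in> B \<and> A \<inter> B = {}"
  proof (intro allI)
    fix y y' :: 'b
    show "\<exists>A B. y \<noteq> y' \<longrightarrow> open A \<and> open B \<and> y \<in> A \<and> y' \<in> B \<and> A \<inter> B = {}"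
      using hausdorff[of y y'] by (cases "y = y'") auto
  qed
  then obtain A B :: "'b \<Rightarrow> 'b \<Rightarrow> 'b set" where AB: "\<And>y y'. y \<noteq> y' \<Longrightarrow>
      open (A y y') \<and> open (B y y') \<and> y \<in> A y y' \<and> y' \<in> B y y' \<and> A y y' \<inter> B y y' = {}"
    by metis
  \<comment> \<open>The separating sets for \<open>(y, y')\<close> and for \<open>(y', y)\<close>
    are chosen independently. Intersecting both kinds ensures that \<open>N y\<close> lies in
    \<open>A y y'\<close> while \<open>N y'\<close> lies in \<open>B y y'\<close>.\<close>
  define N where "N = (\<lambda>y. \<Inter>y'\<in>F - {y}. A y y' \<inter> B y' y)"
  show ?thesis
  proof (intro exI[of _ N] conjI ballI impI)
    fix y assume "y \<in> F"
    show "open (N y)" unfolding N_def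
      by (rule open_INT) (use assms AB in \<open>auto intro!: open_Int\<close>)
    have "y \<in> A y y' \<inter> B y' y" if "y' \<in> F - {y}" for y'
      using AB[of y y'] AB[of y' y] that by auto
    then show "y \<in> N y" unfolding N_def by (rule INT_I)
    fix y' assume y': "y' \<in> F" "y \<noteq> y'"
    have "N y \<subseteq> A y y'" "N y' \<subseteq> B y y'" using y' \<open>y \<in> F\<close> by (auto simp: N_def)
    then show "N y \<inter> N y' = {}" using AB[OF y'(2)] by auto
  qed
qed

text \<open>Locally constant on a connected space. \<open>local_degree\<close> controls the
  preimages that stay near the fibre over x, and compactness of the source prevents any further
  ones.\<close>

lemma degree_constant:
  assumes com: "compact (UNIV :: 'b set)" and con: "connected (UNIV :: 'a set)"
  shows "(\<Sum>y\<in>f -` {x}. m y) = (\<Sum>y\<in>f -` {x'}. m y)"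
proof (rule connected_local_const[OF con, where f = "\<lambda>x. \<Sum>y\<in>f -` {x}. m y"])
  show "\<forall>x\<in>UNIV. \<forall>\<^sub>F x' in at x. (\<Sum>y\<in>f -` {x}. m y) = (\<Sum>y\<in>f -` {x'}. m y)"
  proof
    fix x
    define F where "F = f -` {x}"
    have F: "finite F" unfolding F_def by (rule finite_fibre[OF com])
    obtain N where N': "\<forall>y\<in>F. open (N y) \<and> y \<in> N y"
      "\<forall>y\<in>F. \<forall>y'\<in>F. y \<noteq> y' \<longrightarrow> N y \<inter> N y' = {}"
      using finite_disjoint_neighbourhoods[OF F] by (elim exE conjE)
    have N: "y \<in> F \<Longrightarrow> open (N y)" "y \<in> F \<Longrightarrow> y \<in> N y"
      "y \<in> F \<Longrightarrow> y' \<in> F \<Longrightarrow> y \<noteq> y' \<Longrightarrow> N y \<inter> N y' = {}" for y y'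
      using N' by auto
    define P where "P = (\<lambda>y (N', W). open N' \<and> y \<in> N' \<and> N' \<subseteq> N y \<and> open W \<and> f y \<in> W \<and>
      (\<forall>x\<in>W. (\<Sum>y'\<in>f -` {x} \<inter> N'. m y') = m y))"
    have "\<exists>NW. P y NW" if y: "y \<in> F" for y
    proof -
      obtain N' W where "open N'" "y \<in> N'" "N' \<subseteq> N y" "open W" "f y \<in> W"
        "\<forall>x\<in>W. (\<Sum>y'\<in>f -` {x} \<inter> N'. m y') = m y"
        by (rule local_degree[OF com N(1)[OF y] N(2)[OF y]])
      then show ?thesis by (intro exI[of _ "(N', W)"]) (simp add: P_def)
    qed
    then obtain NW where NW: "\<And>y. y \<in> F \<Longrightarrow> P y (NW y)" by metis
    define N' W where "N' = (\<lambda>y. fst (NW y))" "W = (\<lambda>y. snd (NW y))"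
    have L: "open (N' y)" "y \<in> N' y" "N' y \<subseteq> N y" "open (W y)" "f y \<in> W y"
      "\<And>x. x \<in> W y \<Longrightarrow> (\<Sum>y'\<in>f -` {x} \<inter> N' y. m y') = m y" if "y \<in> F" for y
      using NW[OF that] by (auto simp: P_def N'_W_def case_prod_beta)
    define C where "C = - (\<Union>y\<in>F. N' y)"
    have "closed C" unfolding C_def using L(1) by (intro closed_Compl open_UN) auto
    then have "compact C" using compact_Int_closed[OF com, of C] by simp
    then have "closed (f ` C)"
      using holomorphic_mapD(1)[OF f] continuous_on_subset
      by (intro compact_imp_closed compact_continuous_image) auto
    \<comment> \<open>C is compact and misses the fibre over x, so its image is closed and avoids x.
      Removing this image forces all preimages of points of S into the sets \<open>N' y\<close>. An
      empty fibre is covered: then S is the complement of the image of f.\<close>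
    define S where "S = (\<Inter>y\<in>F. W y) \<inter> - (f ` C)"
    have oS: "open S" unfolding S_def
      by (intro open_Int open_INT open_Compl \<open>closed (f ` C)\<close>) (use F L(4) in auto)
    have xS: "x \<in> S"
      using L(2,5) by (auto simp: S_def C_def F_def)
    have sumF: "(\<Sum>y\<in>f -` {x'}. m y) = (\<Sum>y\<in>F. m y)" if x': "x' \<in> S" for x'
    proof -
      have "f -` {x'} = (\<Union>y\<in>F. f -` {x'} \<inter> N' y)"
        using x' by (auto simp: S_def C_def)
      then have "(\<Sum>y\<in>f -` {x'}. m y) = (\<Sum>y\<in>(\<Union>y\<in>F. f -` {x'} \<inter> N' y). m y)" by simp
      also have "\<dots> = (\<Sum>y\<in>F. \<Sum>y\<in>f -` {x'} \<inter> N' y. m y)"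
      proof (rule sum.UNION_disjoint[OF F])
        show "\<forall>i\<in>F. finite (f -` {x'} \<inter> N' i)" using finite_fibre[OF com] by auto
        show "\<forall>i\<in>F. \<forall>j\<in>F. i \<noteq> j \<longrightarrow> f -` {x'} \<inter> N' i \<inter> (f -` {x'} \<inter> N' j) = {}"
        proof (intro ballI impI)
          fix i j assume "i \<in> F" "j \<in> F" "i \<noteq> j"
          then have "N' i \<inter> N' j = {}" using N(3)[of i j] L(3)[of i] L(3)[of j] by auto
          then show "f -` {x'} \<inter> N' i \<inter> (f -` {x'} \<inter> N' j) = {}" by auto
        qed
      qed
      also have "\<dots> = (\<Sum>y\<in>F. m y)"
        using L(6) x' by (intro sum.cong refl) (auto simp: S_def)
      finally show ?thesis .
    qed
    show "\<forall>\<^sub>F x' in at x. (\<Sum>y\<in>f -` {x}. m y) = (\<Sum>y\<in>f -` {x'}. m y)"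
      unfolding eventually_at_filter using eventually_nhds_in_open[OF oS xS]
    proof eventually_elim
      case (elim x')
      show ?case using sumF[OF elim] by (simp add: F_def)
    qed
  qed
qed auto

end

section \<open>Matrices\<close>

lemma matrix_inv_mult:
  fixes A :: "complex^'n^'n"
  assumes "invertible A"
  shows "A ** matrix_inv A = mat 1" "matrix_inv A ** A = mat 1"
proof -
  have "\<exists>B. A ** B = mat 1 \<and> B ** A = mat 1" using assms unfolding invertible_def .
  from someI_ex[OF this] show "A ** matrix_inv A = mat 1" "matrix_inv A ** A = mat 1"
    unfolding matrix_inv_def by simp_all
qed

lemma matrix_inv_eqI:
  fixes A B :: "complex^'n^'n"
  assumes "A ** B = mat 1" "B ** A = mat 1"
  shows "matrix_inv A = B"
proof -
  have "invertible A" unfolding invertible_def using assms by (intro exI[of _ B] conjI)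
  note i = matrix_inv_mult[OF this]
  have "matrix_inv A = matrix_inv A ** (A ** B)" using assms(1) by simp
  also have "\<dots> = B" unfolding matrix_mul_assoc i(2) by simp
  finally show ?thesis .
qed

lemma invertibleI:
  fixes A B :: "complex^'n^'n"
  assumes "A ** B = mat 1" "B ** A = mat 1"
  shows "invertible A"
  unfolding invertible_def using assms by (intro exI[of _ B] conjI)

lemma matrix_inv_prod:
  fixes A B :: "complex^'n^'n"
  assumes "invertible A" "invertible B"
  shows "matrix_inv (A ** B) = matrix_inv B ** matrix_inv A"
proof (rule matrix_inv_eqI)
  have "A ** B ** (matrix_inv B ** matrix_inv A) = A ** (B ** matrix_inv B) ** matrix_inv A"
    by (simp add: matrix_mul_assoc)
  then show "A ** B ** (matrix_inv B ** matrix_inv A) = mat 1"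
    using matrix_inv_mult[OF assms(1)] matrix_inv_mult[OF assms(2)] by simp
  have "matrix_inv B ** matrix_inv A ** (A ** B) = matrix_inv B ** (matrix_inv A ** A) ** B"
    by (simp add: matrix_mul_assoc)
  then show "matrix_inv B ** matrix_inv A ** (A ** B) = mat 1"
    using matrix_inv_mult[OF assms(1)] matrix_inv_mult[OF assms(2)] by simp
qed

lemma matrix_inv_vector:
  fixes A :: "complex^'n^'n"
  assumes "invertible A"
  shows "A *v (matrix_inv A *v v) = v" "matrix_inv A *v (A *v v) = v"
  by (simp_all add: matrix_vector_mul_assoc matrix_inv_mult[OF assms])

lemma matrix_vector_columns:
  fixes A :: "complex^'n^'m"
  shows "A *v v = (\<Sum>i\<in>UNIV. v $ i *s column i A)"
  by (simp add: vec_eq_iff matrix_vector_mult_def column_def mult.commute)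

lemma matrix_vector_axis:
  fixes A :: "complex^'n^'m"
  shows "A *v axis i 1 = column i A"
proof -
  have "(\<Sum>k\<in>UNIV. A $ j $ k * axis i 1 $ k) = (\<Sum>k\<in>UNIV. if k = i then A $ j $ i else 0)" for j
    by (rule sum.cong) (auto simp: axis_def)
  then show ?thesis by (simp add: vec_eq_iff matrix_vector_mult_def column_def)
qed

definition diag_matrix :: "('n::finite \<Rightarrow> complex) \<Rightarrow> complex^'n^'n" where
  "diag_matrix c = (\<chi> i j. if i = j then c i else 0)"

lemma diag_matrix_mult: "diag_matrix c ** diag_matrix d = diag_matrix (\<lambda>i. c i * d i)"
proof -
  have "(\<Sum>k\<in>UNIV. (if i = k then c i else 0) * (if k = j then d k else 0)) =
      (if i = j then c i * d i else 0)" for i j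
  proof -
    have "(\<Sum>k\<in>UNIV. (if i = k then c i else 0) * (if k = j then d k else 0)) =
        (\<Sum>k\<in>UNIV. if k = i then (if i = j then c i * d i else 0) else 0)"
      by (rule sum.cong) auto
    then show ?thesis by simp
  qed
  then show ?thesis by (simp add: diag_matrix_def matrix_matrix_mult_def vec_eq_iff)
qed

lemma diag_matrix_1: "diag_matrix (\<lambda>_. 1) = mat 1"
  by (simp add: diag_matrix_def mat_def)

lemma diag_matrix_vector: "(diag_matrix c *v v) $ i = c i * v $ i"
proof -
  have "(\<Sum>k\<in>UNIV. (if i = k then c i else 0) * v $ k) = (\<Sum>k\<in>UNIV. if k = i then c i * v $ i else 0)"
    by (rule sum.cong) auto
  then show ?thesis by (simp add: diag_matrix_def matrix_vector_mult_def)
qed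

lemma diag_matrix_inverse:
  assumes "\<And>i. c i \<noteq> 0"
  shows "invertible (diag_matrix c)" "matrix_inv (diag_matrix c) = diag_matrix (\<lambda>i. inverse (c i))"
proof -
  have *: "diag_matrix c ** diag_matrix (\<lambda>i. inverse (c i)) = mat 1"
    "diag_matrix (\<lambda>i. inverse (c i)) ** diag_matrix c = mat 1"
    using assms by (simp_all add: diag_matrix_mult flip: diag_matrix_1)
  show "invertible (diag_matrix c)" by (rule invertibleI[OF *])
  show "matrix_inv (diag_matrix c) = diag_matrix (\<lambda>i. inverse (c i))" by (rule matrix_inv_eqI[OF *])
qed

section \<open>Holomorphic matrices and frames\<close>

definition hol_matrix_at :: "'a::t2_space atlas \<Rightarrow> 'a \<Rightarrow> ('a \<Rightarrow> complex^'n^'m) \<Rightarrow> bool" where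
  "hol_matrix_at X x A \<longleftrightarrow> (\<forall>i j. hol_at X x (\<lambda>p. A p $ i $ j))"

lemma hol_matrix_iff:
  assumes "riemann_surface X" "open W"
  shows "hol_matrix X W A \<longleftrightarrow> (\<forall>x\<in>W. hol_matrix_at X x A)"
  unfolding hol_matrix_def hol_matrix_at_def hol_fun_iff_hol_at[OF assms] by auto

lemma hol_matrix_at_const: "riemann_surface X \<Longrightarrow> hol_matrix_at X x (\<lambda>_. A)"
  by (simp add: hol_matrix_at_def)

lemma hol_matrix_at_mult:
  assumes "riemann_surface X" "hol_matrix_at X x A" "hol_matrix_at X x B"
  shows "hol_matrix_at X x (\<lambda>p. A p ** B p)"
  using assms unfolding hol_matrix_at_def matrix_matrix_mult_def
  by (auto intro!: hol_at_sum hol_at_mult)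

lemma hol_matrix_at_diag:
  assumes "riemann_surface X" "\<And>i. hol_at X x (c i)"
  shows "hol_matrix_at X x (\<lambda>p. diag_matrix (\<lambda>i. c i p))"
  unfolding hol_matrix_at_def
proof (intro allI)
  fix i j
  show "hol_at X x (\<lambda>p. diag_matrix (\<lambda>i. c i p) $ i $ j)"
    using assms by (cases "i = j") (simp_all add: diag_matrix_def)
qed

lemma holomorphic_bundle_offD:
  assumes "holomorphic_bundle_off X D E"
  shows "(U, \<tau>) \<in> frames E \<Longrightarrow> open U"
    "(U, \<tau>) \<in> frames E \<Longrightarrow> p \<in> U \<Longrightarrow> invertible (\<tau> p)"
    "(\<Union>(U, \<tau>)\<in>frames E. U) = - D"
    "(U, \<tau>) \<in> frames E \<Longrightarrow> (W, \<sigma>) \<in> frames E \<Longrightarrow>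
      hol_matrix X (U \<inter> W) (\<lambda>p. matrix_inv (\<sigma> p) ** \<tau> p)"
  using assms unfolding holomorphic_bundle_off_def by auto

lemma punctured_frameE:
  assumes X: "riemann_surface X" and E: "holomorphic_bundle_off X D E"
    and "punctured_frame X D E x \<tau>"
  obtains U where "open U" "x \<in> U" "U - {x} \<subseteq> - D" "\<forall>p\<in>U - {x}. invertible (\<tau> p)"
    "\<forall>(W, \<sigma>)\<in>frames E. \<forall>p\<in>W \<inter> U - {x}. hol_matrix_at X p (\<lambda>p. matrix_inv (\<sigma> p) ** \<tau> p)"
proof -
  obtain U where U: "open U" "x \<in> U" "U - {x} \<subseteq> - D" "\<forall>p\<in>U - {x}. invertible (\<tau> p)"
    "\<forall>(W, \<sigma>)\<in>frames E. hol_matrix X (W \<inter> U - {x}) (\<lambda>p. matrix_inv (\<sigma> p) ** \<tau> p)"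
    using assms(3) unfolding punctured_frame_def by auto
  show ?thesis
  proof (rule that[OF U(1-4)], rule ballI)
    fix W\<sigma> assume "W\<sigma> \<in> frames E"
    moreover obtain W \<sigma> where W\<sigma>: "W\<sigma> = (W, \<sigma>)" by (cases W\<sigma>)
    ultimately have W: "(W, \<sigma>) \<in> frames E" by simp
    have o: "open (W \<inter> U - {x})" using U(1) holomorphic_bundle_offD(1)[OF E W] by auto
    have h: "hol_matrix X (W \<inter> U - {x}) (\<lambda>p. matrix_inv (\<sigma> p) ** \<tau> p)"
      using bspec[OF U(5) W] by simp
    show "case W\<sigma> of (W, \<sigma>) \<Rightarrow>
        \<forall>p\<in>W \<inter> U - {x}. hol_matrix_at X p (\<lambda>p. matrix_inv (\<sigma> p) ** \<tau> p)"
      unfolding W\<sigma> prod.case by (rule iffD1[OF hol_matrix_iff[OF X o] h])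
  qed
qed

lemma punctured_frameI:
  assumes X: "riemann_surface X" and E: "holomorphic_bundle_off X D E"
    and U: "open U" "x \<in> U" "U - {x} \<subseteq> - D" "\<And>p. p \<in> U - {x} \<Longrightarrow> invertible (\<tau> p)"
    and hol: "\<And>W \<sigma> p. (W, \<sigma>) \<in> frames E \<Longrightarrow> p \<in> W \<inter> U - {x} \<Longrightarrow>
      hol_matrix_at X p (\<lambda>p. matrix_inv (\<sigma> p) ** \<tau> p)"
  shows "punctured_frame X D E x \<tau>"
  unfolding punctured_frame_def
proof (intro exI[of _ U] conjI ballI)
  show "open U" "x \<in> U" "U - {x} \<subseteq> - D" by fact+
  show "invertible (\<tau> p)" if "p \<in> U - {x}" for p using U(4)[OF that] .
  fix W\<sigma> assume W: "W\<sigma> \<in> frames E"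
  obtain W \<sigma> where W\<sigma>: "W\<sigma> = (W, \<sigma>)" by (cases W\<sigma>)
  then have o: "open (W \<inter> U - {x})" using U(1) holomorphic_bundle_offD(1)[OF E, of W \<sigma>] W by auto
  have "hol_matrix X (W \<inter> U - {x}) (\<lambda>p. matrix_inv (\<sigma> p) ** \<tau> p)"
    unfolding hol_matrix_iff[OF X o] using hol[of W \<sigma>] W W\<sigma> by simp
  then show "case W\<sigma> of (W, \<sigma>) \<Rightarrow> hol_matrix X (W \<inter> U - {x}) (\<lambda>p. matrix_inv (\<sigma> p) ** \<tau> p)"
    by (simp add: W\<sigma>)
qed

lemma punctured_frame_invertible:
  assumes "punctured_frame X D E x \<tau>"
  shows "\<forall>\<^sub>F p in at x. invertible (\<tau> p)"
proof -
  obtain U where U: "open U" "x \<in> U" "\<forall>p\<in>U - {x}. invertible (\<tau> p)"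
    using assms unfolding punctured_frame_def by auto
  then show ?thesis
    unfolding eventually_at_topological by (intro exI[of _ U]) auto
qed

text \<open>M may have zeros or poles at x itself. This is what allows a frame to be twisted by
  powers of the coordinate.\<close>

lemma punctured_frame_mult:
  assumes X: "riemann_surface X" and E: "holomorphic_bundle_off X D E"
    and \<sigma>: "punctured_frame X D E x \<sigma>" and N: "open N" "x \<in> N"
    and M: "\<And>p. p \<in> N - {x} \<Longrightarrow> invertible (M p)" "\<And>p. p \<in> N - {x} \<Longrightarrow> hol_matrix_at X p M"
  shows "punctured_frame X D E x (\<lambda>p. \<sigma> p ** M p)"
proof -
  obtain U where U: "open U" "x \<in> U" "U - {x} \<subseteq> - D" "\<forall>p\<in>U - {x}. invertible (\<sigma> p)"
    "\<forall>(W, \<tau>)\<in>frames E. \<forall>p\<in>W \<inter> U - {x}. hol_matrix_at X p (\<lambda>p. matrix_inv (\<tau> p) ** \<sigma> p)"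
    using punctured_frameE[OF X E \<sigma>] .
  show ?thesis
  proof (rule punctured_frameI[OF X E, of "U \<inter> N"])
    show "open (U \<inter> N)" "x \<in> U \<inter> N" "U \<inter> N - {x} \<subseteq> - D" using U N by auto
    show "invertible (\<sigma> p ** M p)" if "p \<in> U \<inter> N - {x}" for p
      using invertible_mult[of "\<sigma> p" "M p"] U(4) M(1)[of p] that by auto
    fix W \<tau> p assume W: "(W, \<tau>) \<in> frames E" "p \<in> W \<inter> (U \<inter> N) - {x}"
    have "hol_matrix_at X p (\<lambda>p. matrix_inv (\<tau> p) ** \<sigma> p ** M p)"
      by (rule hol_matrix_at_mult[OF X]) (use bspec[OF U(5) W(1)] W(2) M(2)[of p] in auto)
    then show "hol_matrix_at X p (\<lambda>p. matrix_inv (\<tau> p) ** (\<sigma> p ** M p))"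
      by (simp add: matrix_mul_assoc)
  qed
qed

section \<open>Modules spanned by germs\<close>

lemma germ_spanI:
  fixes N :: nat
  assumes "\<And>i. i < N \<Longrightarrow> hol_at X x (g i)" "\<And>i. i < N \<Longrightarrow> u i \<in> S"
    "\<forall>\<^sub>F p in at x. v p = (\<Sum>i<N. g i p *s u i p)"
  shows "v \<in> germ_span X x S"
  unfolding germ_span_def using assms by (intro CollectI exI[of _ N] exI[of _ g] exI[of _ u]) simp

lemma germ_spanE:
  assumes "v \<in> germ_span X x S"
  obtains N g u where "\<And>i. i < N \<Longrightarrow> hol_at X x (g i)" "\<And>i. i < N \<Longrightarrow> u i \<in> S"
    "\<forall>\<^sub>F p in at x. v p = (\<Sum>i<(N::nat). g i p *s u i p)"
  using assms unfolding germ_span_def by auto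

lemma germ_span_cong:
  assumes v: "v \<in> germ_span X x S" and "\<forall>\<^sub>F p in at x. v p = w p"
  shows "w \<in> germ_span X x S"
proof -
  obtain N g u where *: "\<And>i. i < N \<Longrightarrow> hol_at X x (g i)" "\<And>i. i < N \<Longrightarrow> u i \<in> S"
    "\<forall>\<^sub>F p in at x. v p = (\<Sum>i<(N::nat). g i p *s u i p)"
    using germ_spanE[OF v] by auto
  have "\<forall>\<^sub>F p in at x. w p = (\<Sum>i<N. g i p *s u i p)"
    using *(3) assms(2) by eventually_elim simp
  with *(1,2) show ?thesis by (rule germ_spanI)
qed

lemma germ_span_base: "riemann_surface X \<Longrightarrow> u \<in> S \<Longrightarrow> u \<in> germ_span X x S"
  by (rule germ_spanI[of 1 X x "\<lambda>_ _. 1" "\<lambda>_. u"]) (auto simp del: sum_constant)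

lemma germ_span_zero: "(\<lambda>p. 0) \<in> germ_span X x S"
  by (rule germ_spanI[of 0]) auto

lemma germ_span_add:
  assumes "v \<in> germ_span X x S" "w \<in> germ_span X x S"
  shows "(\<lambda>p. v p + w p) \<in> germ_span X x S"
proof -
  obtain N g u where v: "\<And>i. i < N \<Longrightarrow> hol_at X x (g i)" "\<And>i. i < N \<Longrightarrow> u i \<in> S"
    "\<forall>\<^sub>F p in at x. v p = (\<Sum>i<(N::nat). g i p *s u i p)"
    using germ_spanE[OF assms(1)] by auto
  obtain N' g' u' where w: "\<And>i. i < N' \<Longrightarrow> hol_at X x (g' i)" "\<And>i. i < N' \<Longrightarrow> u' i \<in> S"
    "\<forall>\<^sub>F p in at x. w p = (\<Sum>i<(N'::nat). g' i p *s u' i p)"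
    using germ_spanE[OF assms(2)] by auto
  define G where "G = (\<lambda>i. if i < N then g i else g' (i - N))"
  define H where "H = (\<lambda>i. if i < N then u i else u' (i - N))"
  have sum: "(\<Sum>i<N + N'. G i p *s H i p) = (\<Sum>i<N. g i p *s u i p) + (\<Sum>i<N'. g' i p *s u' i p)" for p
  proof -
    have "(\<Sum>i<N + N'. G i p *s H i p) = (\<Sum>i<N. G i p *s H i p) + (\<Sum>i=N..<N + N'. G i p *s H i p)"
      by (simp add: lessThan_atLeast0 sum.atLeastLessThan_concat)
    also have "(\<Sum>i=N..<N + N'. G i p *s H i p) = (\<Sum>i<N'. G (i + N) p *s H (i + N) p)"
      using sum.shift_bounds_nat_ivl[of "\<lambda>i. G i p *s H i p" 0 N N']
      by (simp add: lessThan_atLeast0 add.commute)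
    finally show ?thesis by (simp add: G_def H_def)
  qed
  show ?thesis
  proof (rule germ_spanI)
    show "hol_at X x (G i)" if "i < N + N'" for i using v(1) w(1)[of "i - N"] that by (auto simp: G_def)
    show "H i \<in> S" if "i < N + N'" for i using v(2) w(2)[of "i - N"] that by (auto simp: H_def)
    show "\<forall>\<^sub>F p in at x. v p + w p = (\<Sum>i<N + N'. G i p *s H i p)"
      using v(3) w(3) by eventually_elim (simp only: sum)
  qed
qed

lemma germ_span_scale:
  assumes X: "riemann_surface X" and v: "v \<in> germ_span X x S" and h: "hol_at X x h"
  shows "(\<lambda>p. h p *s v p) \<in> germ_span X x S"
proof -
  obtain N g u where *: "\<And>i. i < N \<Longrightarrow> hol_at X x (g i)" "\<And>i. i < N \<Longrightarrow> u i \<in> S"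
    "\<forall>\<^sub>F p in at x. v p = (\<Sum>i<(N::nat). g i p *s u i p)"
    using germ_spanE[OF v] by auto
  show ?thesis
  proof (rule germ_spanI)
    show "hol_at X x (\<lambda>p. h p * g i p)" if "i < N" for i by (intro hol_at_mult X h *(1) that)
    show "\<forall>\<^sub>F p in at x. h p *s v p = (\<Sum>i<N. (h p * g i p) *s u i p)"
      using *(3) by eventually_elim (simp add: vec.scale_sum_right)
  qed (use *(2) in auto)
qed

lemma germ_span_sum:
  assumes "\<And>i. i \<in> I \<Longrightarrow> v i \<in> germ_span X x S"
  shows "(\<lambda>p. \<Sum>i\<in>I. v i p) \<in> germ_span X x S"
  using assms by (induction I rule: infinite_finite_induct) (auto intro: germ_span_zero germ_span_add)

text \<open>L acts on fibres and may depend on the point in any way: pointwise linearity already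
  lets it commute with combinations over holomorphic coefficients, so generators decide.\<close>

lemma germ_span_linear:
  fixes L :: "'a::t2_space \<Rightarrow> complex^'n \<Rightarrow> complex^'m"
  assumes X: "riemann_surface X" and v: "v \<in> germ_span X x S"
    and add: "\<And>p u v. L p (u + v) = L p u + L p v" and scale: "\<And>p c u. L p (c *s u) = c *s L p u"
    and L: "\<And>u. u \<in> S \<Longrightarrow> (\<lambda>p. L p (u p)) \<in> germ_span X x T"
  shows "(\<lambda>p. L p (v p)) \<in> germ_span X x T"
proof -
  obtain N g u where *: "\<And>i. i < N \<Longrightarrow> hol_at X x (g i)" "\<And>i. i < N \<Longrightarrow> u i \<in> S"
    "\<forall>\<^sub>F p in at x. v p = (\<Sum>i<(N::nat). g i p *s u i p)"
    using germ_spanE[OF v] by auto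
  have L0: "L p 0 = 0" for p using scale[of p 0 0] by simp
  have sum: "L p (\<Sum>i\<in>I. g i p *s u i p) = (\<Sum>i\<in>I. g i p *s L p (u i p))" for p I
    by (induction I rule: infinite_finite_induct) (simp_all add: L0 add scale)
  have "(\<lambda>p. \<Sum>i<N. g i p *s L p (u i p)) \<in> germ_span X x T"
    by (intro germ_span_sum germ_span_scale X *(1) L *(2)) auto
  then show ?thesis
    by (rule germ_span_cong) (use *(3) in \<open>eventually_elim, simp add: sum\<close>)
qed

lemma germ_span_image:
  fixes M :: "'a::t2_space \<Rightarrow> complex^'n^'m"
  assumes X: "riemann_surface X" and v: "v \<in> germ_span X x S"
    and M: "\<And>u. u \<in> S \<Longrightarrow> (\<lambda>p. M p *v u p) \<in> germ_span X x T"
  shows "(\<lambda>p. M p *v v p) \<in> germ_span X x T"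
  by (rule germ_span_linear[OF X v]) (use M in \<open>simp_all add: vec.add vec.scale\<close>)

text \<open>Scalar counterpart of \<open>germ_span_image\<close>, with values in a power of the
  coordinate; it serves for coordinates in a frame and for the pairing that defines the
  dual.\<close>

lemma germ_span_functional:
  fixes M :: "'a::t2_space \<Rightarrow> complex^'n"
  assumes X: "riemann_surface X" and v: "v \<in> germ_span X x S"
    and M: "\<And>u. u \<in> S \<Longrightarrow> (\<lambda>p. \<Sum>i\<in>UNIV. M p $ i * u p $ i) \<in> zpow_module X x k"
  shows "(\<lambda>p. \<Sum>i\<in>UNIV. M p $ i * v p $ i) \<in> zpow_module X x k"
proof -
  obtain N g u where *: "\<And>i. i < N \<Longrightarrow> hol_at X x (g i)" "\<And>i. i < N \<Longrightarrow> u i \<in> S"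
    "\<forall>\<^sub>F p in at x. v p = (\<Sum>i<(N::nat). g i p *s u i p)"
    using germ_spanE[OF v] by auto
  have "(\<lambda>p. \<Sum>i<N. g i p * (\<Sum>j\<in>UNIV. M p $ j * u i p $ j)) \<in> zpow_module X x k"
  proof (rule zpow_module_sum[OF X])
    fix i assume "i \<in> {..<N}"
    then show "(\<lambda>p. g i p * (\<Sum>j\<in>UNIV. M p $ j * u i p $ j)) \<in> zpow_module X x k"
      using zpow_module_mult[OF X zpow_module_0I[OF *(1)[of i]] M[OF *(2)[of i]]] by simp
  qed
  then show ?thesis
  proof (rule zpow_module_cong)
    show "\<forall>\<^sub>F p in at x. (\<Sum>i<N. g i p * (\<Sum>j\<in>UNIV. M p $ j * u i p $ j)) = (\<Sum>i\<in>UNIV. M p $ i * v p $ i)"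
      using *(3)
    proof eventually_elim
      case (elim p)
      have "(\<Sum>j\<in>UNIV. M p $ j * v p $ j) = (\<Sum>j\<in>UNIV. \<Sum>i<N. M p $ j * (g i p * u i p $ j))"
        unfolding elim by (simp add: sum_distrib_left)
      also have "\<dots> = (\<Sum>i<N. \<Sum>j\<in>UNIV. M p $ j * (g i p * u i p $ j))" by (rule sum.swap)
      also have "\<dots> = (\<Sum>i<N. g i p * (\<Sum>j\<in>UNIV. M p $ j * u i p $ j))"
        by (simp add: sum_distrib_left mult.left_commute)
      finally show ?case by simp
    qed
  qed
qed

lemma germ_span_coordinate:
  fixes A :: "'a::t2_space \<Rightarrow> complex^'n^'m"
  assumes X: "riemann_surface X" and v: "v \<in> germ_span X x S"
    and M: "\<And>u. u \<in> S \<Longrightarrow> (\<lambda>p. (A p *v u p) $ j) \<in> zpow_module X x k"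
  shows "(\<lambda>p. (A p *v v p) $ j) \<in> zpow_module X x k"
  using germ_span_functional[OF X v, of "\<lambda>p. A p $ j"] M by (simp add: matrix_vector_mult_def)

section \<open>Bases adapted to a flag\<close>

text \<open>The basis grows from the smallest subspace to the largest. Vectors already chosen are
  kept, so the spanning property of the smaller subspaces is never lost.\<close>

lemma flag_basis_set:
  fixes V :: "nat \<Rightarrow> (complex^'n) set"
  assumes n: "V (Suc n) = {0}" and V: "\<And>j. j \<in> {1..n} \<Longrightarrow> V (Suc j) \<subseteq> V j"
  shows "\<exists>B. vec.independent B \<and> B \<subseteq> V 1 \<and> (\<forall>l\<in>{1..Suc n}. V l \<subseteq> vec.span (B \<inter> V l))"
proof -
  define Q where "Q = (\<lambda>k B. vec.independent B \<and> B \<subseteq> V k \<and> (\<forall>l\<in>{k..Suc n}. V l \<subseteq> vec.span (B \<inter> V l)))"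
  have "1 \<le> Suc n" by simp
  then have "\<exists>B. Q 1 B"
  \<comment> \<open>The induction descends from \<open>Suc n\<close>, where the subspace is zero and
    the basis is empty.\<close>
  proof (induction rule: inc_induct)
    case base
    have "Q (Suc n) {}" unfolding Q_def
      by (intro conjI vec.independent_empty) (use n in auto)
    then show ?case ..
  next
    case (step k)
    then obtain B where B: "vec.independent B" "B \<subseteq> V (Suc k)"
        "\<forall>l\<in>{Suc k..Suc n}. V l \<subseteq> vec.span (B \<inter> V l)"
      unfolding Q_def by (elim exE conjE)
    have "B \<subseteq> V k" using B(2) V[of k] step.hyps by auto
    then obtain B' where B': "B \<subseteq> B'" "B' \<subseteq> V k" "vec.independent B'" "V k \<subseteq> vec.span B'"
      using vec.maximal_independent_subset_extend[OF _ B(1)] by auto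
    have "V l \<subseteq> vec.span (B' \<inter> V l)" if l: "l \<in> {k..Suc n}" for l
    proof (cases "l = k")
      case True
      then show ?thesis using B'(2,4) by (simp add: Int_absorb2)
    next
      case False
      then have "V l \<subseteq> vec.span (B \<inter> V l)" using B(3) l by auto
      also have "\<dots> \<subseteq> vec.span (B' \<inter> V l)" by (rule vec.span_mono) (use B'(1) in auto)
      finally show ?thesis .
    qed
    then have "Q k B'" using B'(2,3) by (simp add: Q_def)
    then show ?case ..
  qed
  then show ?thesis unfolding Q_def .
qed

text \<open>The columns of P are an adapted basis and \<open>\<iota> i\<close> is the depth of the
  i-th column in the flag; in this basis every step of the flag is a coordinate subspace.\<close>

lemma flag_basis:
  fixes V :: "nat \<Rightarrow> (complex^'n) set"
  assumes V1: "V 1 = UNIV" and n: "V (Suc n) = {0}"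
    and V': "\<forall>j\<in>{1..n}. vec.subspace (V j) \<and> V (Suc j) \<subset> V j"
  shows "\<exists>(P :: complex^'n^'n) (\<iota> :: 'n \<Rightarrow> nat). invertible P \<and> (\<forall>i. \<iota> i \<in> {1..n}) \<and>
    (\<forall>k\<in>{1..Suc n}. \<forall>c. P *v c \<in> V k \<longleftrightarrow> (\<forall>i. \<iota> i < k \<longrightarrow> c $ i = 0))"
proof -
  have V: "vec.subspace (V j)" "V (Suc j) \<subset> V j" if "j \<in> {1..n}" for j
    using V' that by auto
  have sub: "vec.subspace (V k)" if "k \<in> {1..Suc n}" for k
    using V(1)[of k] n that by (cases "k = Suc n") (auto simp: vec.subspace_def)
  have anti: "V l \<subseteq> V k" if "k \<le> l" "1 \<le> k" "l \<le> Suc n" for k l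
    using that
  proof (induction l rule: dec_induct)
    case (step l)
    then show ?case using V(2)[of l] by auto
  qed simp
  have "\<And>j. j \<in> {1..n} \<Longrightarrow> V (Suc j) \<subseteq> V j" using V(2) by (simp add: psubset_eq)
  from flag_basis_set[OF n this]
  obtain B where B: "vec.independent B" "\<And>l. l \<in> {1..Suc n} \<Longrightarrow> V l \<subseteq> vec.span (B \<inter> V l)"
    by auto
  have span: "vec.span B = UNIV" using B(2)[of 1] V1 by auto
  have finB: "finite B" by (rule vec.finiteI_independent[OF B(1)])
  have "card B = CARD('n)"
    using vec.basis_card_eq_dim[of B UNIV] B(1) span vec_dim_card by simp
  then obtain b where b: "bij_betw b (UNIV :: 'n set) B"
    using finite_same_card_bij[of "UNIV :: 'n set" B] finB by auto
  have bB: "b i \<in> B" for i using bij_betwE[OF b] by simp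
  have inj: "b i = b j \<longleftrightarrow> i = j" for i j
    using bij_betw_imp_inj_on[OF b] by (auto simp: inj_on_def)
  define P where "P = (\<chi> r i. b i $ r)"
  have col: "column i P = b i" for i by (simp add: column_def P_def)
  have Pv: "P *v c = (\<Sum>i\<in>UNIV. c $ i *s b i)" for c
    unfolding matrix_vector_columns col ..
  have "columns P = B"
    using bij_betw_imp_surj_on[OF b] unfolding columns_def col by auto
  then have inv: "invertible P"
    using matrix_right_invertible_span_columns[of P] span by (simp add: invertible_right_inverse)
  \<comment> \<open>The last step of the flag containing \<open>b i\<close>. It exists within
    \<open>{1..n}\<close> because the first step is everything and a basis vector is never in the
    zero space.\<close>
  define \<iota> where "\<iota> = (\<lambda>i. Max {k \<in> {1..n}. b i \<in> V k})"
  have "0 \<notin> B"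
  proof
    assume "0 \<in> B"
    from vec.dependent_zero[OF this] B(1) show False by contradiction
  qed
  have b0: "b i \<notin> V (Suc n)" for i
  proof
    assume "b i \<in> V (Suc n)"
    then have "b i = 0" unfolding n by (rule singletonD)
    then have "0 \<in> B" using bB[of i] by (rule subst)
    with \<open>0 \<notin> B\<close> show False by contradiction
  qed
  \<comment> \<open>For \<open>n = 0\<close> the first step would be both the whole space and zero,
    which a basis vector contradicts.\<close>
  have n1: "1 \<le> n"
  proof (rule ccontr)
    assume "\<not> 1 \<le> n"
    then have "Suc n = 1" by simp
    then show False using b0[of undefined] V1 by simp
  qed
  have "1 \<in> {k \<in> {1..n}. b i \<in> V k}" for i
    by (rule CollectI, unfold V1) (use n1 in simp)
  then have "{k \<in> {1..n}. b i \<in> V k} \<noteq> {}" for i by (rule ex_in_conv[THEN iffD1, OF exI])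
  then have "\<iota> i \<in> {k \<in> {1..n}. b i \<in> V k}" for i
    unfolding \<iota>_def by (intro Max_in) auto
  then have \<iota>: "\<iota> i \<in> {1..n}" "b i \<in> V (\<iota> i)" for i by auto
  have b_iff: "b i \<in> V k \<longleftrightarrow> k \<le> \<iota> i" if k: "k \<in> {1..Suc n}" for i k
  proof
    assume bk: "b i \<in> V k"
    then have "k \<noteq> Suc n" using b0[of i] by auto
    then show "k \<le> \<iota> i" unfolding \<iota>_def using k bk by (intro Max_ge) auto
  next
    assume "k \<le> \<iota> i"
    then show "b i \<in> V k" using anti[of k "\<iota> i"] \<iota>[of i] k by auto
  qed
  show ?thesis
  proof (intro exI[of _ P] exI[of _ \<iota>] conjI allI ballI)
    show "invertible P" "\<iota> i \<in> {1..n}" for i by fact+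
    fix k c assume k: "k \<in> {1..Suc n}"
    show "P *v c \<in> V k \<longleftrightarrow> (\<forall>i. \<iota> i < k \<longrightarrow> c $ i = 0)"
    proof
      assume Pc: "P *v c \<in> V k"
      show "\<forall>i. \<iota> i < k \<longrightarrow> c $ i = 0"
      \<comment> \<open>A nonzero coefficient at some \<open>b i\<close> outside \<open>V k\<close>
        would express \<open>b i\<close> through the other basis vectors, since \<open>V k\<close>
        is spanned by the basis vectors it contains.\<close>
      proof (intro allI impI, rule ccontr)
        fix i assume i: "\<iota> i < k" "c $ i \<noteq> 0"
        have "b i \<notin> V k" using b_iff[OF k, of i] i(1) by simp
        then have "B \<inter> V k \<subseteq> B - {b i}" by auto
        then have 1: "P *v c \<in> vec.span (B - {b i})"
          by (rule subsetD[OF vec.span_mono subsetD[OF B(2)[OF k] Pc]])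
        have 2: "(\<Sum>j\<in>UNIV - {i}. c $ j *s b j) \<in> vec.span (B - {b i})"
        proof (rule vec.span_sum)
          fix j assume "j \<in> UNIV - {i}"
          then have "b j \<in> B - {b i}" using bB inj by auto
          then show "c $ j *s b j \<in> vec.span (B - {b i})"
            by (intro vec.span_scale vec.span_base)
        qed
        have "P *v c = c $ i *s b i + (\<Sum>j\<in>UNIV - {i}. c $ j *s b j)"
          unfolding Pv by (rule sum.remove) auto
        then have "c $ i *s b i = P *v c - (\<Sum>j\<in>UNIV - {i}. c $ j *s b j)" by simp
        then have "c $ i *s b i \<in> vec.span (B - {b i})"
          using vec.span_diff[OF 1 2] by simp
        from vec.span_scale[OF this, of "inverse (c $ i)"]
        have "b i \<in> vec.span (B - {b i})" using i(2) by simp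
        with bB[of i] have "vec.dependent B" unfolding vec.dependent_def by (intro bexI[of _ "b i"])
        then show False using B(1) by contradiction
      qed
    next
      assume c: "\<forall>i. \<iota> i < k \<longrightarrow> c $ i = 0"
      show "P *v c \<in> V k"
        unfolding Pv
      proof (rule vec.subspace_sum[OF sub[OF k]])
        fix i
        show "c $ i *s b i \<in> V k"
        proof (cases "\<iota> i < k")
          case True
          then show ?thesis using c vec.subspace_0[OF sub[OF k]] by simp
        next
          case False
          then have "b i \<in> V k" using b_iff[OF k, of i] by simp
          then show ?thesis by (rule vec.subspace_scale[OF sub[OF k]])
        qed
      qed
    qed
  qed
qed

text \<open>As the weights increase, the least index with weight at least t lies beyond k exactly
  when \<open>\<alpha> k\<close> is still too small. The default \<open>Suc n\<close> fits: it lies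
  beyond every k.\<close>

lemma weight_index_less:
  assumes "strict_mono_on {1..n} \<alpha>" "k \<in> {1..n}"
  shows "k < weight_index n \<alpha> t \<longleftrightarrow> \<alpha> k < t"
proof -
  define Q where "Q = (\<lambda>j. 1 \<le> j \<and> (j \<le> n \<longrightarrow> t \<le> \<alpha> j))"
  have L: "weight_index n \<alpha> t = (LEAST j. Q j)" by (simp add: weight_index_def Q_def)
  have "Q (Suc n)" by (simp add: Q_def)
  then have QL: "Q (LEAST j. Q j)" by (rule LeastI)
  show ?thesis
  proof
    assume "k < weight_index n \<alpha> t"
    then have "\<not> Q k" unfolding L by (rule not_less_Least)
    then show "\<alpha> k < t" using assms(2) by (auto simp: Q_def)
  next
    assume k: "\<alpha> k < t"
    show "k < weight_index n \<alpha> t"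
    proof (rule ccontr)
      assume "\<not> ?thesis"
      then have l: "(LEAST j. Q j) \<le> k" by (simp add: L)
      then have "t \<le> \<alpha> (LEAST j. Q j)" "1 \<le> (LEAST j. Q j)" using QL assms(2) by (auto simp: Q_def)
      moreover have "\<alpha> (LEAST j. Q j) \<le> \<alpha> k"
        using strict_mono_on_leD[OF assms(1), of "LEAST j. Q j" k] l assms(2) \<open>1 \<le> (LEAST j. Q j)\<close> by auto
      ultimately show False using k by simp
    qed
  qed
qed

lemma weight_index_range: "weight_index n \<alpha> t \<in> {1..Suc n}"
proof -
  define Q where "Q = (\<lambda>j. 1 \<le> j \<and> (j \<le> n \<longrightarrow> t \<le> \<alpha> j))"
  have L: "weight_index n \<alpha> t = (LEAST j. Q j)" by (simp add: weight_index_def Q_def)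
  have Q: "Q (Suc n)" by (simp add: Q_def)
  then have "Q (LEAST j. Q j)" by (rule LeastI)
  moreover have "(LEAST j. Q j) \<le> Suc n" using Q by (rule Least_le)
  ultimately show ?thesis by (simp add: L Q_def)
qed

section \<open>Frames adapted to the weights\<close>

definition weighted_germs ::
    "'a::t2_space atlas \<Rightarrow> 'a \<Rightarrow> ('a \<Rightarrow> complex^'n^'n) \<Rightarrow> ('n \<Rightarrow> real) \<Rightarrow> real
       \<Rightarrow> ('a \<Rightarrow> complex^'n) set" where
  "weighted_germs X x \<sigma> \<beta> t =
     {v. \<forall>i. (\<lambda>p. (matrix_inv (\<sigma> p) *v v p) $ i) \<in> zpow_module X x \<lceil>t - \<beta> i\<rceil>}"

text \<open>
  Only one inclusion is required for general \<open>t\<close>: for \<open>t < 0\<close> the definition of a presentation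
  determines \<open>stalk E x t\<close> only up to equality of germs.
\<close>

definition adapted_frame ::
    "'a::t2_space atlas \<Rightarrow> 'a set \<Rightarrow> ('a, 'n::finite) parabolic_data \<Rightarrow> 'a
       \<Rightarrow> ('a \<Rightarrow> complex^'n^'n) \<Rightarrow> ('n \<Rightarrow> real) \<Rightarrow> bool" where
  "adapted_frame X D E x \<sigma> \<beta> \<longleftrightarrow> punctured_frame X D E x \<sigma> \<and>
     (\<forall>i. (\<lambda>p. column i (\<sigma> p)) \<in> stalk E x (\<beta> i)) \<and>
     (\<forall>t. stalk E x t \<subseteq> weighted_germs X x \<sigma> \<beta> t)"

text \<open>A germ that vanishes identically near x has no order, hence the case
  distinction.\<close>

lemma zero_imp_zpow_module_1:
  assumes X: "riemann_surface X" and g: "hol_at X x g" "g x = 0"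
  shows "g \<in> zpow_module X x 1"
proof (cases "\<forall>\<^sub>F p in at x. g p = 0")
  case True
  then have "\<forall>\<^sub>F p in at x. 0 = g p" by eventually_elim simp
  then show ?thesis by (rule zpow_module_cong[OF zpow_module_zero[OF X]])
next
  case False
  then have "\<exists>\<^sub>F p in at x. g p \<noteq> 0" by (simp add: frequently_def)
  from has_order_at_zero[OF X g this]
  show ?thesis
    using zpow_module_mono[OF X has_order_at_imp_zpow_module, of x g "ord_at X x g" 1] by simp
qed

text \<open>For weights in \<open>[0, 1)\<close> the ceiling is 1 or 0, so the twist reduces to a
  vanishing condition at x. This links \<open>weighted_germs\<close> to the flag in the
  fibre.\<close>

lemma zpow_module_unit_interval:
  assumes X: "riemann_surface X" and t: "0 \<le> t" "t < (1::real)" and \<beta>: "0 \<le> \<beta>" "\<beta> < 1"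
  shows "g \<in> zpow_module X x \<lceil>t - \<beta>\<rceil> \<longleftrightarrow>
    (\<exists>h. hol_at X x h \<and> (\<beta> < t \<longrightarrow> h x = 0) \<and> (\<forall>\<^sub>F p in at x. g p = h p))"
proof (cases "\<beta> < t")
  case True
  then have c: "\<lceil>t - \<beta>\<rceil> = 1" using t \<beta> by (simp add: ceiling_eq_iff)
  show ?thesis
    unfolding c
  proof
    assume "g \<in> zpow_module X x 1"
    then obtain h where h: "hol_at X x h" "\<forall>\<^sub>F p in at x. g p = coord_at X x p powi 1 * h p"
      by (rule zpow_moduleE)
    show "\<exists>h. hol_at X x h \<and> (\<beta> < t \<longrightarrow> h x = 0) \<and> (\<forall>\<^sub>F p in at x. g p = h p)"
    proof (intro exI[of _ "\<lambda>p. coord_at X x p * h p"] conjI)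
      show "hol_at X x (\<lambda>p. coord_at X x p * h p)"
        by (intro hol_at_mult X h(1) hol_at_coord_at chart_at_mem)
    qed (use h(2) in simp_all)
  next
    assume "\<exists>h. hol_at X x h \<and> (\<beta> < t \<longrightarrow> h x = 0) \<and> (\<forall>\<^sub>F p in at x. g p = h p)"
    then obtain h where h: "hol_at X x h" "h x = 0" "\<forall>\<^sub>F p in at x. g p = h p" using True by auto
    have "\<forall>\<^sub>F p in at x. h p = g p" using h(3) by eventually_elim simp
    then show "g \<in> zpow_module X x 1"
      by (rule zpow_module_cong[OF zero_imp_zpow_module_1[OF X h(1,2)]])
  qed
next
  case False
  then have c: "\<lceil>t - \<beta>\<rceil> = 0" using t \<beta> by (simp add: ceiling_eq_iff)
  show ?thesis
    unfolding c
  proof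
    assume "g \<in> zpow_module X x 0"
    then obtain h where "hol_at X x h" "\<forall>\<^sub>F p in at x. g p = h p" by (rule zpow_module_0E)
    then show "\<exists>h. hol_at X x h \<and> (\<beta> < t \<longrightarrow> h x = 0) \<and> (\<forall>\<^sub>F p in at x. g p = h p)"
      using False by (intro exI[of _ h]) simp
  next
    assume "\<exists>h. hol_at X x h \<and> (\<beta> < t \<longrightarrow> h x = 0) \<and> (\<forall>\<^sub>F p in at x. g p = h p)"
    then obtain h where h: "hol_at X x h" "\<forall>\<^sub>F p in at x. g p = h p" by auto
    have "\<forall>\<^sub>F p in at x. h p = g p" using h(2) by eventually_elim simp
    then show "g \<in> zpow_module X x 0" by (rule zpow_module_cong[OF zpow_module_0I[OF h(1)]])
  qed
qed

lemma weighted_germs_unit_interval: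
  fixes \<sigma> :: "'a::t2_space \<Rightarrow> complex^'n^'n"
  assumes X: "riemann_surface X" and \<sigma>: "\<forall>\<^sub>F p in at x. invertible (\<sigma> p)"
    and t: "0 \<le> t" "t < (1::real)" and \<beta>: "\<And>i. 0 \<le> \<beta> i" "\<And>i. \<beta> i < 1"
  shows "weighted_germs X x \<sigma> \<beta> t = frame_germs X x \<sigma> {c. \<forall>i. \<beta> i < t \<longrightarrow> c $ i = 0}"
proof (intro equalityI subsetI)
  fix v assume "v \<in> weighted_germs X x \<sigma> \<beta> t"
  then have "\<forall>i. \<exists>h. hol_at X x h \<and> (\<beta> i < t \<longrightarrow> h x = 0) \<and>
      (\<forall>\<^sub>F p in at x. (matrix_inv (\<sigma> p) *v v p) $ i = h p)"
    unfolding weighted_germs_def mem_Collect_eq zpow_module_unit_interval[OF X t \<beta>] .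
  then obtain h where h: "\<forall>i. hol_at X x (h i) \<and> (\<beta> i < t \<longrightarrow> h i x = 0) \<and>
      (\<forall>\<^sub>F p in at x. (matrix_inv (\<sigma> p) *v v p) $ i = h i p)"
    unfolding choice_iff by (rule exE)
  define c where "c = (\<lambda>p. \<chi> i. h i p)"
  have "\<forall>\<^sub>F p in at x. \<forall>i. (matrix_inv (\<sigma> p) *v v p) $ i = h i p"
    by (rule eventually_all_finite) (use h in simp)
  then have "\<forall>\<^sub>F p in at x. v p = \<sigma> p *v c p"
    using \<sigma>
  proof eventually_elim
    case (elim p)
    then have "matrix_inv (\<sigma> p) *v v p = c p" by (simp add: c_def vec_eq_iff)
    then show ?case using matrix_inv_vector(1)[OF elim(2), of "v p"] by simp
  qed
  then show "v \<in> frame_germs X x \<sigma> {c. \<forall>i. \<beta> i < t \<longrightarrow> c $ i = 0}"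
    unfolding frame_germs_def by (intro CollectI exI[of _ c]) (use h in \<open>simp add: c_def\<close>)
next
  fix v assume "v \<in> frame_germs X x \<sigma> {c. \<forall>i. \<beta> i < t \<longrightarrow> c $ i = 0}"
  then obtain c :: "'a \<Rightarrow> complex^'n" where c: "\<forall>i. hol_at X x (\<lambda>p. c p $ i)" "\<forall>i. \<beta> i < t \<longrightarrow> c x $ i = 0"
      "\<forall>\<^sub>F p in at x. v p = \<sigma> p *v c p"
    unfolding frame_germs_def by auto
  have ev: "\<forall>\<^sub>F p in at x. (matrix_inv (\<sigma> p) *v v p) $ i = c p $ i" for i
    using c(3) \<sigma> by eventually_elim (simp add: matrix_inv_vector(2))
  show "v \<in> weighted_germs X x \<sigma> \<beta> t"
    unfolding weighted_germs_def mem_Collect_eq zpow_module_unit_interval[OF X t \<beta>]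
  proof
    fix i
    show "\<exists>h. hol_at X x h \<and> (\<beta> i < t \<longrightarrow> h x = 0) \<and>
        (\<forall>\<^sub>F p in at x. (matrix_inv (\<sigma> p) *v v p) $ i = h p)"
      using c(1,2) ev[of i] by (intro exI[of _ "\<lambda>p. c p $ i"]) simp
  qed
qed

lemma weighted_germs_shift:
  assumes X: "riemann_surface X"
  shows "(\<lambda>p. coord_at X x p *s v p) \<in> weighted_germs X x \<sigma> \<beta> (t + 1) \<longleftrightarrow>
    v \<in> weighted_germs X x \<sigma> \<beta> t"
proof -
  have "\<lceil>t + 1 - \<beta> i\<rceil> - 1 = \<lceil>t - \<beta> i\<rceil>" for i
    using ceiling_add_one[of "t - \<beta> i"] by (simp add: algebra_simps)
  then show ?thesis
    using zpow_module_mult_coord[OF X, of x 1] by (simp add: weighted_germs_def vec.scale)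
qed

lemma weighted_germs_cong:
  assumes "v \<in> weighted_germs X x \<sigma> \<beta> t" "\<forall>\<^sub>F p in at x. v p = w p"
  shows "w \<in> weighted_germs X x \<sigma> \<beta> t"
  unfolding weighted_germs_def
proof (intro CollectI allI)
  fix i
  have "(\<lambda>p. (matrix_inv (\<sigma> p) *v v p) $ i) \<in> zpow_module X x \<lceil>t - \<beta> i\<rceil>"
    using assms(1) by (simp add: weighted_germs_def)
  then show "(\<lambda>p. (matrix_inv (\<sigma> p) *v w p) $ i) \<in> zpow_module X x \<lceil>t - \<beta> i\<rceil>"
    by (rule zpow_module_cong) (use assms(2) in \<open>eventually_elim, simp\<close>)
qed

text \<open>On \<open>[0, 1)\<close> the modules are read off from the flag, and the shift by 1
  propagates the inclusion to all t. The basis P is a hypothesis, so that for a line bundle the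
  given frame can be kept unchanged.\<close>

lemma presentation_imp_adapted_frame:
  fixes E :: "('a::t2_space, 'n::finite) parabolic_data"
  assumes X: "riemann_surface X" and E: "holomorphic_bundle_off X D E"
    and p: "parabolic_presentation X D E x \<tau> n V \<alpha>"
    and P: "invertible P" "\<And>i. \<iota> i \<in> {1..n}"
    "\<And>k c. k \<in> {1..Suc n} \<Longrightarrow> P *v c \<in> V k \<longleftrightarrow> (\<forall>i. \<iota> i < k \<longrightarrow> c $ i = 0)"
  shows "adapted_frame X D E x (\<lambda>p. \<tau> p ** P) (\<lambda>i. \<alpha> (\<iota> i))"
proof -
  define \<sigma> where "\<sigma> = (\<lambda>p. \<tau> p ** P)"
  define \<beta> where "\<beta> = (\<lambda>i. \<alpha> (\<iota> i))"
  have \<tau>: "punctured_frame X D E x \<tau>" and flag: "is_weighted_flag n V \<alpha>"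
    and stalk: "\<And>t. 0 \<le> t \<Longrightarrow> t < 1 \<Longrightarrow> stalk E x t = frame_germs X x \<tau> (V (weight_index n \<alpha> t))"
    and shift: "\<And>t. stalk E x (t + 1) =
        {s. \<exists>u\<in>stalk E x t. \<forall>\<^sub>F p in at x. s p = coord_at X x p *s u p}"
    using p unfolding parabolic_presentation_def by auto
  have mono: "strict_mono_on {1..n} \<alpha>" and \<alpha>: "\<And>j. j \<in> {1..n} \<Longrightarrow> 0 \<le> \<alpha> j \<and> \<alpha> j < 1"
    using flag unfolding is_weighted_flag_def by auto
  have \<beta>: "0 \<le> \<beta> i" "\<beta> i < 1" for i using \<alpha>[OF P(2)[of i]] by (auto simp: \<beta>_def)
  have \<sigma>: "punctured_frame X D E x \<sigma>"
    unfolding \<sigma>_def by (rule punctured_frame_mult[OF X E \<tau> open_UNIV]) (use P(1) hol_matrix_at_const[OF X] in auto)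
  have ev: "\<forall>\<^sub>F p in at x. invertible (\<sigma> p)" by (rule punctured_frame_invertible[OF \<sigma>])
  \<comment> \<open>A constant change of basis suffices because the flag lives in the single fibre
    at x.\<close>
  have change: "frame_germs X x \<tau> W = frame_germs X x \<sigma> {c. P *v c \<in> W}" for W
  proof (intro equalityI subsetI)
    fix v assume "v \<in> frame_germs X x \<tau> W"
    then obtain c :: "'a \<Rightarrow> complex^'n" where c: "\<forall>i. hol_at X x (\<lambda>p. c p $ i)" "c x \<in> W" "\<forall>\<^sub>F p in at x. v p = \<tau> p *v c p"
      unfolding frame_germs_def by auto
    have "\<forall>\<^sub>F p in at x. v p = \<sigma> p *v (matrix_inv P *v c p)"
      using c(3) by eventually_elim
        (simp add: \<sigma>_def matrix_vector_mul_assoc[symmetric] matrix_inv_vector(1)[OF P(1)])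
    moreover have "hol_at X x (\<lambda>p. (matrix_inv P *v c p) $ i)" for i
      unfolding matrix_vector_mult_def using c(1) by (simp add: hol_at_sum hol_at_mult X)
    moreover have "P *v (matrix_inv P *v c x) \<in> W" using c(2) by (simp add: matrix_inv_vector(1)[OF P(1)])
    ultimately show "v \<in> frame_germs X x \<sigma> {c. P *v c \<in> W}"
      unfolding frame_germs_def by (intro CollectI exI[of _ "\<lambda>p. matrix_inv P *v c p"]) simp
  next
    fix v assume "v \<in> frame_germs X x \<sigma> {c. P *v c \<in> W}"
    then obtain c :: "'a \<Rightarrow> complex^'n" where c: "\<forall>i. hol_at X x (\<lambda>p. c p $ i)" "P *v c x \<in> W" "\<forall>\<^sub>F p in at x. v p = \<sigma> p *v c p"
      unfolding frame_germs_def by auto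
    have "\<forall>\<^sub>F p in at x. v p = \<tau> p *v (P *v c p)"
      using c(3) by eventually_elim (simp add: \<sigma>_def matrix_vector_mul_assoc)
    moreover have "hol_at X x (\<lambda>p. (P *v c p) $ i)" for i
      unfolding matrix_vector_mult_def using c(1) by (simp add: hol_at_sum hol_at_mult X)
    ultimately show "v \<in> frame_germs X x \<tau> W"
      unfolding frame_germs_def using c(2) by (intro CollectI exI[of _ "\<lambda>p. P *v c p"]) simp
  qed
  have eq: "stalk E x t = weighted_germs X x \<sigma> \<beta> t" if t: "0 \<le> t" "t < 1" for t
  proof -
    have "{c. P *v c \<in> V (weight_index n \<alpha> t)} = {c. \<forall>i. \<beta> i < t \<longrightarrow> c $ i = 0}"
      unfolding P(3)[OF weight_index_range] weight_index_less[OF mono P(2)] \<beta>_def ..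
    then show ?thesis
      unfolding stalk[OF t] change weighted_germs_unit_interval[OF X ev t \<beta>] by simp
  qed
  have sub: "stalk E x t \<subseteq> weighted_germs X x \<sigma> \<beta> t" for t
  proof -
    have up: "stalk E x (t + 1) \<subseteq> weighted_germs X x \<sigma> \<beta> (t + 1)"
      if "stalk E x t \<subseteq> weighted_germs X x \<sigma> \<beta> t" for t
    proof
      fix s assume "s \<in> stalk E x (t + 1)"
      then obtain u where u: "u \<in> stalk E x t" "\<forall>\<^sub>F p in at x. s p = coord_at X x p *s u p"
        unfolding shift by auto
      have "(\<lambda>p. coord_at X x p *s u p) \<in> weighted_germs X x \<sigma> \<beta> (t + 1)"
        unfolding weighted_germs_shift[OF X] using u(1) that by auto
      then show "s \<in> weighted_germs X x \<sigma> \<beta> (t + 1)"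
        by (rule weighted_germs_cong) (use u(2) in \<open>eventually_elim, simp\<close>)
    qed
    \<comment> \<open>Downwards the inclusion is tested after multiplication by the coordinate,
      which neither module loses track of.\<close>
    have down: "stalk E x t \<subseteq> weighted_germs X x \<sigma> \<beta> t"
      if "stalk E x (t + 1) \<subseteq> weighted_germs X x \<sigma> \<beta> (t + 1)" for t
    proof
      fix s assume "s \<in> stalk E x t"
      then have "(\<lambda>p. coord_at X x p *s s p) \<in> stalk E x (t + 1)"
        unfolding shift by (intro CollectI bexI[of _ s]) auto
      then have "(\<lambda>p. coord_at X x p *s s p) \<in> weighted_germs X x \<sigma> \<beta> (t + 1)" using that by auto
      then show "s \<in> weighted_germs X x \<sigma> \<beta> t" unfolding weighted_germs_shift[OF X] .
    qed
    \<comment> \<open>Every t differs by an integer from \<open>frac t\<close>, where equality is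
      known; the induction runs in both directions.\<close>
    have "stalk E x (frac t + of_int k) \<subseteq> weighted_germs X x \<sigma> \<beta> (frac t + of_int k)" for k
    proof (induction k rule: int_induct[where k = 0])
      case base
      show ?case using eq[of "frac t"] by (simp add: frac_ge_0 frac_lt_1)
    next
      case (step1 k)
      then show ?case using up[of "frac t + of_int k"] by (simp add: add.assoc)
    next
      case (step2 k)
      then show ?case using down[of "frac t + of_int (k - 1)"] by (simp add: add.assoc)
    qed
    from this[of "\<lfloor>t\<rfloor>"] show ?thesis by (simp add: frac_def)
  qed
  \<comment> \<open>Since \<open>\<beta> i\<close> lies in \<open>[0, 1)\<close>, the equality of
    modules applies there; in the frame the column has the single coordinate 1, at weight difference
    0.\<close>
  have "(\<lambda>p. column i (\<sigma> p)) \<in> stalk E x (\<beta> i)" for i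
    unfolding eq[OF \<beta>] weighted_germs_def
  proof (intro CollectI allI)
    fix j
    have "hol_at X x (\<lambda>p. axis i 1 $ j)" using X by simp
    moreover have "\<lceil>\<beta> i - \<beta> j\<rceil> \<le> 0" if "i = j" using that by simp
    ultimately have "(\<lambda>p. axis i 1 $ j) \<in> zpow_module X x \<lceil>\<beta> i - \<beta> j\<rceil>"
      using zpow_module_mono[OF X zpow_module_0I] zpow_module_zero[OF X] by (cases "i = j") (auto simp: axis_def)
    then show "(\<lambda>p. (matrix_inv (\<sigma> p) *v column i (\<sigma> p)) $ j) \<in> zpow_module X x \<lceil>\<beta> i - \<beta> j\<rceil>"
      by (rule zpow_module_cong)
        (use ev in \<open>eventually_elim, simp add: matrix_vector_axis[symmetric] matrix_inv_vector(2)\<close>)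
  qed
  then show ?thesis
    using \<sigma> sub unfolding adapted_frame_def \<sigma>_def \<beta>_def by simp
qed

lemma adapted_frame_exists:
  fixes E :: "('a::t2_space, 'n::finite) parabolic_data"
  assumes X: "riemann_surface X" and E: "parabolic_bundle X D E" and x: "x \<in> D"
  obtains \<sigma> \<beta> where "adapted_frame X D E x \<sigma> \<beta>"
proof -
  obtain \<tau> n V \<alpha> where p: "parabolic_presentation X D E x \<tau> n V \<alpha>"
    using E x unfolding parabolic_bundle_def by auto
  have off: "holomorphic_bundle_off X D E" using E unfolding parabolic_bundle_def by simp
  have V: "V 1 = UNIV" "V (Suc n) = {0}" "\<forall>j\<in>{1..n}. vec.subspace (V j) \<and> V (Suc j) \<subset> V j"
    using p unfolding parabolic_presentation_def is_weighted_flag_def by auto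
  obtain P :: "complex^'n^'n" and \<iota> where P: "invertible P" "\<forall>i. \<iota> i \<in> {1..n}"
    "\<forall>k\<in>{1..Suc n}. \<forall>c. P *v c \<in> V k \<longleftrightarrow> (\<forall>i. \<iota> i < k \<longrightarrow> c $ i = 0)"
    using flag_basis[OF V] by (elim exE conjE)
  have "adapted_frame X D E x (\<lambda>p. \<tau> p ** P) (\<lambda>i. \<alpha> (\<iota> i))"
    by (rule presentation_imp_adapted_frame[OF X off p P(1)]) (use P(2,3) in auto)
  then show ?thesis by (rule that)
qed

text \<open>A way back from frames to presentations, for pullbacks: their modules are spans of
  germs, so equality with \<open>weighted_germs\<close> can be had for every t.\<close>

lemma weighted_germs_presentation:
  fixes E :: "('a::t2_space, 'n::finite) parabolic_data"
  assumes X: "riemann_surface X" and \<sigma>: "punctured_frame X D E x \<sigma>"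
    and stalk: "\<And>t. stalk E x t = weighted_germs X x \<sigma> \<beta> t"
    and \<beta>: "\<And>i. 0 \<le> \<beta> i" "\<And>i. \<beta> i < 1"
    and flag: "is_weighted_flag n V \<alpha>"
    and V: "\<And>t (c :: complex^'n). c \<in> V (weight_index n \<alpha> t) \<longleftrightarrow> (\<forall>i. \<beta> i < t \<longrightarrow> c $ i = 0)"
  shows "parabolic_presentation X D E x \<sigma> n V \<alpha>"
  unfolding parabolic_presentation_def
proof (intro conjI allI impI)
  show "punctured_frame X D E x \<sigma>" "is_weighted_flag n V \<alpha>" by fact+
  note ev = punctured_frame_invertible[OF \<sigma>]
  show "stalk E x t = frame_germs X x \<sigma> (V (weight_index n \<alpha> t))" if t: "0 \<le> t \<and> t < 1" for t
  proof -
    have "V (weight_index n \<alpha> t) = {c. \<forall>i. \<beta> i < t \<longrightarrow> c $ i = 0}" using V by auto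
    then show ?thesis
      using weighted_germs_unit_interval[OF X ev _ _ \<beta>, of t] t by (simp add: stalk)
  qed
  show "stalk E x (t + 1) = {s. \<exists>u\<in>stalk E x t. \<forall>\<^sub>F p in at x. s p = coord_at X x p *s u p}" for t
    unfolding stalk
  proof (intro equalityI subsetI)
    fix s assume s: "s \<in> weighted_germs X x \<sigma> \<beta> (t + 1)"
    \<comment> \<open>Division by the coordinate; its vanishing at x does not matter for germs on a
      punctured neighbourhood.\<close>
    define u where "u = (\<lambda>p. inverse (coord_at X x p) *s s p)"
    have ev: "\<forall>\<^sub>F p in at x. s p = coord_at X x p *s u p"
      using eventually_coord_at_nonzero[OF X, of x] by eventually_elim (simp add: u_def)
    then have "(\<lambda>p. coord_at X x p *s u p) \<in> weighted_germs X x \<sigma> \<beta> (t + 1)"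
      by (rule weighted_germs_cong[OF s])
    then have "u \<in> weighted_germs X x \<sigma> \<beta> t" unfolding weighted_germs_shift[OF X] .
    then show "s \<in> {s. \<exists>u\<in>weighted_germs X x \<sigma> \<beta> t. \<forall>\<^sub>F p in at x. s p = coord_at X x p *s u p}"
      using ev by (intro CollectI bexI[of _ u])
  next
    fix s assume "s \<in> {s. \<exists>u\<in>weighted_germs X x \<sigma> \<beta> t. \<forall>\<^sub>F p in at x. s p = coord_at X x p *s u p}"
    then obtain u where u: "u \<in> weighted_germs X x \<sigma> \<beta> t" "\<forall>\<^sub>F p in at x. s p = coord_at X x p *s u p"
      by auto
    have "(\<lambda>p. coord_at X x p *s u p) \<in> weighted_germs X x \<sigma> \<beta> (t + 1)"
      unfolding weighted_germs_shift[OF X] by (rule u(1))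
    then show "s \<in> weighted_germs X x \<sigma> \<beta> (t + 1)"
      by (rule weighted_germs_cong) (use u(2) in \<open>eventually_elim, simp\<close>)
  qed
qed

section \<open>Flags with prescribed weights\<close>

lemma finite_enumeration:
  fixes A :: "real set"
  assumes "finite A"
  shows "\<exists>\<alpha>. strict_mono_on {1..card A} \<alpha> \<and> \<alpha> ` {1..card A} = A"
  using assms
proof (induction A rule: finite_linorder_max_induct)
  case empty
  show ?case by (simp add: strict_mono_on_def)
next
  case (insert b A)
  then obtain \<alpha> where \<alpha>: "strict_mono_on {1..card A} \<alpha>" "\<alpha> ` {1..card A} = A" by auto
  have "b \<notin> A" using insert.hyps(2) by auto
  then have c: "card (insert b A) = Suc (card A)" using insert.hyps(1) by simp
  have less: "\<alpha> k < b" if "k \<in> {1..card A}" for k using that \<alpha>(2) insert.hyps(2) by auto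
  define \<alpha>' where "\<alpha>' = \<alpha>(Suc (card A) := b)"
  have "strict_mono_on {1..Suc (card A)} \<alpha>'"
  proof (rule strict_mono_onI)
    fix k l assume kl: "k \<in> {1..Suc (card A)}" "l \<in> {1..Suc (card A)}" "k < l"
    show "\<alpha>' k < \<alpha>' l"
      using strict_mono_onD[OF \<alpha>(1), of k l] less[of k] kl by (auto simp: \<alpha>'_def)
  qed
  moreover have "\<alpha>' ` {1..Suc (card A)} = insert b A"
  proof -
    have "{1..Suc (card A)} = insert (Suc (card A)) {1..card A}" by auto
    then have "\<alpha>' ` {1..Suc (card A)} = insert (\<alpha>' (Suc (card A))) (\<alpha>' ` {1..card A})"
      by (simp only: image_insert)
    also have "\<alpha>' ` {1..card A} = \<alpha> ` {1..card A}" by (rule image_cong) (auto simp: \<alpha>'_def)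
    also have "\<alpha>' (Suc (card A)) = b" by (simp add: \<alpha>'_def)
    finally show ?thesis unfolding \<alpha>(2) .
  qed
  ultimately show ?case unfolding c by (intro exI[of _ \<alpha>'] conjI)
qed

lemma weighted_flag_exists:
  fixes \<beta> :: "'n::finite \<Rightarrow> real"
  assumes \<beta>: "\<And>i. 0 \<le> \<beta> i" "\<And>i. \<beta> i < 1"
  shows "\<exists>n (V :: nat \<Rightarrow> (complex^'n) set) \<alpha>. is_weighted_flag n V \<alpha> \<and>
    (\<forall>t c. c \<in> V (weight_index n \<alpha> t) \<longleftrightarrow> (\<forall>i. \<beta> i < t \<longrightarrow> c $ i = 0))"
proof -
  define n where "n = card (range \<beta>)"
  obtain \<alpha> where \<alpha>: "strict_mono_on {1..n} \<alpha>" "\<alpha> ` {1..n} = range \<beta>"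
    using finite_enumeration[of "range \<beta>"] unfolding n_def by auto
  \<comment> \<open>Coordinates are grouped by weight, and \<open>V j\<close> keeps the groups of
    weight at least \<open>\<alpha> j\<close>. Each \<open>\<alpha> j\<close> is some
    \<open>\<beta> i\<close>, and the unit vector of this i makes the inclusion strict.\<close>
  define V :: "nat \<Rightarrow> (complex^'n) set"
    where "V = (\<lambda>j. {c. \<forall>i. (\<forall>k\<in>{j..n}. \<beta> i \<noteq> \<alpha> k) \<longrightarrow> c $ i = 0})"
  have idx: "\<exists>k\<in>{1..n}. \<beta> i = \<alpha> k" for i
  proof -
    have "\<beta> i \<in> \<alpha> ` {1..n}" unfolding \<alpha>(2) by simp
    then show ?thesis by auto
  qed
  have inj: "\<alpha> k = \<alpha> l \<longleftrightarrow> k = l" if "k \<in> {1..n}" "l \<in> {1..n}" for k l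
    by (rule inj_on_eq_iff[OF strict_mono_on_imp_inj_on[OF \<alpha>(1)] that])
  have "is_weighted_flag n V \<alpha>"
    unfolding is_weighted_flag_def
  proof (intro conjI ballI)
    have "c \<in> V 1" for c
      unfolding V_def
    proof (intro CollectI allI impI)
      fix i assume "\<forall>k\<in>{1..n}. \<beta> i \<noteq> \<alpha> k"
      then show "c $ i = 0" using idx[of i] by auto
    qed
    then show "V 1 = UNIV" by (simp add: set_eq_iff)
    show "V (Suc n) = {0}" unfolding V_def by (auto simp: vec_eq_iff)
    show "strict_mono_on {1..n} \<alpha>" by fact
    fix j assume j: "j \<in> {1..n}"
    show "vec.subspace (V j)" by (simp add: vec.subspace_def V_def)
    have "\<alpha> j \<in> range \<beta>" using \<alpha>(2) j by auto
    then obtain i where i: "\<alpha> j = \<beta> i" by auto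
    show "0 \<le> \<alpha> j" "\<alpha> j < 1" using \<beta> i by auto
    have "V (Suc j) \<subseteq> V j" by (auto simp: V_def)
    moreover have "axis i 1 \<in> V j"
      unfolding V_def
    proof (intro CollectI allI impI)
      fix i' assume "\<forall>k\<in>{j..n}. \<beta> i' \<noteq> \<alpha> k"
      moreover have "j \<in> {j..n}" using j by simp
      ultimately have "\<beta> i' \<noteq> \<alpha> j" by (rule bspec)
      then have "i' \<noteq> i" unfolding i by (rule contrapos_nn) (rule arg_cong)
      then show "axis i (1::complex) $ i' = 0" by (simp add: axis_def)
    qed
    moreover have "axis i 1 \<notin> V (Suc j)"
    proof
      have *: "\<forall>k\<in>{Suc j..n}. \<beta> i \<noteq> \<alpha> k"
      proof
        fix k assume "k \<in> {Suc j..n}"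
        then show "\<beta> i \<noteq> \<alpha> k" using inj[of j k] j unfolding i by simp
      qed
      assume "axis i 1 \<in> V (Suc j)"
      then have "axis i (1::complex) $ i = 0" using * unfolding V_def by auto
      then show False by (simp add: axis_def)
    qed
    ultimately show "V (Suc j) \<subset> V j" by auto
  qed
  moreover have "c \<in> V (weight_index n \<alpha> t) \<longleftrightarrow> (\<forall>i. \<beta> i < t \<longrightarrow> c $ i = 0)" for t c
  proof -
    define w where "w = weight_index n \<alpha> t"
    have "(\<forall>k\<in>{w..n}. \<beta> i \<noteq> \<alpha> k) \<longleftrightarrow> \<beta> i < t" for i
    proof -
      obtain k where k: "k \<in> {1..n}" "\<beta> i = \<alpha> k" using idx[of i] by auto
      have "w \<in> {1..Suc n}" unfolding w_def by (rule weight_index_range)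
      then have "(\<forall>l\<in>{w..n}. \<beta> i \<noteq> \<alpha> l) \<longleftrightarrow> k < w"
        unfolding k(2) using inj[OF k(1)] k(1) by (auto simp: not_le)
      then show ?thesis unfolding w_def weight_index_less[OF \<alpha>(1) k(1)] k(2) .
    qed
    then show ?thesis unfolding w_def[symmetric] V_def by simp
  qed
  ultimately show ?thesis by (intro exI[of _ n] exI[of _ V] exI[of _ \<alpha>]) simp
qed

text \<open>Explicit form of the flag for line bundles, where the weight sum has to be computed from
  it.\<close>

lemma weighted_flag_rank_one:
  fixes c :: "complex^1"
  assumes "0 \<le> \<gamma>" "\<gamma> < 1"
  defines "V \<equiv> \<lambda>j::nat. if j = 1 then UNIV else {0 :: complex^1}"
  shows "is_weighted_flag 1 V (\<lambda>_. \<gamma>)"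
    "c \<in> V (weight_index 1 (\<lambda>_. \<gamma>) t) \<longleftrightarrow> (\<forall>i. \<gamma> < t \<longrightarrow> c $ i = 0)"
proof -
  have "axis 1 1 \<noteq> (0 :: complex^1)" by (simp add: vec_eq_iff axis_def)
  then have ne: "{0 :: complex^1} \<subset> UNIV" by auto
  show "is_weighted_flag 1 V (\<lambda>_. \<gamma>)"
    unfolding is_weighted_flag_def V_def using assms ne by (auto simp: strict_mono_on_def)
  have "strict_mono_on {1..1} (\<lambda>_::nat. \<gamma>)" by (auto simp: strict_mono_on_def)
  from weight_index_less[OF this, of 1 t]
  have "1 < weight_index 1 (\<lambda>_. \<gamma>) t \<longleftrightarrow> \<gamma> < t" by simp
  moreover have "weight_index 1 (\<lambda>_. \<gamma>) t \<in> {1..Suc 1}" by (rule weight_index_range)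
  ultimately have "V (weight_index 1 (\<lambda>_. \<gamma>) t) = (if \<gamma> < t then {0} else UNIV)"
    by (auto simp: V_def)
  then show "c \<in> V (weight_index 1 (\<lambda>_. \<gamma>) t) \<longleftrightarrow> (\<forall>i. \<gamma> < t \<longrightarrow> c $ i = 0)"
    by (auto simp: vec_eq_iff)
qed

section \<open>Pullback of bundles\<close>

lemma frames_pullback:
  "frames (parabolic_pullback Y X f E) = {(f -` U, \<tau> \<circ> f) | U \<tau>. (U, \<tau>) \<in> frames E}"
  by (simp add: parabolic_pullback_def)

lemma frames_pullbackE:
  assumes "(W, \<sigma>) \<in> frames (parabolic_pullback Y X f E)"
  obtains U \<tau> where "(U, \<tau>) \<in> frames E" "W = f -` U" "\<sigma> = (\<lambda>p. \<tau> (f p))"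
  using assms unfolding frames_pullback by (auto simp: o_def)

context nonconstant_map
begin

definition pullback_generators ::
    "('a, 'n::finite) parabolic_data \<Rightarrow> 'b \<Rightarrow> real \<Rightarrow> ('b \<Rightarrow> complex^'n) set" where
  "pullback_generators E y s = {\<lambda>p. (coord_at Y y p powi k) *s u (f p) | k u.
     \<exists>t. u \<in> stalk E (f y) t \<and> real_of_int (m y) * t + real_of_int k \<ge> s}"

lemma stalk_pullback:
  "stalk (parabolic_pullback Y X f E) y s = germ_span Y y (pullback_generators E y s)"
  by (simp add: parabolic_pullback_def pullback_generators_def)

lemma pullback_generatorsI:
  assumes "u \<in> stalk E (f y) t" "real_of_int (m y) * t + real_of_int k \<ge> s"
  shows "(\<lambda>p. (coord_at Y y p powi k) *s u (f p)) \<in> pullback_generators E y s"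
  unfolding pullback_generators_def
  by (rule CollectI, rule exI[of _ k], rule exI[of _ u]) (use assms in auto)

lemma pullback_generatorsE:
  assumes "w \<in> pullback_generators E y s"
  obtains k u t where "w = (\<lambda>p. (coord_at Y y p powi k) *s u (f p))" "u \<in> stalk E (f y) t"
    "real_of_int (m y) * t + real_of_int k \<ge> s"
  using assms unfolding pullback_generators_def by auto

lemma hol_matrix_at_f:
  assumes "hol_matrix_at X (f y) A"
  shows "hol_matrix_at Y y (\<lambda>p. A (f p))"
  using assms unfolding hol_matrix_at_def by (intro allI hol_at_f) simp

lemma hol_matrix_f:
  assumes W: "open W" and A: "hol_matrix X W A"
  shows "hol_matrix Y (f -` W) (\<lambda>p. A (f p))"
  unfolding hol_matrix_iff[OF Y holomorphic_mapD(3)[OF f W]]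
proof
  fix y assume "y \<in> f -` W"
  then have "hol_matrix_at X (f y) A" using A unfolding hol_matrix_iff[OF X W] by simp
  then show "hol_matrix_at Y y (\<lambda>p. A (f p))" by (rule hol_matrix_at_f)
qed

lemma holomorphic_bundle_off_pullback:
  assumes E: "holomorphic_bundle_off X D E"
  shows "holomorphic_bundle_off Y (f -` D) (parabolic_pullback Y X f E)"
  unfolding holomorphic_bundle_off_def
proof (intro conjI ballI)
  fix W\<sigma> assume "W\<sigma> \<in> frames (parabolic_pullback Y X f E)"
  moreover obtain W \<sigma> where W\<sigma>: "W\<sigma> = (W, \<sigma>)" by (cases W\<sigma>)
  ultimately obtain U \<tau> where U: "(U, \<tau>) \<in> frames E" "W = f -` U" "\<sigma> = (\<lambda>p. \<tau> (f p))"
    by (auto elim: frames_pullbackE)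
  have oU: "open U" by (rule holomorphic_bundle_offD(1)[OF E U(1)])
  show "case W\<sigma> of (U, \<tau>) \<Rightarrow> open U \<and> (\<forall>p\<in>U. invertible (\<tau> p))"
    using holomorphic_mapD(3)[OF f oU] holomorphic_bundle_offD(2)[OF E U(1)] by (simp add: U W\<sigma>)
  show "case W\<sigma> of (U, \<tau>) \<Rightarrow> \<forall>(W, \<sigma>)\<in>frames (parabolic_pullback Y X f E).
      hol_matrix Y (U \<inter> W) (\<lambda>p. matrix_inv (\<sigma> p) ** \<tau> p)"
    unfolding W\<sigma> prod.case
  proof
    fix W\<sigma>' assume "W\<sigma>' \<in> frames (parabolic_pullback Y X f E)"
    moreover obtain W' \<sigma>' where W\<sigma>': "W\<sigma>' = (W', \<sigma>')" by (cases W\<sigma>')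
    ultimately obtain U' \<tau>' where U': "(U', \<tau>') \<in> frames E" "W' = f -` U'" "\<sigma>' = (\<lambda>p. \<tau>' (f p))"
      by (auto elim: frames_pullbackE)
    have oU': "open U'" by (rule holomorphic_bundle_offD(1)[OF E U'(1)])
    have "hol_matrix Y (f -` (U \<inter> U')) (\<lambda>p. matrix_inv (\<tau>' (f p)) ** \<tau> (f p))"
      by (rule hol_matrix_f[OF open_Int[OF oU oU'] holomorphic_bundle_offD(4)[OF E U(1) U'(1)]])
    then show "case W\<sigma>' of (W', \<sigma>') \<Rightarrow> hol_matrix Y (W \<inter> W') (\<lambda>p. matrix_inv (\<sigma>' p) ** \<sigma> p)"
      by (simp add: U U' W\<sigma>')
  qed
next
  have "(\<Union>(U, \<tau>)\<in>frames (parabolic_pullback Y X f E). U) = f -` (\<Union>(U, \<tau>)\<in>frames E. U)"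
    unfolding frames_pullback by auto
  then show "(\<Union>(U, \<tau>)\<in>frames (parabolic_pullback Y X f E). U) = - (f -` D)"
    unfolding holomorphic_bundle_offD(3)[OF E] by auto
qed

lemma punctured_frame_pullback:
  assumes E: "holomorphic_bundle_off X D E" and \<sigma>: "punctured_frame X D E (f y) \<sigma>"
  shows "punctured_frame Y (f -` D) (parabolic_pullback Y X f E) y (\<lambda>p. \<sigma> (f p))"
proof -
  obtain U where U: "open U" "f y \<in> U" "U - {f y} \<subseteq> - D" "\<forall>p\<in>U - {f y}. invertible (\<sigma> p)"
    "\<forall>(W, \<tau>)\<in>frames E. \<forall>p\<in>W \<inter> U - {f y}. hol_matrix_at X p (\<lambda>p. matrix_inv (\<tau> p) ** \<sigma> p)"
    using punctured_frameE[OF X E \<sigma>] .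
  obtain N where N: "open N" "y \<in> N" "\<forall>p\<in>N. p \<noteq> y \<longrightarrow> f p \<noteq> f y"
    using eventually_neq[of y] unfolding eventually_at_topological by auto
  show ?thesis
  proof (rule punctured_frameI[OF Y holomorphic_bundle_off_pullback[OF E], of "N \<inter> f -` U"])
    show "open (N \<inter> f -` U)" using N(1) holomorphic_mapD(3)[OF f U(1)] by auto
    show "y \<in> N \<inter> f -` U" "N \<inter> f -` U - {y} \<subseteq> - (f -` D)" using N U(2,3) by auto
    show "invertible (\<sigma> (f p))" if "p \<in> N \<inter> f -` U - {y}" for p using that N(3) U(4) by auto
    fix W \<sigma>' p assume W: "(W, \<sigma>') \<in> frames (parabolic_pullback Y X f E)" "p \<in> W \<inter> (N \<inter> f -` U) - {y}"
    obtain U' \<tau> where U': "(U', \<tau>) \<in> frames E" "W = f -` U'" "\<sigma>' = (\<lambda>p. \<tau> (f p))"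
      using frames_pullbackE[OF W(1)] .
    have "f p \<in> U' \<inter> U - {f y}" using W(2) N(3) U'(2) by auto
    then have "hol_matrix_at X (f p) (\<lambda>p. matrix_inv (\<tau> p) ** \<sigma> p)" using bspec[OF U(5) U'(1)] by simp
    then show "hol_matrix_at Y p (\<lambda>p. matrix_inv (\<sigma>' p) ** \<sigma> (f p))"
      unfolding U'(3) by (rule hol_matrix_at_f)
  qed
qed

text \<open>Multiplicities are positive, and the right-hand side is an integer. This inequality
  compares exponents both for the weights of the pullback and, with \<open>\<beta> = 0\<close>, for
  the pairing with the dual.\<close>

lemma weighted_ceiling: "\<lceil>s - real_of_int (m y) * \<beta>\<rceil> \<le> k + m y * \<lceil>t - \<beta>\<rceil>"
  if "real_of_int (m y) * t + real_of_int k \<ge> s" for s t \<beta> :: real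
proof -
  have "real_of_int (m y) * (t - \<beta>) \<le> real_of_int (m y) * real_of_int \<lceil>t - \<beta>\<rceil>"
    using multiplicity_pos[of y] by (intro mult_left_mono) auto
  then have "s - real_of_int (m y) * \<beta> \<le> real_of_int (k + m y * \<lceil>t - \<beta>\<rceil>)"
    using that by (simp add: algebra_simps)
  then show ?thesis by (simp only: ceiling_le_iff)
qed

text \<open>From left to right, coordinates of generators are estimated by the inclusion in
  \<open>adapted_frame\<close>. From right to left, v is expanded in the pulled back columns, each
  of which is a generator by its own weight.\<close>

lemma stalk_pullback_weighted:
  fixes E :: "('a, 'n::finite) parabolic_data"
  assumes \<sigma>: "adapted_frame X D E (f y) \<sigma> \<beta>"
  shows "stalk (parabolic_pullback Y X f E) y s =
    weighted_germs Y y (\<lambda>p. \<sigma> (f p)) (\<lambda>i. real_of_int (m y) * \<beta> i) s"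
proof (intro equalityI subsetI)
  have cols: "(\<lambda>p. column i (\<sigma> p)) \<in> stalk E (f y) (\<beta> i)" for i
    using \<sigma> unfolding adapted_frame_def by simp
  have sub: "(\<lambda>p. (matrix_inv (\<sigma> p) *v u p) $ i) \<in> zpow_module X (f y) \<lceil>t - \<beta> i\<rceil>"
    if "u \<in> stalk E (f y) t" for u t i
    using \<sigma> that unfolding adapted_frame_def weighted_germs_def by auto
  {
    fix v assume "v \<in> stalk (parabolic_pullback Y X f E) y s"
    note v = this[unfolded stalk_pullback]
    show "v \<in> weighted_germs Y y (\<lambda>p. \<sigma> (f p)) (\<lambda>i. real_of_int (m y) * \<beta> i) s"
      unfolding weighted_germs_def
    proof (intro CollectI allI germ_span_coordinate[OF Y v])
      fix i w
      assume "w \<in> pullback_generators E y s"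
      then obtain k u t where w: "w = (\<lambda>p. (coord_at Y y p powi k) *s u (f p))"
        and u: "u \<in> stalk E (f y) t" and t: "real_of_int (m y) * t + real_of_int k \<ge> s" by (rule pullback_generatorsE)
      have "(\<lambda>p. coord_at Y y p powi k * (matrix_inv (\<sigma> (f p)) *v u (f p)) $ i)
          \<in> zpow_module Y y (k + m y * \<lceil>t - \<beta> i\<rceil>)"
        by (rule zpow_module_mult[OF Y coord_powi_in_zpow_module[OF Y] zpow_module_f[OF sub[OF u]]])
      from zpow_module_mono[OF Y this weighted_ceiling[OF t]]
      show "(\<lambda>p. (matrix_inv (\<sigma> (f p)) *v w p) $ i)
          \<in> zpow_module Y y \<lceil>s - real_of_int (m y) * \<beta> i\<rceil>"
        by (simp add: w vec.scale)
    qed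
  }
  {
    fix v assume v: "v \<in> weighted_germs Y y (\<lambda>p. \<sigma> (f p)) (\<lambda>i. real_of_int (m y) * \<beta> i) s"
    \<comment> \<open>The least power of the coordinate that lifts the i-th pulled back column, of
      weight \<open>m y * \<beta> i\<close>, to level s.\<close>
    define \<kappa> where "\<kappa> = (\<lambda>i. \<lceil>s - real_of_int (m y) * \<beta> i\<rceil>)"
    have "\<forall>i. \<exists>h. hol_at Y y h \<and>
        (\<forall>\<^sub>F p in at y. (matrix_inv (\<sigma> (f p)) *v v p) $ i = coord_at Y y p powi \<kappa> i * h p)"
      using v unfolding weighted_germs_def zpow_module_def \<kappa>_def by simp
    then obtain h where h: "\<forall>i. hol_at Y y (h i) \<and>
        (\<forall>\<^sub>F p in at y. (matrix_inv (\<sigma> (f p)) *v v p) $ i = coord_at Y y p powi \<kappa> i * h i p)"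
      unfolding choice_iff by (rule exE)
    have "\<forall>\<^sub>F p in at y. \<forall>i. (matrix_inv (\<sigma> (f p)) *v v p) $ i = coord_at Y y p powi \<kappa> i * h i p"
      by (rule eventually_all_finite) (use h in simp)
    moreover have "\<forall>\<^sub>F p in at y. invertible (\<sigma> (f p))"
      using \<sigma> eventually_at_f[OF punctured_frame_invertible] unfolding adapted_frame_def by blast
    ultimately have ev: "\<forall>\<^sub>F p in at y.
        (\<Sum>i\<in>UNIV. h i p *s (coord_at Y y p powi \<kappa> i *s column i (\<sigma> (f p)))) = v p"
    proof eventually_elim
      case (elim p)
      have "v p = \<sigma> (f p) *v (matrix_inv (\<sigma> (f p)) *v v p)"
        using matrix_inv_vector(1)[OF elim(2)] by simp
      also have "\<dots> = (\<Sum>i\<in>UNIV. (matrix_inv (\<sigma> (f p)) *v v p) $ i *s column i (\<sigma> (f p)))"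
        by (rule matrix_vector_columns)
      also have "\<dots> = (\<Sum>i\<in>UNIV. h i p *s (coord_at Y y p powi \<kappa> i *s column i (\<sigma> (f p))))"
        unfolding elim(1)[rule_format] by (simp add: mult.commute)
      finally show ?case ..
    qed
    have "(\<lambda>p. \<Sum>i\<in>UNIV. h i p *s (coord_at Y y p powi \<kappa> i *s column i (\<sigma> (f p))))
        \<in> stalk (parabolic_pullback Y X f E) y s"
      unfolding stalk_pullback
    proof (rule germ_span_sum, rule germ_span_scale[OF Y germ_span_base[OF Y]])
      fix i :: 'n
      show "hol_at Y y (h i)" using h by simp
      have "real_of_int (m y) * \<beta> i + real_of_int (\<kappa> i) \<ge> s" unfolding \<kappa>_def by linarith
      then show "(\<lambda>p. coord_at Y y p powi \<kappa> i *s column i (\<sigma> (f p))) \<in>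
          pullback_generators E y s"
        using cols[of i]
        by (rule pullback_generatorsI[rotated])
    qed
    then show "v \<in> stalk (parabolic_pullback Y X f E) y s"
      unfolding stalk_pullback by (rule germ_span_cong[OF _ ev])
  }
qed

definition normalized_frame ::
    "('a \<Rightarrow> complex^'n^'n) \<Rightarrow> ('n::finite \<Rightarrow> real) \<Rightarrow> 'b \<Rightarrow> 'b \<Rightarrow> complex^'n^'n" where
  "normalized_frame \<sigma> \<beta> y p =
     \<sigma> (f p) ** diag_matrix (\<lambda>i. coord_at Y y p powi - \<lfloor>real_of_int (m y) * \<beta> i\<rfloor>)"

lemma normalized_frame:
  fixes E :: "('a, 'n::finite) parabolic_data"
  assumes E: "holomorphic_bundle_off X D E" and \<sigma>: "adapted_frame X D E (f y) \<sigma> \<beta>"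
  shows "punctured_frame Y (f -` D) (parabolic_pullback Y X f E) y (normalized_frame \<sigma> \<beta> y)"
    "stalk (parabolic_pullback Y X f E) y s =
       weighted_germs Y y (normalized_frame \<sigma> \<beta> y) (\<lambda>i. frac (real_of_int (m y) * \<beta> i)) s"
proof -
  have pf: "punctured_frame X D E (f y) \<sigma>" using \<sigma> unfolding adapted_frame_def by simp
  note ch = chart_at_mem[OF Y, of y]
  show "punctured_frame Y (f -` D) (parabolic_pullback Y X f E) y (normalized_frame \<sigma> \<beta> y)"
    unfolding normalized_frame_def[abs_def]
  proof (rule punctured_frame_mult[OF Y holomorphic_bundle_off_pullback[OF E]
        punctured_frame_pullback[OF E pf] riemann_surfaceD(1)[OF Y ch(1)] ch(2)])
    fix p assume p: "p \<in> fst (chart_at Y y) - {y}"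
    then have nz: "coord_at Y y p \<noteq> 0" using coord_at_nonzero[OF Y] by auto
    then show "invertible (diag_matrix (\<lambda>i. coord_at Y y p powi - \<lfloor>real_of_int (m y) * \<beta> i\<rfloor>))"
      by (intro diag_matrix_inverse) simp
    show "hol_matrix_at Y p (\<lambda>p. diag_matrix (\<lambda>i. coord_at Y y p powi - \<lfloor>real_of_int (m y) * \<beta> i\<rfloor>))"
      by (intro hol_matrix_at_diag Y hol_at_powi hol_at_coord_at) (use p nz in auto)
  qed
  define b where "b = (\<lambda>i. real_of_int (m y) * \<beta> i)"
  have nf: "normalized_frame \<sigma> \<beta> y p =
      \<sigma> (f p) ** diag_matrix (\<lambda>i. coord_at Y y p powi - \<lfloor>b i\<rfloor>)" for p
    by (simp add: normalized_frame_def b_def)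
  \<comment> \<open>Twisting a frame vector by one power of the coordinate twists the corresponding
    component by the inverse power.\<close>
  have inv: "\<forall>\<^sub>F p in at y. \<forall>i. coord_at Y y p powi \<lfloor>b i\<rfloor> * (matrix_inv (\<sigma> (f p)) *v v p) $ i =
      (matrix_inv (normalized_frame \<sigma> \<beta> y p) *v v p) $ i" for v
    using eventually_at_f[OF punctured_frame_invertible[OF pf]] eventually_coord_at_nonzero[OF Y, of y]
  proof eventually_elim
    case (elim p)
    have c: "coord_at Y y p powi - \<lfloor>b i\<rfloor> \<noteq> 0" for i using elim(2) by simp
    have "matrix_inv (normalized_frame \<sigma> \<beta> y p) =
        diag_matrix (\<lambda>i. inverse (coord_at Y y p powi - \<lfloor>b i\<rfloor>)) ** matrix_inv (\<sigma> (f p))"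
      unfolding nf
      by (simp add: matrix_inv_prod[OF elim(1) diag_matrix_inverse(1)[OF c]] diag_matrix_inverse(2)[OF c])
    then show ?case
      by (simp add: matrix_vector_mul_assoc[symmetric] diag_matrix_vector power_int_minus)
  qed
  \<comment> \<open>The integer part removed from the weight cancels the power gained by the
    component.\<close>
  have "\<lceil>s - frac (b i)\<rceil> - \<lfloor>b i\<rfloor> = \<lceil>s - b i\<rceil>" for i
  proof -
    have "s - frac (b i) = (s - b i) + of_int \<lfloor>b i\<rfloor>" by (simp add: frac_def)
    then show ?thesis by (simp only: ceiling_add_of_int)
  qed
  then have iff: "(\<lambda>p. coord_at Y y p powi \<lfloor>b i\<rfloor> * g p) \<in> zpow_module Y y \<lceil>s - frac (b i)\<rceil> \<longleftrightarrow>
      g \<in> zpow_module Y y \<lceil>s - b i\<rceil>" for g i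
    unfolding zpow_module_mult_coord[OF Y] by simp
  have "(\<lambda>p. (matrix_inv (normalized_frame \<sigma> \<beta> y p) *v v p) $ i) \<in> zpow_module Y y \<lceil>s - frac (b i)\<rceil> \<longleftrightarrow>
      (\<lambda>p. (matrix_inv (\<sigma> (f p)) *v v p) $ i) \<in> zpow_module Y y \<lceil>s - b i\<rceil>" for v i
  proof -
    have 1: "\<forall>\<^sub>F p in at y. coord_at Y y p powi \<lfloor>b i\<rfloor> * (matrix_inv (\<sigma> (f p)) *v v p) $ i =
      (matrix_inv (normalized_frame \<sigma> \<beta> y p) *v v p) $ i"
      using inv[of v] by eventually_elim simp
    have 2: "\<forall>\<^sub>F p in at y. (matrix_inv (normalized_frame \<sigma> \<beta> y p) *v v p) $ i =
      coord_at Y y p powi \<lfloor>b i\<rfloor> * (matrix_inv (\<sigma> (f p)) *v v p) $ i"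
      using 1 by eventually_elim simp
    show ?thesis
      unfolding iff[symmetric] using zpow_module_cong[OF _ 1] zpow_module_cong[OF _ 2] by (rule iffI[rotated])
  qed
  then show "stalk (parabolic_pullback Y X f E) y s =
       weighted_germs Y y (normalized_frame \<sigma> \<beta> y) (\<lambda>i. frac (real_of_int (m y) * \<beta> i)) s"
    unfolding stalk_pullback_weighted[OF \<sigma>] weighted_germs_def b_def by simp
qed

lemma parabolic_bundle_pullback:
  fixes E :: "('a, 'n::finite) parabolic_data"
  assumes E: "parabolic_bundle X D E"
  shows "parabolic_bundle Y (f -` D) (parabolic_pullback Y X f E)"
  unfolding parabolic_bundle_def
proof (intro conjI ballI)
  have off: "holomorphic_bundle_off X D E" using E unfolding parabolic_bundle_def by simp
  then show "holomorphic_bundle_off Y (f -` D) (parabolic_pullback Y X f E)"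
    by (rule holomorphic_bundle_off_pullback)
  fix y assume "y \<in> f -` D"
  then obtain \<sigma> \<beta> where \<sigma>: "adapted_frame X D E (f y) \<sigma> \<beta>"
    using adapted_frame_exists[OF X E, of "f y"] by auto
  define \<gamma> where "\<gamma> = (\<lambda>i. frac (real_of_int (m y) * \<beta> i))"
  have \<gamma>: "0 \<le> \<gamma> i" "\<gamma> i < 1" for i by (simp_all add: \<gamma>_def frac_lt_1)
  obtain n \<alpha> and V :: "nat \<Rightarrow> (complex^'n) set" where V: "is_weighted_flag n V \<alpha>"
    "\<forall>t c. c \<in> V (weight_index n \<alpha> t) \<longleftrightarrow> (\<forall>i. \<gamma> i < t \<longrightarrow> c $ i = 0)"
    using weighted_flag_exists[of \<gamma>, OF \<gamma>] by (elim exE conjE)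
  have "parabolic_presentation Y (f -` D) (parabolic_pullback Y X f E) y (normalized_frame \<sigma> \<beta> y) n V \<alpha>"
    by (rule weighted_germs_presentation[OF Y normalized_frame[OF off \<sigma>] _ _ V(1)])
      (use \<gamma> V(2) in \<open>auto simp: \<gamma>_def\<close>)
  then show "\<exists>\<tau> n V \<alpha>. parabolic_presentation Y (f -` D) (parabolic_pullback Y X f E) y \<tau> n V \<alpha>"
    by (intro exI)
qed

end

section \<open>Pullback of homomorphisms, tensor products and duals\<close>

lemma tensor_vec_linear:
  "tensor_vec (u + u') v = tensor_vec u v + tensor_vec u' v"
  "tensor_vec u (v + v') = tensor_vec u v + tensor_vec u v'"
  "tensor_vec (c *s u) v = c *s tensor_vec u v"
  "tensor_vec u (c *s v) = c *s tensor_vec u v"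
  by (simp_all add: tensor_vec_def vec_eq_iff algebra_simps)

lemma germ_span_tensor:
  assumes X: "riemann_surface X" and u: "u \<in> germ_span X x S" and v: "v \<in> germ_span X x T"
    and W: "\<And>u v. u \<in> S \<Longrightarrow> v \<in> T \<Longrightarrow> (\<lambda>p. tensor_vec (u p) (v p)) \<in> germ_span X x W"
  shows "(\<lambda>p. tensor_vec (u p) (v p)) \<in> germ_span X x W"
proof (rule germ_span_linear[OF X u, where L = "\<lambda>p u. tensor_vec u (v p)"])
  fix u assume "u \<in> S"
  show "(\<lambda>p. tensor_vec (u p) (v p)) \<in> germ_span X x W"
    by (rule germ_span_linear[OF X v, where L = "\<lambda>p v. tensor_vec (u p) v"])
      (use W[OF \<open>u \<in> S\<close>] in \<open>simp_all add: tensor_vec_linear\<close>)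
qed (simp_all add: tensor_vec_linear)

lemma germ_span_subset:
  assumes X: "riemann_surface X" and S: "\<And>u. u \<in> S \<Longrightarrow> u \<in> germ_span X x T"
  shows "germ_span X x S \<subseteq> germ_span X x T"
proof
  fix v assume "v \<in> germ_span X x S"
  then show "v \<in> germ_span X x T"
    by (rule germ_span_linear[OF X, where L = "\<lambda>p u. u"]) (use S in simp_all)
qed

definition tensor_generators ::
    "('a, 'n::finite) parabolic_data \<Rightarrow> ('a, 'm::finite) parabolic_data \<Rightarrow> 'a \<Rightarrow> real
       \<Rightarrow> ('a \<Rightarrow> complex^('n \<times> 'm)) set" where
  "tensor_generators E F x t =
     {\<lambda>p. tensor_vec (u p) (v p) | u v. \<exists>a b. a + b = t \<and> u \<in> stalk E x a \<and> v \<in> stalk F x b}"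

lemma stalk_tensor: "stalk (parabolic_tensor X E F) x t = germ_span X x (tensor_generators E F x t)"
  by (simp add: parabolic_tensor_def tensor_generators_def)

lemma stalk_dual:
  "stalk (parabolic_dual X E) x t = {\<xi>. \<forall>a. \<forall>s\<in>stalk E x a.
     (\<lambda>p. \<Sum>i\<in>UNIV. \<xi> p $ i * s p $ i) \<in> zpow_module X x \<lceil>a + t\<rceil>}"
  by (simp add: parabolic_dual_def)

lemma stalk_tensorI:
  assumes "riemann_surface X" "u \<in> stalk E x a" "v \<in> stalk F x b"
  shows "(\<lambda>p. tensor_vec (u p) (v p)) \<in> stalk (parabolic_tensor X E F) x (a + b)"
  unfolding stalk_tensor tensor_generators_def
  by (rule germ_span_base[OF assms(1)], rule CollectI, rule exI[of _ u], rule exI[of _ v])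
    (use assms in auto)

text \<open>Modules are compared over the divisor only: there adapted frames are available, and
  pullback and dual are known to commute.\<close>

lemma parabolic_hom_cong:
  assumes "frames E = frames E'" "frames F = frames F'"
    and "\<And>x t. x \<in> D \<Longrightarrow> stalk E x t = stalk E' x t" "\<And>x t. x \<in> D \<Longrightarrow> stalk F x t = stalk F' x t"
  shows "parabolic_hom X D E F \<phi> \<longleftrightarrow> parabolic_hom X D E' F' \<phi>"
  unfolding parabolic_hom_def assms(1,2) using assms(3,4) by simp

context nonconstant_map
begin

lemma stalk_pullbackI:
  assumes "u \<in> stalk E (f y) t" "real_of_int (m y) * t + real_of_int k \<ge> s"
  shows "(\<lambda>p. (coord_at Y y p powi k) *s u (f p)) \<in> stalk (parabolic_pullback Y X f E) y s"
  unfolding stalk_pullback by (rule germ_span_base[OF Y pullback_generatorsI[OF assms]])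

lemma stalk_pullbackI0:
  assumes "u \<in> stalk E (f y) t"
  shows "(\<lambda>p. u (f p)) \<in> stalk (parabolic_pullback Y X f E) y (real_of_int (m y) * t)"
  using stalk_pullbackI[OF assms, of _ 0] by simp

lemma parabolic_hom_pullback:
  fixes E :: "('a, 'n::finite) parabolic_data" and F :: "('a, 'm::finite) parabolic_data"
  assumes oE: "\<And>U \<tau>. (U, \<tau>) \<in> frames E \<Longrightarrow> open U" and oF: "\<And>U \<tau>. (U, \<tau>) \<in> frames F \<Longrightarrow> open U"
    and hom: "parabolic_hom X D E F \<phi>"
  shows "parabolic_hom Y (f -` D) (parabolic_pullback Y X f E) (parabolic_pullback Y X f F)
    (\<lambda>p. \<phi> (f p))"
  unfolding parabolic_hom_def
proof (intro conjI ballI allI)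
  have frames_hom: "hol_matrix X (U \<inter> W) (\<lambda>p. matrix_inv (\<sigma> p) ** \<phi> p ** \<tau> p)"
    if "(U, \<tau>) \<in> frames E" "(W, \<sigma>) \<in> frames F" for U \<tau> W \<sigma>
    using hom that unfolding parabolic_hom_def by auto
  fix U\<tau> assume U\<tau>: "U\<tau> \<in> frames (parabolic_pullback Y X f E)"
  obtain U' \<tau>' where [simp]: "U\<tau> = (U', \<tau>')" by (cases U\<tau>)
  obtain U \<tau> where U: "(U, \<tau>) \<in> frames E" "U' = f -` U" "\<tau>' = (\<lambda>p. \<tau> (f p))"
    using U\<tau> by (auto elim: frames_pullbackE)
  show "case U\<tau> of (U, \<tau>) \<Rightarrow> \<forall>(W, \<sigma>)\<in>frames (parabolic_pullback Y X f F).
      hol_matrix Y (U \<inter> W) (\<lambda>p. matrix_inv (\<sigma> p) ** \<phi> (f p) ** \<tau> p)"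
    unfolding \<open>U\<tau> = (U', \<tau>')\<close> prod.case
  proof
    fix W\<sigma> assume W\<sigma>: "W\<sigma> \<in> frames (parabolic_pullback Y X f F)"
    obtain W' \<sigma>' where [simp]: "W\<sigma> = (W', \<sigma>')" by (cases W\<sigma>)
    obtain W \<sigma> where W: "(W, \<sigma>) \<in> frames F" "W' = f -` W" "\<sigma>' = (\<lambda>p. \<sigma> (f p))"
      using W\<sigma> by (auto elim: frames_pullbackE)
    have "hol_matrix Y (f -` (U \<inter> W)) (\<lambda>p. matrix_inv (\<sigma> (f p)) ** \<phi> (f p) ** \<tau> (f p))"
      by (rule hol_matrix_f[OF open_Int[OF oE[OF U(1)] oF[OF W(1)]] frames_hom[OF U(1) W(1)]])
    then show "case W\<sigma> of (W, \<sigma>) \<Rightarrow> hol_matrix Y (U' \<inter> W) (\<lambda>p. matrix_inv (\<sigma> p) ** \<phi> (f p) ** \<tau>' p)"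
      by (simp add: U W)
  qed
next
  fix y s v assume y: "y \<in> f -` D" and v: "v \<in> stalk (parabolic_pullback Y X f E) y s"
  show "(\<lambda>p. \<phi> (f p) *v v p) \<in> stalk (parabolic_pullback Y X f F) y s"
    unfolding stalk_pullback
  proof (rule germ_span_image[OF Y v[unfolded stalk_pullback]])
    fix w
    assume "w \<in> pullback_generators E y s"
    then obtain k u t where w: "w = (\<lambda>p. (coord_at Y y p powi k) *s u (f p))"
      and u: "u \<in> stalk E (f y) t" and t: "real_of_int (m y) * t + real_of_int k \<ge> s" by (rule pullback_generatorsE)
    have "(\<lambda>p. \<phi> p *v u p) \<in> stalk F (f y) t"
      using hom y u unfolding parabolic_hom_def by auto
    from stalk_pullbackI[OF this t]
    show "(\<lambda>p. \<phi> (f p) *v w p) \<in> germ_span Y y (pullback_generators F y s)"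
      by (simp add: stalk_pullback w vec.scale)
  qed
qed

text \<open>Purely formal: weights and exponents of generators add on both sides, and both sides are
  closed under combinations with holomorphic coefficients.\<close>

lemma stalk_pullback_tensor:
  fixes E :: "('a, 'n::finite) parabolic_data" and F :: "('a, 'm::finite) parabolic_data"
  shows "stalk (parabolic_pullback Y X f (parabolic_tensor X E F)) y s =
    stalk (parabolic_tensor Y (parabolic_pullback Y X f E) (parabolic_pullback Y X f F)) y s"
    (is "?L = ?R")
proof
  show "?L \<subseteq> ?R"
    unfolding stalk_tensor[of Y] stalk_pullback[of "parabolic_tensor X E F"]
  proof (rule germ_span_subset[OF Y])
    fix w
    assume "w \<in> pullback_generators (parabolic_tensor X E F) y s"
    then obtain k u t where w: "w = (\<lambda>p. (coord_at Y y p powi k) *s u (f p))"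
      and u: "u \<in> stalk (parabolic_tensor X E F) (f y) t"
      and t: "real_of_int (m y) * t + real_of_int k \<ge> s" by (rule pullback_generatorsE)
    \<comment> \<open>A section of the tensor product on \<open>X\<close> is only eventually a
      combination of elementary tensors; its coefficients pull back along f, and the power of the
      coordinate is carried into each term.\<close>
    obtain N g h where *: "\<And>i. i < N \<Longrightarrow> hol_at X (f y) (g i)"
      "\<And>i. i < N \<Longrightarrow> h i \<in> tensor_generators E F (f y) t"
      "\<forall>\<^sub>F p in at (f y). u p = (\<Sum>i<(N::nat). g i p *s h i p)"
      using germ_spanE[OF u[unfolded stalk_tensor]] by auto
    have "(\<lambda>p. \<Sum>i<N. g i (f p) *s (coord_at Y y p powi k *s h i (f p))) \<in> ?R"
      unfolding stalk_tensor
    proof (rule germ_span_sum, rule germ_span_scale[OF Y])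
      fix i assume "i \<in> {..<N}"
      then have i: "i < N" by simp
      show "hol_at Y y (\<lambda>p. g i (f p))" by (rule hol_at_f[OF *(1)[OF i]])
      obtain u v a b where h: "h i = (\<lambda>p. tensor_vec (u p) (v p))" and ab: "a + b = t"
        and u: "u \<in> stalk E (f y) a" and v: "v \<in> stalk F (f y) b"
        using *(2)[OF i] unfolding tensor_generators_def by auto
      \<comment> \<open>The power of the coordinate goes entirely into the second factor. The first
        then has level exactly \<open>m y * a\<close>, leaving the level \<open>s - m y * a\<close>
        to be reached.\<close>
      have le: "real_of_int (m y) * b + real_of_int k \<ge> s - real_of_int (m y) * a"
        using t unfolding ab[symmetric] by (simp add: algebra_simps)
      from stalk_tensorI[OF Y stalk_pullbackI0[OF u] stalk_pullbackI[OF v le]]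
      have "(\<lambda>p. coord_at Y y p powi k *s h i (f p)) \<in> ?R"
        by (simp add: h tensor_vec_linear)
      then show "(\<lambda>p. coord_at Y y p powi k *s h i (f p)) \<in> germ_span Y y
        (tensor_generators (parabolic_pullback Y X f E) (parabolic_pullback Y X f F) y s)"
        unfolding stalk_tensor .
    qed
    then have "w \<in> ?R"
      unfolding stalk_tensor
    proof (rule germ_span_cong)
      show "\<forall>\<^sub>F p in at y. (\<Sum>i<N. g i (f p) *s (coord_at Y y p powi k *s h i (f p))) = w p"
        using eventually_at_f[OF *(3)]
        by eventually_elim (simp add: w vec.scale_sum_right mult.commute)
    qed
    then show "w \<in> germ_span Y y
        (tensor_generators (parabolic_pullback Y X f E) (parabolic_pullback Y X f F) y s)"
      unfolding stalk_tensor .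
  qed
next
  show "?R \<subseteq> ?L"
    unfolding stalk_tensor[of Y] stalk_pullback[of "parabolic_tensor X E F"]
  proof (rule germ_span_subset[OF Y])
    fix w
    assume "w \<in> tensor_generators (parabolic_pullback Y X f E) (parabolic_pullback Y X f F) y s"
    then obtain u v a b where w: "w = (\<lambda>p. tensor_vec (u p) (v p))" and ab: "a + b = s"
      and u: "u \<in> stalk (parabolic_pullback Y X f E) y a"
      and v: "v \<in> stalk (parabolic_pullback Y X f F) y b" unfolding tensor_generators_def by auto
    show "w \<in> germ_span Y y (pullback_generators (parabolic_tensor X E F) y s)"
      unfolding w
    proof (rule germ_span_tensor[OF Y u[unfolded stalk_pullback] v[unfolded stalk_pullback]])
      fix u' v'
      assume "u' \<in> pullback_generators E y a"
      then obtain k u t where u': "u' = (\<lambda>p. (coord_at Y y p powi k) *s u (f p))"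
        and u: "u \<in> stalk E (f y) t" and t: "real_of_int (m y) * t + real_of_int k \<ge> a" by (rule pullback_generatorsE)
      assume "v' \<in> pullback_generators F y b"
      then obtain l v r where v': "v' = (\<lambda>p. (coord_at Y y p powi l) *s v (f p))"
        and v: "v \<in> stalk F (f y) r" and r: "real_of_int (m y) * r + real_of_int l \<ge> b" by (rule pullback_generatorsE)
      have le: "real_of_int (m y) * (t + r) + real_of_int (k + l) \<ge> s"
        using t r ab by (simp add: algebra_simps)
      have "\<forall>\<^sub>F p in at y. (coord_at Y y p powi (k + l)) *s tensor_vec (u (f p)) (v (f p)) =
          tensor_vec (u' p) (v' p)"
        using eventually_coord_at_nonzero[OF Y, of y]
        by eventually_elim (simp add: u' v' tensor_vec_linear power_int_add)
      from germ_span_cong[OF stalk_pullbackI[OF stalk_tensorI[OF X u v] le, unfolded stalk_pullback] this]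
      show "(\<lambda>p. tensor_vec (u' p) (v' p)) \<in> germ_span Y y (pullback_generators (parabolic_tensor X E F) y s)" .
    qed
  qed
qed

text \<open>Pulled back functionals pair correctly with pulled back sections, by comparison of
  exponents on generators. Conversely, a functional is the sum of its values on the frame times the
  dual basis, so the frame is essential in this direction.\<close>

lemma stalk_pullback_dual:
  fixes E :: "('a, 'n::finite) parabolic_data"
  assumes \<sigma>: "adapted_frame X D E (f y) \<sigma> \<beta>"
  shows "stalk (parabolic_pullback Y X f (parabolic_dual X E)) y s =
    stalk (parabolic_dual Y (parabolic_pullback Y X f E)) y s"
proof (intro equalityI subsetI)
  fix \<xi> assume \<xi>: "\<xi> \<in> stalk (parabolic_pullback Y X f (parabolic_dual X E)) y s"
  show "\<xi> \<in> stalk (parabolic_dual Y (parabolic_pullback Y X f E)) y s"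
    unfolding stalk_dual
  proof (intro CollectI allI ballI)
    fix a v assume v: "v \<in> stalk (parabolic_pullback Y X f E) y a"
    show "(\<lambda>p. \<Sum>i\<in>UNIV. \<xi> p $ i * v p $ i) \<in> zpow_module Y y \<lceil>a + s\<rceil>"
    proof (rule germ_span_functional[OF Y v[unfolded stalk_pullback]])
      fix w
      assume "w \<in> pullback_generators E y a"
      then obtain k u t where w: "w = (\<lambda>p. (coord_at Y y p powi k) *s u (f p))"
        and u: "u \<in> stalk E (f y) t" and t: "real_of_int (m y) * t + real_of_int k \<ge> a" by (rule pullback_generatorsE)
      \<comment> \<open>The pairing is bilinear: reduction to generators is applied once more, now
        to the functional, with w held fixed.\<close>
      have "(\<lambda>p. \<Sum>i\<in>UNIV. w p $ i * \<xi> p $ i) \<in> zpow_module Y y \<lceil>a + s\<rceil>"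
      proof (rule germ_span_functional[OF Y \<xi>[unfolded stalk_pullback]])
        fix \<eta>
        assume "\<eta> \<in> pullback_generators (parabolic_dual X E) y s"
        then obtain l \<zeta> r where \<eta>: "\<eta> = (\<lambda>p. (coord_at Y y p powi l) *s \<zeta> (f p))"
          and \<zeta>: "\<zeta> \<in> stalk (parabolic_dual X E) (f y) r"
          and r: "real_of_int (m y) * r + real_of_int l \<ge> s" by (rule pullback_generatorsE)
        have "(\<lambda>p. \<Sum>i\<in>UNIV. \<zeta> p $ i * u p $ i) \<in> zpow_module X (f y) \<lceil>t + r\<rceil>"
          using \<zeta> u unfolding stalk_dual by auto
        from zpow_module_mult[OF Y coord_powi_in_zpow_module[OF Y, of y "k + l"] zpow_module_f[OF this]]
        have z: "(\<lambda>p. coord_at Y y p powi (k + l) * (\<Sum>i\<in>UNIV. \<zeta> (f p) $ i * u (f p) $ i))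
            \<in> zpow_module Y y (k + l + m y * \<lceil>t + r\<rceil>)" .
        have "real_of_int (m y) * (t + r) + real_of_int (k + l) \<ge> a + s"
          using t r by (simp add: algebra_simps)
        from weighted_ceiling[OF this, of 0]
        have "\<lceil>a + s\<rceil> \<le> k + l + m y * \<lceil>t + r\<rceil>" by simp
        from zpow_module_mono[OF Y z this]
        show "(\<lambda>p. \<Sum>i\<in>UNIV. w p $ i * \<eta> p $ i) \<in> zpow_module Y y \<lceil>a + s\<rceil>"
        proof (rule zpow_module_cong)
          show "\<forall>\<^sub>F p in at y. coord_at Y y p powi (k + l) * (\<Sum>i\<in>UNIV. \<zeta> (f p) $ i * u (f p) $ i) =
              (\<Sum>i\<in>UNIV. w p $ i * \<eta> p $ i)"
            using eventually_coord_at_nonzero[OF Y, of y]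
            by eventually_elim (simp add: w \<eta> sum_distrib_left power_int_add mult_ac)
        qed
      qed
      then show "(\<lambda>p. \<Sum>i\<in>UNIV. \<xi> p $ i * w p $ i) \<in> zpow_module Y y \<lceil>a + s\<rceil>"
        by (simp add: mult.commute)
    qed
  qed
next
  fix \<xi> assume "\<xi> \<in> stalk (parabolic_dual Y (parabolic_pullback Y X f E)) y s"
  then have \<xi>: "(\<lambda>p. \<Sum>j\<in>UNIV. \<xi> p $ j * v p $ j) \<in> zpow_module Y y \<lceil>a + s\<rceil>"
    if "v \<in> stalk (parabolic_pullback Y X f E) y a" for a v
    using that unfolding stalk_dual by auto
  \<comment> \<open>The value of \<open>\<xi>\<close> on the i-th pulled back column, which has
    level \<open>m y * \<beta> i\<close>, is divisible by this power of the coordinate.\<close>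
  define \<kappa> where "\<kappa> = (\<lambda>i. \<lceil>real_of_int (m y) * \<beta> i + s\<rceil>)"
  have "\<exists>h. hol_at Y y h \<and> (\<forall>\<^sub>F p in at y.
      (\<Sum>j\<in>UNIV. \<xi> p $ j * \<sigma> (f p) $ j $ i) = coord_at Y y p powi \<kappa> i * h p)" for i
  proof -
    have "(\<lambda>p. column i (\<sigma> p)) \<in> stalk E (f y) (\<beta> i)"
      using \<sigma> unfolding adapted_frame_def by simp
    from \<xi>[OF stalk_pullbackI0[OF this]] show ?thesis
      by (simp add: zpow_module_def column_def \<kappa>_def)
  qed
  then have "\<forall>i. \<exists>h. hol_at Y y h \<and> (\<forall>\<^sub>F p in at y.
      (\<Sum>j\<in>UNIV. \<xi> p $ j * \<sigma> (f p) $ j $ i) = coord_at Y y p powi \<kappa> i * h p)" by (rule allI)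
  then obtain h where h: "\<forall>i. hol_at Y y (h i) \<and> (\<forall>\<^sub>F p in at y.
      (\<Sum>j\<in>UNIV. \<xi> p $ j * \<sigma> (f p) $ j $ i) = coord_at Y y p powi \<kappa> i * h i p)"
    unfolding choice_iff by (rule exE)
  have 1: "\<forall>\<^sub>F p in at y. \<forall>i.
      (\<Sum>j\<in>UNIV. \<xi> p $ j * \<sigma> (f p) $ j $ i) = coord_at Y y p powi \<kappa> i * h i p"
    by (rule eventually_all_finite) (use h in simp)
  have pf: "punctured_frame X D E (f y) \<sigma>" using \<sigma> unfolding adapted_frame_def by simp
  \<comment> \<open>The dual basis of the frame. Its i-th member extracts the i-th coordinate, so
    the inclusion in \<open>adapted_frame\<close> says precisely that it has weight
    \<open>- \<beta> i\<close>.\<close>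
  define \<rho> where "\<rho> = (\<lambda>i p. row i (matrix_inv (\<sigma> p)))"
  have \<rho>: "\<rho> i \<in> stalk (parabolic_dual X E) (f y) (- \<beta> i)" for i
    unfolding stalk_dual
  proof (intro CollectI allI ballI)
    fix a u assume "u \<in> stalk E (f y) a"
    then have "(\<lambda>p. (matrix_inv (\<sigma> p) *v u p) $ i) \<in> zpow_module X (f y) \<lceil>a - \<beta> i\<rceil>"
      using \<sigma> unfolding adapted_frame_def weighted_germs_def by auto
    then show "(\<lambda>p. \<Sum>j\<in>UNIV. \<rho> i p $ j * u p $ j) \<in> zpow_module X (f y) \<lceil>a + - \<beta> i\<rceil>"
      by (simp add: \<rho>_def row_def matrix_vector_mult_def)
  qed
  have "(\<lambda>p. \<Sum>i\<in>UNIV. h i p *s (coord_at Y y p powi \<kappa> i *s \<rho> i (f p)))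
      \<in> stalk (parabolic_pullback Y X f (parabolic_dual X E)) y s"
    unfolding stalk_pullback
  proof (rule germ_span_sum, rule germ_span_scale[OF Y])
    fix i :: 'n
    show "hol_at Y y (h i)" using h by simp
    have "real_of_int (m y) * (- \<beta> i) + real_of_int (\<kappa> i) \<ge> s" unfolding \<kappa>_def by (simp; linarith)
    from stalk_pullbackI[OF \<rho> this]
    show "(\<lambda>p. coord_at Y y p powi \<kappa> i *s \<rho> i (f p)) \<in> germ_span Y y (pullback_generators (parabolic_dual X E) y s)"
      unfolding stalk_pullback .
  qed
  moreover have "\<forall>\<^sub>F p in at y. (\<Sum>i\<in>UNIV. h i p *s (coord_at Y y p powi \<kappa> i *s \<rho> i (f p))) = \<xi> p"
    using 1 eventually_at_f[OF punctured_frame_invertible[OF pf]]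
  proof eventually_elim
    case (elim p)
    let ?S = "\<sigma> (f p)"
    \<comment> \<open>In matrix form: the row \<open>\<xi>\<close> equals \<open>\<xi>\<close> times
      \<open>?S\<close> times its inverse.\<close>
    have "(\<Sum>i\<in>UNIV. h i p *s (coord_at Y y p powi \<kappa> i *s \<rho> i (f p))) $ k = \<xi> p $ k" for k
    proof -
      have "(\<Sum>i\<in>UNIV. h i p *s (coord_at Y y p powi \<kappa> i *s \<rho> i (f p))) $ k =
          (\<Sum>i\<in>UNIV. (coord_at Y y p powi \<kappa> i * h i p) * matrix_inv ?S $ i $ k)"
        by (simp add: \<rho>_def row_def mult_ac)
      also have "\<dots> = (\<Sum>i\<in>UNIV. \<Sum>j\<in>UNIV. \<xi> p $ j * ?S $ j $ i * matrix_inv ?S $ i $ k)"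
        by (simp add: elim(1)[rule_format, symmetric] sum_distrib_right)
      also have "\<dots> = (\<Sum>j\<in>UNIV. \<Sum>i\<in>UNIV. \<xi> p $ j * ?S $ j $ i * matrix_inv ?S $ i $ k)"
        by (rule sum.swap)
      also have "\<dots> = (\<Sum>j\<in>UNIV. \<xi> p $ j * (?S ** matrix_inv ?S) $ j $ k)"
        by (simp add: matrix_matrix_mult_def sum_distrib_left mult.assoc)
      also have "\<dots> = (\<Sum>j\<in>UNIV. if j = k then \<xi> p $ k else 0)"
        unfolding matrix_inv_mult(1)[OF elim(2)] by (rule sum.cong) (auto simp: mat_def)
      finally show ?thesis by simp
    qed
    then show ?case by (simp add: vec_eq_iff)
  qed
  ultimately show "\<xi> \<in> stalk (parabolic_pullback Y X f (parabolic_dual X E)) y s"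
    unfolding stalk_pullback by (rule germ_span_cong)
qed

lemma frames_pullback_tensor:
  "frames (parabolic_pullback Y X f (parabolic_tensor X E F)) =
    frames (parabolic_tensor Y (parabolic_pullback Y X f E) (parabolic_pullback Y X f F))"
  (is "?L = ?R")
proof
  show "?L \<subseteq> ?R"
  proof
    fix c assume "c \<in> ?L"
    then obtain U \<tau> W \<sigma> where "(U, \<tau>) \<in> frames E" "(W, \<sigma>) \<in> frames F"
      "c = (f -` (U \<inter> W), (\<lambda>p. tensor_matrix (\<tau> p) (\<sigma> p)) \<circ> f)"
      unfolding frames_pullback parabolic_tensor_def by auto
    moreover from this have "(f -` U, \<tau> \<circ> f) \<in> frames (parabolic_pullback Y X f E)"
      "(f -` W, \<sigma> \<circ> f) \<in> frames (parabolic_pullback Y X f F)" unfolding frames_pullback by auto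
    ultimately show "c \<in> ?R"
      unfolding parabolic_tensor_def parabolic_data.simps
      by (intro CollectI exI[of _ "f -` U"] exI[of _ "\<tau> \<circ> f"] exI[of _ "f -` W"] exI[of _ "\<sigma> \<circ> f"])
        (simp add: o_def)
  qed
  show "?R \<subseteq> ?L"
  proof
    fix c assume "c \<in> ?R"
    then obtain U' \<tau>' W' \<sigma>' where "(U', \<tau>') \<in> frames (parabolic_pullback Y X f E)"
      "(W', \<sigma>') \<in> frames (parabolic_pullback Y X f F)"
      and c: "c = (U' \<inter> W', \<lambda>p. tensor_matrix (\<tau>' p) (\<sigma>' p))"
      unfolding parabolic_tensor_def by auto
    then obtain U \<tau> W \<sigma> where U: "(U, \<tau>) \<in> frames E" "U' = f -` U" "\<tau>' = (\<lambda>p. \<tau> (f p))"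
      and W: "(W, \<sigma>) \<in> frames F" "W' = f -` W" "\<sigma>' = (\<lambda>p. \<sigma> (f p))"
      by (auto elim!: frames_pullbackE)
    have "(U \<inter> W, \<lambda>p. tensor_matrix (\<tau> p) (\<sigma> p)) \<in> frames (parabolic_tensor X E F)"
      unfolding parabolic_tensor_def parabolic_data.simps
      by (rule CollectI, rule exI[of _ U], rule exI[of _ \<tau>], rule exI[of _ W], rule exI[of _ \<sigma>]) (simp add: U W)
    then show "c \<in> ?L"
      unfolding frames_pullback c
      by (intro CollectI exI[of _ "U \<inter> W"] exI[of _ "\<lambda>p. tensor_matrix (\<tau> p) (\<sigma> p)"])
        (simp add: U W o_def)
  qed
qed

lemma frames_pullback_dual:
  "frames (parabolic_pullback Y X f (parabolic_dual X E)) =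
    frames (parabolic_dual Y (parabolic_pullback Y X f E))"
  (is "?L = ?R")
proof
  show "?L \<subseteq> ?R"
  proof
    fix c assume "c \<in> ?L"
    then obtain U \<tau> where U: "(U, \<tau>) \<in> frames E"
      "c = (f -` U, (\<lambda>p. transpose (matrix_inv (\<tau> p))) \<circ> f)"
      unfolding frames_pullback parabolic_dual_def by auto
    then have "(f -` U, \<tau> \<circ> f) \<in> frames (parabolic_pullback Y X f E)"
      unfolding frames_pullback by auto
    then show "c \<in> ?R"
      unfolding parabolic_dual_def parabolic_data.simps
      by (intro CollectI exI[of _ "f -` U"] exI[of _ "\<tau> \<circ> f"]) (simp add: U o_def)
  qed
  show "?R \<subseteq> ?L"
  proof
    fix c assume "c \<in> ?R"
    then obtain U' \<tau>' where "(U', \<tau>') \<in> frames (parabolic_pullback Y X f E)"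
      and c: "c = (U', \<lambda>p. transpose (matrix_inv (\<tau>' p)))"
      unfolding parabolic_dual_def by auto
    then obtain U \<tau> where U: "(U, \<tau>) \<in> frames E" "U' = f -` U" "\<tau>' = (\<lambda>p. \<tau> (f p))"
      by (auto elim!: frames_pullbackE)
    have "(U, \<lambda>p. transpose (matrix_inv (\<tau> p))) \<in> frames (parabolic_dual X E)"
      unfolding parabolic_dual_def parabolic_data.simps
      by (rule CollectI, rule exI[of _ U], rule exI[of _ \<tau>]) (simp add: U)
    then show "c \<in> ?L"
      unfolding frames_pullback c
      by (intro CollectI exI[of _ U] exI[of _ "\<lambda>p. transpose (matrix_inv (\<tau> p))"]) (simp add: U o_def)
  qed
qed

end

section \<open>Parabolic degree of line bundles\<close>

lemma matrix_rank_one: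
  fixes A B :: "complex^1^1"
  shows "(A ** B) $ 1 $ 1 = A $ 1 $ 1 * B $ 1 $ 1" "invertible A \<longleftrightarrow> A $ 1 $ 1 \<noteq> 0"
    "invertible A \<Longrightarrow> matrix_inv A $ 1 $ 1 = inverse (A $ 1 $ 1)"
proof -
  show mult: "(A ** B) $ 1 $ 1 = A $ 1 $ 1 * B $ 1 $ 1" for A B :: "complex^1^1"
    by (simp add: matrix_matrix_mult_def)
  show "invertible A \<longleftrightarrow> A $ 1 $ 1 \<noteq> 0" by (simp add: invertible_det_nz det_1)
  assume "invertible A"
  then have "A $ 1 $ 1 * matrix_inv A $ 1 $ 1 = 1"
    using mult[of A "matrix_inv A"] by (simp add: matrix_inv_mult mat_def)
  then show "matrix_inv A $ 1 $ 1 = inverse (A $ 1 $ 1)" by (metis inverse_unique)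
qed

text \<open>Weights are nonnegative, so the index at 0 is 1 and the module at 0 carries no condition
  on the value at x.\<close>

lemma presentation_frame_at:
  assumes p: "parabolic_presentation X D E x \<tau> n V \<alpha>" and x: "x \<in> D"
  shows "frame_at X D E x \<tau>"
proof -
  have \<tau>: "punctured_frame X D E x \<tau>" and V: "V 1 = UNIV" and mono: "strict_mono_on {1..n} \<alpha>"
    and \<alpha>: "\<forall>j\<in>{1..n}. 0 \<le> \<alpha> j"
    and stalk: "stalk E x 0 = frame_germs X x \<tau> (V (weight_index n \<alpha> 0))"
    using p unfolding parabolic_presentation_def is_weighted_flag_def by auto
  have "weight_index n \<alpha> 0 = 1"
  proof (cases "n = 0")
    case True
    then show ?thesis using weight_index_range[of n \<alpha> 0] by simp
  next
    case False
    then have "1 \<in> {1..n}" by simp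
    from weight_index_less[OF mono this, of 0] bspec[OF \<alpha> this] weight_index_range[of n \<alpha> 0]
    show ?thesis by (simp add: not_less)
  qed
  then show ?thesis using \<tau> stalk V x unfolding frame_at_def by simp
qed

lemma frame_at_exists:
  assumes E: "parabolic_bundle X D E"
  shows "\<exists>\<tau>. frame_at X D E x \<tau>"
proof (cases "x \<in> D")
  case True
  then obtain \<tau> n V \<alpha> where "parabolic_presentation X D E x \<tau> n V \<alpha>"
    using E unfolding parabolic_bundle_def by auto
  from presentation_frame_at[OF this True] show ?thesis by (rule exI[of _ \<tau>])
next
  case False
  have off: "holomorphic_bundle_off X D E" using E unfolding parabolic_bundle_def by simp
  have "x \<in> (\<Union>(U, \<tau>)\<in>frames E. U)" unfolding holomorphic_bundle_offD(3)[OF off] using False by simp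
  then obtain U \<tau> where "(U, \<tau>) \<in> frames E" "x \<in> U" by auto
  then have "frame_at X D E x \<tau>" using False unfolding frame_at_def by auto
  then show ?thesis by (rule exI[of _ \<tau>])
qed

lemma frame_at_imp_punctured_frame:
  assumes X: "riemann_surface X" and E: "holomorphic_bundle_off X D E" and \<tau>: "frame_at X D E x \<tau>"
  shows "punctured_frame X D E x \<tau>"
proof (cases "x \<in> D")
  case True
  then show ?thesis using \<tau> unfolding frame_at_def by simp
next
  case False
  then obtain U where U: "(U, \<tau>) \<in> frames E" "x \<in> U" using \<tau> unfolding frame_at_def by auto
  have oU: "open U" by (rule holomorphic_bundle_offD(1)[OF E U(1)])
  have "U \<subseteq> (\<Union>(U, \<tau>)\<in>frames E. U)" using U(1) by auto
  then have UD: "U \<subseteq> - D" unfolding holomorphic_bundle_offD(3)[OF E] .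
  show ?thesis
  proof (rule punctured_frameI[OF X E oU U(2)])
    show "U - {x} \<subseteq> - D" using UD by auto
    show "invertible (\<tau> p)" if "p \<in> U - {x}" for p
      using holomorphic_bundle_offD(2)[OF E U(1)] that by simp
    fix W \<sigma> p assume W: "(W, \<sigma>) \<in> frames E" "p \<in> W \<inter> U - {x}"
    have "open (U \<inter> W)" using oU holomorphic_bundle_offD(1)[OF E W(1)] by (rule open_Int)
    from iffD1[OF hol_matrix_iff[OF X this] holomorphic_bundle_offD(4)[OF E U(1) W(1)]]
    show "hol_matrix_at X p (\<lambda>p. matrix_inv (\<sigma> p) ** \<tau> p)" using W(2) by simp
  qed
qed

text \<open>Off the divisor this is a transition function. On the divisor the two frames generate
  the same module, so each is a holomorphic multiple of the other; the two factors are inverse near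
  x, hence also at x.\<close>

lemma frame_ratio:
  fixes L :: "('a::t2_space, 1) parabolic_data" and \<tau> \<sigma> :: "'a \<Rightarrow> complex^1^1"
  assumes X: "riemann_surface X" and L: "holomorphic_bundle_off X D L"
    and \<tau>: "frame_at X D L x \<tau>" and \<sigma>: "frame_at X D L x \<sigma>"
  shows "has_order_at X x (\<lambda>p. \<tau> p $ 1 $ 1 / \<sigma> p $ 1 $ 1) 0"
proof (cases "x \<in> D")
  case False
  obtain U where U: "(U, \<tau>) \<in> frames L" "x \<in> U" using \<tau> False unfolding frame_at_def by auto
  obtain W where W: "(W, \<sigma>) \<in> frames L" "x \<in> W" using \<sigma> False unfolding frame_at_def by auto
  have o: "open (U \<inter> W)"
    using holomorphic_bundle_offD(1)[OF L U(1)] holomorphic_bundle_offD(1)[OF L W(1)] by (rule open_Int)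
  from iffD1[OF hol_matrix_iff[OF X this] holomorphic_bundle_offD(4)[OF L U(1) W(1)]]
  have "hol_matrix_at X x (\<lambda>p. matrix_inv (\<sigma> p) ** \<tau> p)" using U(2) W(2) by simp
  then have h: "hol_at X x (\<lambda>p. (matrix_inv (\<sigma> p) ** \<tau> p) $ 1 $ 1)" unfolding hol_matrix_at_def by simp
  have eq: "(matrix_inv (\<sigma> p) ** \<tau> p) $ 1 $ 1 = \<tau> p $ 1 $ 1 / \<sigma> p $ 1 $ 1" if "p \<in> U \<inter> W" for p
    using holomorphic_bundle_offD(2)[OF L W(1), of p] that
    by (simp add: matrix_rank_one(1,3) divide_inverse mult.commute)
  have "(matrix_inv (\<sigma> x) ** \<tau> x) $ 1 $ 1 \<noteq> 0"
    using holomorphic_bundle_offD(2)[OF L W(1,2)] holomorphic_bundle_offD(2)[OF L U(1,2)] eq[of x] U(2) W(2)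
    by (simp add: matrix_rank_one(2))
  from has_order_at_unit[OF h this] show ?thesis
  proof (rule has_order_at_cong[rotated])
    show "\<forall>\<^sub>F p in at x. (matrix_inv (\<sigma> p) ** \<tau> p) $ 1 $ 1 = \<tau> p $ 1 $ 1 / \<sigma> p $ 1 $ 1"
      unfolding eventually_at_filter
      by (rule eventually_mono[OF eventually_nhds_in_open[OF o]]) (use U(2) W(2) eq in auto)
  qed
next
  case True
  have main: "\<exists>c. hol_at X x c \<and> (\<forall>\<^sub>F p in at x. \<tau> p $ 1 $ 1 = \<sigma> p $ 1 $ 1 * c p)"
    if "frame_germs X x \<tau> UNIV = frame_germs X x \<sigma> UNIV" for \<tau> \<sigma> :: "'a \<Rightarrow> complex^1^1"
  proof -
    have "(\<lambda>p. \<tau> p *v 1) \<in> frame_germs X x \<tau> UNIV"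
      unfolding frame_germs_def by (intro CollectI exI[of _ "\<lambda>p. 1"]) (simp add: X)
    then have "(\<lambda>p. \<tau> p *v 1) \<in> frame_germs X x \<sigma> UNIV" by (simp only: that)
    then obtain c :: "'a \<Rightarrow> complex^1" where c: "\<forall>i. hol_at X x (\<lambda>p. c p $ i)"
        "\<forall>\<^sub>F p in at x. \<tau> p *v 1 = \<sigma> p *v c p"
      unfolding frame_germs_def by auto
    have "\<forall>\<^sub>F p in at x. \<tau> p $ 1 $ 1 = \<sigma> p $ 1 $ 1 * c p $ 1"
      using c(2)
    proof eventually_elim
      case (elim p)
      then have "(\<tau> p *v 1) $ 1 = (\<sigma> p *v c p) $ 1" by simp
      then show ?case by (simp add: matrix_vector_mult_def)
    qed
    then show ?thesis using c(1) by (intro exI[of _ "\<lambda>p. c p $ 1"]) simp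
  qed
  have g: "frame_germs X x \<tau> UNIV = frame_germs X x \<sigma> UNIV"
    and pf: "punctured_frame X D L x \<tau>" "punctured_frame X D L x \<sigma>"
    using \<tau> \<sigma> True unfolding frame_at_def by simp_all
  obtain c where c: "hol_at X x c" "\<forall>\<^sub>F p in at x. \<tau> p $ 1 $ 1 = \<sigma> p $ 1 $ 1 * c p"
    using main[OF g] by auto
  obtain d where d: "hol_at X x d" "\<forall>\<^sub>F p in at x. \<sigma> p $ 1 $ 1 = \<tau> p $ 1 $ 1 * d p"
    using main[OF g[symmetric]] by auto
  have "\<forall>\<^sub>F p in at x. c p * d p = 1"
    using c(2) d(2) punctured_frame_invertible[OF pf(1)] punctured_frame_invertible[OF pf(2)]
  proof eventually_elim
    case (elim p)
    have "\<tau> p $ 1 $ 1 * (d p * c p) = \<tau> p $ 1 $ 1"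
      using elim(1,2) by (metis mult.assoc)
    then show ?case using elim(3) unfolding matrix_rank_one(2) by (simp add: mult.commute)
  qed
  \<comment> \<open>The relation \<open>c * d = 1\<close> is known only off x; continuity extends it
    to x and so excludes a zero of c there.\<close>
  moreover have "((\<lambda>p. c p * d p) \<longlongrightarrow> c x * d x) (at x)"
    using hol_at_isCont[OF X hol_at_mult[OF X c(1) d(1)]] by (simp add: isCont_def)
  ultimately have "((\<lambda>p. 1) \<longlongrightarrow> c x * d x) (at x)"
    by (rule tendsto_cong[THEN iffD1])
  then have "c x * d x = 1"
    by (rule tendsto_unique[OF at_neq_bot[OF X] _ tendsto_const])
  then have "c x \<noteq> 0" by auto
  from has_order_at_unit[OF c(1) this] show ?thesis
  proof (rule has_order_at_cong[rotated])
    show "\<forall>\<^sub>F p in at x. c p = \<tau> p $ 1 $ 1 / \<sigma> p $ 1 $ 1"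
      using c(2) punctured_frame_invertible[OF pf(2)]
      by eventually_elim (simp add: matrix_rank_one(2))
  qed
qed

lemma frame_change_order:
  fixes L :: "('a::t2_space, 1) parabolic_data"
  assumes X: "riemann_surface X" and L: "holomorphic_bundle_off X D L"
    and \<tau>: "frame_at X D L x \<tau>" and \<sigma>: "frame_at X D L x \<sigma>"
    and h: "has_order_at X x (\<lambda>p. h p / det (\<tau> p)) k"
  shows "has_order_at X x (\<lambda>p. h p / det (\<sigma> p)) k"
proof -
  have "has_order_at X x (\<lambda>p. h p / det (\<tau> p) * (\<tau> p $ 1 $ 1 / \<sigma> p $ 1 $ 1)) (k + 0)"
    by (rule has_order_at_mult[OF X h frame_ratio[OF X L \<tau> \<sigma>]])
  then have "has_order_at X x (\<lambda>p. h p / det (\<sigma> p)) (k + 0)"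
  proof (rule has_order_at_cong[rotated])
    show "\<forall>\<^sub>F p in at x. h p / det (\<tau> p) * (\<tau> p $ 1 $ 1 / \<sigma> p $ 1 $ 1) = h p / det (\<sigma> p)"
      using punctured_frame_invertible[OF frame_at_imp_punctured_frame[OF X L \<tau>]]
      by eventually_elim (simp add: matrix_rank_one(2) det_1)
  qed
  then show ?thesis by simp
qed

text \<open>Frames differ by units, so the frame selected inside \<open>det_section_ord\<close> may
  be replaced by any convenient one.\<close>

lemma det_section_ord_eq:
  fixes L :: "('a::t2_space, 1) parabolic_data"
  assumes X: "riemann_surface X" and L: "holomorphic_bundle_off X D L"
    and \<tau>: "frame_at X D L x \<tau>" and h: "has_order_at X x (\<lambda>p. h p / det (\<tau> p)) k"
  shows "det_section_ord X D L h x = k"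
proof -
  have "frame_at X D L x (SOME \<tau>. frame_at X D L x \<tau>)" by (rule someI[where P = "frame_at X D L x", OF \<tau>])
  from has_order_at_imp_ord_at[OF X frame_change_order[OF X L \<tau> this h]]
  show ?thesis by (simp add: det_section_ord_def)
qed

lemma mero_det_section_order:
  fixes L :: "('a::t2_space, 1) parabolic_data"
  assumes X: "riemann_surface X" and L: "holomorphic_bundle_off X D L"
    and h: "mero_det_section X D L h" and \<tau>: "frame_at X D L x \<tau>"
  shows "has_order_at X x (\<lambda>p. h p / det (\<tau> p)) (det_section_ord X D L h x)"
proof -
  have m: "mero_at X x (\<lambda>p. h p / det (\<tau> p))" and fr: "\<exists>\<^sub>F p in at x. h p \<noteq> 0"
    using h \<tau> unfolding mero_det_section_def by auto
  have "\<forall>\<^sub>F p in at x. det (\<tau> p) \<noteq> 0"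
    using punctured_frame_invertible[OF frame_at_imp_punctured_frame[OF X L \<tau>]]
    by eventually_elim (simp add: invertible_det_nz)
  from frequently_eventually_frequently[OF fr this]
  have "\<exists>\<^sub>F p in at x. h p / det (\<tau> p) \<noteq> 0" by (rule frequently_elim1) simp
  from has_order_at_ord_at[OF X m this]
  have o: "has_order_at X x (\<lambda>p. h p / det (\<tau> p)) (ord_at X x (\<lambda>p. h p / det (\<tau> p)))" .
  show ?thesis unfolding det_section_ord_eq[OF X L \<tau> o] by (rule o)
qed

text \<open>Near any x the section is a power of the coordinate times a unit in one frame, and this
  frame remains usable at the nearby points, which lie off the divisor. So nonzero orders cannot
  accumulate, and compactness applies.\<close>

lemma finite_divisor:
  fixes L :: "('a::t2_space, 1) parabolic_data"
  assumes X: "riemann_surface X" and com: "compact (UNIV :: 'a set)"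
    and L: "parabolic_bundle X D L" and h: "mero_det_section X D L h"
  shows "finite {x. det_section_ord X D L h x \<noteq> 0}"
proof (rule ccontr)
  assume "infinite {x. det_section_ord X D L h x \<noteq> 0}"
  then obtain x where x: "x islimpt {x. det_section_ord X D L h x \<noteq> 0}"
    using Heine_Borel_imp_Bolzano_Weierstrass[OF com, of "{x. det_section_ord X D L h x \<noteq> 0}"] by auto
  have off: "holomorphic_bundle_off X D L" using L unfolding parabolic_bundle_def by simp
  obtain \<tau> where \<tau>: "frame_at X D L x \<tau>" using frame_at_exists[OF L, of x] by auto
  obtain u where u: "hol_at X x u" "u x \<noteq> 0" "\<forall>\<^sub>F p in at x.
      h p / det (\<tau> p) = coord_at X x p powi det_section_ord X D L h x * u p"
    using mero_det_section_order[OF X off h \<tau>] by (rule has_order_atE)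
  define k where "k = det_section_ord X D L h x"
  obtain A where A: "open A" "x \<in> A" "hol_fun X A u" using u(1) unfolding hol_at_def by auto
  obtain B where B: "open B" "x \<in> B" "\<forall>p\<in>B. u p \<noteq> 0"
    using hol_at_eventually_nonzero[OF X u(1,2)] unfolding eventually_nhds by auto
  obtain C where C: "open C" "x \<in> C" "\<forall>p\<in>C. p \<noteq> x \<longrightarrow> h p / det (\<tau> p) = coord_at X x p powi k * u p"
    using u(3) unfolding eventually_at_topological k_def by auto
  obtain U where U: "open U" "x \<in> U" "U - {x} \<subseteq> - D" "\<forall>p\<in>U - {x}. invertible (\<tau> p)"
    "\<forall>(W, \<sigma>)\<in>frames L. \<forall>p\<in>W \<inter> U - {x}. hol_matrix_at X p (\<lambda>p. matrix_inv (\<sigma> p) ** \<tau> p)"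
    using punctured_frameE[OF X off frame_at_imp_punctured_frame[OF X off \<tau>]] .
  define N where "N = A \<inter> B \<inter> C \<inter> U \<inter> fst (chart_at X x)"
  have N: "open N" "x \<in> N"
    unfolding N_def using A B C U riemann_surfaceD(1)[OF X chart_at_mem(1)[OF X, of x]] chart_at_mem(2)[OF X, of x]
    by auto
  have "det_section_ord X D L h q = 0" if q: "q \<in> N" "q \<noteq> x" for q
  proof -
    have "q \<notin> D" using q U(3) unfolding N_def by auto
    obtain \<sigma> where \<sigma>: "frame_at X D L q \<sigma>" using frame_at_exists[OF L, of q] by auto
    then obtain W where W: "(W, \<sigma>) \<in> frames L" "q \<in> W" using \<open>q \<notin> D\<close> unfolding frame_at_def by auto
    have oW: "open (W \<inter> (N - {x}))" using holomorphic_bundle_offD(1)[OF off W(1)] N(1) by auto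
    have hq: "hol_at X q u" using A(1,3) q unfolding N_def hol_at_def by auto
    have ht: "hol_at X q (\<lambda>p. (matrix_inv (\<sigma> p) ** \<tau> p) $ 1 $ 1)"
      using bspec[OF U(5) W(1)] q W(2) unfolding N_def hol_matrix_at_def by auto
    have cq: "coord_at X x q \<noteq> 0" using coord_at_nonzero[OF X, of q x] q unfolding N_def by auto
    have hc: "hol_at X q (\<lambda>p. coord_at X x p powi k)"
      by (intro hol_at_powi hol_at_coord_at X cq) (use q in \<open>auto simp: N_def\<close>)
    have eq: "(matrix_inv (\<sigma> p) ** \<tau> p) $ 1 $ 1 = \<tau> p $ 1 $ 1 / \<sigma> p $ 1 $ 1" "\<tau> p $ 1 $ 1 \<noteq> 0" "\<sigma> p $ 1 $ 1 \<noteq> 0"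
      if "p \<in> W \<inter> (N - {x})" for p
      using holomorphic_bundle_offD(2)[OF off W(1), of p] U(4) that
      by (auto simp: N_def matrix_rank_one(1,3) divide_inverse mult.commute simp flip: matrix_rank_one(2))
    have qm: "q \<in> W \<inter> (N - {x})" using q W(2) by auto
    \<comment> \<open>The coefficient of the section in the frame at q is a product of three units
      at q: the power of the coordinate of x, the factor u, and the transition function between the
      frames.\<close>
    have "has_order_at X q (\<lambda>p. coord_at X x p powi k * u p * (matrix_inv (\<sigma> p) ** \<tau> p) $ 1 $ 1) 0"
    proof (rule has_order_at_unit)
      show "hol_at X q (\<lambda>p. coord_at X x p powi k * u p * (matrix_inv (\<sigma> p) ** \<tau> p) $ 1 $ 1)"
        by (intro hol_at_mult X hc hq ht)
      show "coord_at X x q powi k * u q * (matrix_inv (\<sigma> q) ** \<tau> q) $ 1 $ 1 \<noteq> 0"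
        using cq B(3) q eq[OF qm] unfolding N_def by auto
    qed
    then have "has_order_at X q (\<lambda>p. h p / det (\<sigma> p)) 0"
    proof (rule has_order_at_cong[rotated])
      show "\<forall>\<^sub>F p in at q. coord_at X x p powi k * u p * (matrix_inv (\<sigma> p) ** \<tau> p) $ 1 $ 1 = h p / det (\<sigma> p)"
        unfolding eventually_at_filter using eventually_nhds_in_open[OF oW qm]
      proof eventually_elim
        case (elim p)
        have "h p / det (\<tau> p) = coord_at X x p powi k * u p" using C(3) elim unfolding N_def by auto
        then show ?case using eq[OF elim] by (simp add: det_1 flip: \<open>h p / det (\<tau> p) = _\<close>)
      qed
    qed
    then show ?thesis by (rule det_section_ord_eq[OF X off \<sigma>])
  qed
  then show False using islimptE[OF x N(2,1)] by auto
qed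

section \<open>The single weight of a line bundle\<close>

lemma rank_one_flag:
  fixes V :: "nat \<Rightarrow> (complex^1) set"
  assumes "is_weighted_flag n V \<alpha>"
  shows "n = 1"
proof -
  have V: "V 1 = UNIV" "V (Suc n) = {0}" "\<And>j. j \<in> {1..n} \<Longrightarrow> vec.subspace (V j)"
    "\<And>j. j \<in> {1..n} \<Longrightarrow> V (Suc j) \<subset> V j"
    using assms unfolding is_weighted_flag_def by auto
  have ne: "(UNIV :: (complex^1) set) \<noteq> {0}"
  proof
    assume "(UNIV :: (complex^1) set) = {0}"
    then have "(1 :: complex^1) \<in> {0}" by (metis UNIV_I)
    then show False by simp
  qed
  have "n \<noteq> 0" using V(1,2) ne by auto
  moreover have "\<not> 2 \<le> n"
  proof
    assume n: "2 \<le> n"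
    \<comment> \<open>A second step would sit strictly between the line and zero; it contains a
      nonzero vector, which already spans the line.\<close>
    have 0: "0 \<in> V 3"
    proof (cases "n = 2")
      case True
      then have "Suc n = 3" by simp
      then show ?thesis using V(2) by simp
    next
      case False
      then have "3 \<in> {1..n}" using n by simp
      from vec.subspace_0[OF V(3)[OF this]] show ?thesis .
    qed
    have "2 \<in> {1..n}" using n by simp
    note s2 = V(3)[OF this]
    have "Suc 2 = (3::nat)" by simp
    then have "V 3 \<subset> V 2" using V(4)[OF \<open>2 \<in> {1..n}\<close>] by simp
    then obtain v where v: "v \<in> V 2" "v \<noteq> 0" using 0 by auto
    then have v1: "v $ 1 \<noteq> 0" by (simp add: vec_eq_iff)
    have "c \<in> V 2" for c
    proof -
      have "c = (c $ 1 / v $ 1) *s v" using v1 by (simp add: vec_eq_iff)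
      then show ?thesis using vec.subspace_scale[OF s2 v(1)] by metis
    qed
    moreover have "V 2 \<subset> V 1" using V(4)[of 1] n by (simp add: numeral_2_eq_2)
    ultimately show False by auto
  qed
  ultimately show ?thesis by simp
qed

text \<open>The weight sum is the only weight. The same frame is both adapted, which determines the
  modules of the pullback, and a frame of the underlying bundle, which measures orders of
  sections.\<close>

lemma rank_one_weight_sum:
  fixes L :: "('a::t2_space, 1) parabolic_data"
  assumes X: "riemann_surface X" and L: "holomorphic_bundle_off X D L" and x: "x \<in> D"
    and w: "has_weight_sum X D L x w"
  obtains \<tau> where "adapted_frame X D L x \<tau> (\<lambda>_. w)" "frame_at X D L x \<tau>"
proof -
  obtain \<tau> n V \<alpha> where p: "parabolic_presentation X D L x \<tau> n V \<alpha>"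
    and w: "w = (\<Sum>j=1..n. \<alpha> j * (real (vec.dim (V j)) - real (vec.dim (V (Suc j)))))"
    using w unfolding has_weight_sum_def by auto
  have flag: "is_weighted_flag n V \<alpha>" using p unfolding parabolic_presentation_def by simp
  have n: "n = 1" by (rule rank_one_flag[OF flag])
  have V: "V 1 = UNIV" "V (Suc 1) = {0}" using flag unfolding n is_weighted_flag_def by auto
  have "vec.dim (V (Suc 1)) = 0" using vec.dim_eq_0[of "V (Suc 1)"] V(2) by simp
  moreover have "vec.dim (V 1) = 1" unfolding V(1) vec_dim_card by simp
  ultimately have w1: "w = \<alpha> 1" unfolding w n by simp
  have "adapted_frame X D L x (\<lambda>p. \<tau> p ** mat 1) (\<lambda>i. \<alpha> 1)"
  proof (rule presentation_imp_adapted_frame[OF X L p])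
    show "invertible (mat 1 :: complex^1^1)" by (simp add: invertible_det_nz)
    show "1 \<in> {1..n}" by (simp add: n)
    fix k and c :: "complex^1" assume "k \<in> {1..Suc n}"
    then have "k = 1 \<or> k = Suc 1" by (auto simp: n)
    then show "mat 1 *v c \<in> V k \<longleftrightarrow> (\<forall>i::1. 1 < k \<longrightarrow> c $ i = 0)"
      using V by (auto simp: vec_eq_iff)
  qed
  then have "adapted_frame X D L x \<tau> (\<lambda>_. w)" by (simp add: w1)
  then show ?thesis using presentation_frame_at[OF p x] by (rule that)
qed

context nonconstant_map
begin

text \<open>The frame of the pullback is the pulled back frame times \<open>coord_at Y y\<close> to
  the power \<open>- \<lfloor>m y * w\<rfloor>\<close>; dividing by it raises the order of the
  section by this floor, while the fractional part is left as weight.\<close>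

lemma rank_one_pullback:
  fixes L :: "('a, 1) parabolic_data"
  assumes L: "parabolic_bundle X D L" and h: "mero_det_section X D L h" and y: "f y \<in> D"
    and w: "has_weight_sum X D L (f y) w"
  defines "k \<equiv> m y * det_section_ord X D L h (f y) + \<lfloor>real_of_int (m y) * w\<rfloor>"
  shows "\<exists>\<nu>. frame_at Y (f -` D) (parabolic_pullback Y X f L) y \<nu> \<and>
      has_order_at Y y (\<lambda>p. h (f p) / det (\<nu> p)) k"
    "has_weight_sum Y (f -` D) (parabolic_pullback Y X f L) y (frac (real_of_int (m y) * w))"
proof -
  have off: "holomorphic_bundle_off X D L" using L unfolding parabolic_bundle_def by simp
  obtain \<tau> where \<tau>: "adapted_frame X D L (f y) \<tau> (\<lambda>_. w)" "frame_at X D L (f y) \<tau>"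
    using rank_one_weight_sum[OF X off y w] .
  define \<gamma> where "\<gamma> = frac (real_of_int (m y) * w)"
  define \<nu> where "\<nu> = normalized_frame \<tau> (\<lambda>_. w) y"
  define V :: "nat \<Rightarrow> (complex^1) set" where "V = (\<lambda>j. if j = 1 then UNIV else {0})"
  have \<gamma>: "0 \<le> \<gamma>" "\<gamma> < 1" by (simp_all add: \<gamma>_def frac_lt_1)
  have flag: "is_weighted_flag 1 V (\<lambda>_. \<gamma>)"
    unfolding V_def by (rule weighted_flag_rank_one(1)[OF \<gamma>])
  have V: "c \<in> V (weight_index 1 (\<lambda>_. \<gamma>) t) \<longleftrightarrow> (\<forall>i::1. \<gamma> < t \<longrightarrow> c $ i = 0)" for c t
    unfolding V_def by (rule weighted_flag_rank_one(2)[OF \<gamma>])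
  have pres: "parabolic_presentation Y (f -` D) (parabolic_pullback Y X f L) y \<nu> 1 V (\<lambda>_. \<gamma>)"
    unfolding \<nu>_def
    by (rule weighted_germs_presentation[OF Y normalized_frame[OF off \<tau>(1), folded \<gamma>_def] \<gamma> flag V])
  have "vec.dim (V (Suc 1)) = 0" using vec.dim_eq_0[of "V (Suc 1)"] by (simp add: V_def)
  moreover have "vec.dim (V 1) = 1" using vec_dim_card[where 'a = complex and 'n = 1] by (simp add: V_def)
  ultimately have "\<gamma> = (\<Sum>j=1..1. \<gamma> * (real (vec.dim (V j)) - real (vec.dim (V (Suc j)))))"
    by simp
  with pres show "has_weight_sum Y (f -` D) (parabolic_pullback Y X f L) y (frac (real_of_int (m y) * w))"
    unfolding has_weight_sum_def \<gamma>_def[symmetric]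
    by (intro exI[of _ \<nu>] exI[of _ 1] exI[of _ V] exI[of _ "\<lambda>_. \<gamma>"] conjI)
  have 1: "frame_at Y (f -` D) (parabolic_pullback Y X f L) y \<nu>"
    by (rule presentation_frame_at[OF pres]) (use y in simp)
  have "has_order_at Y y (\<lambda>p. (h (f p) / det (\<tau> (f p))) *
      coord_at Y y p powi \<lfloor>real_of_int (m y) * w\<rfloor>) k"
    unfolding k_def
    by (intro has_order_at_mult Y has_order_at_coord
        has_order_at_f[of y "\<lambda>q. h q / det (\<tau> q)"] mero_det_section_order[OF X off h \<tau>(2)])
  then have "has_order_at Y y (\<lambda>p. h (f p) / det (\<nu> p)) k"
  proof (rule has_order_at_cong[rotated])
    show "\<forall>\<^sub>F p in at y. h (f p) / det (\<tau> (f p)) * coord_at Y y p powi \<lfloor>real_of_int (m y) * w\<rfloor> =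
        h (f p) / det (\<nu> p)"
      unfolding \<nu>_def normalized_frame_def
      by (simp add: det_1 matrix_rank_one(1) diag_matrix_def power_int_minus divide_simps)
  qed
  with 1 show "\<exists>\<nu>. frame_at Y (f -` D) (parabolic_pullback Y X f L) y \<nu> \<and>
      has_order_at Y y (\<lambda>p. h (f p) / det (\<nu> p)) k"
    by (intro exI[of _ \<nu>] conjI)
qed

lemma pullback_frame_order:
  fixes L :: "('a, 1) parabolic_data"
  assumes L: "parabolic_bundle X D L" and h: "mero_det_section X D L h" and y: "f y \<notin> D"
  shows "\<exists>\<nu>. frame_at Y (f -` D) (parabolic_pullback Y X f L) y \<nu> \<and>
      has_order_at Y y (\<lambda>p. h (f p) / det (\<nu> p)) (m y * det_section_ord X D L h (f y))"
proof -
  have off: "holomorphic_bundle_off X D L" using L unfolding parabolic_bundle_def by simp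
  obtain \<tau> where \<tau>: "frame_at X D L (f y) \<tau>" using frame_at_exists[OF L, of "f y"] by auto
  then obtain U where U: "(U, \<tau>) \<in> frames L" "f y \<in> U" using y unfolding frame_at_def by auto
  then have "(f -` U, \<tau> \<circ> f) \<in> frames (parabolic_pullback Y X f L)" unfolding frames_pullback by auto
  then have "frame_at Y (f -` D) (parabolic_pullback Y X f L) y (\<tau> \<circ> f)"
    using y U(2) unfolding frame_at_def by auto
  moreover have "has_order_at Y y (\<lambda>p. h (f p) / det ((\<tau> \<circ> f) p)) (m y * det_section_ord X D L h (f y))"
    using has_order_at_f[OF mero_det_section_order[OF X off h \<tau>]] by simp
  ultimately show ?thesis by (intro exI[of _ "\<tau> \<circ> f"] conjI)
qed

lemma has_parabolic_degree_zero_pullback: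
  fixes L :: "('a, 1) parabolic_data"
  assumes comX: "compact (UNIV :: 'a set)" and conX: "connected (UNIV :: 'a set)"
    and comY: "compact (UNIV :: 'b set)" and D: "finite D"
    and L: "parabolic_bundle X D L" and deg: "has_parabolic_degree X D L 0"
  shows "has_parabolic_degree Y (f -` D) (parabolic_pullback Y X f L) 0"
proof -
  let ?M = "parabolic_pullback Y X f L" and ?B = "f -` D"
  obtain d w where d: "has_degree X D L d" and w: "\<forall>x\<in>D. has_weight_sum X D L x (w x)"
    and dw: "0 = real_of_int d + (\<Sum>x\<in>D. w x)"
    using deg unfolding has_parabolic_degree_def by auto
  obtain h where h: "mero_det_section X D L h"
    and dh: "d = (\<Sum>x | det_section_ord X D L h x \<noteq> 0. det_section_ord X D L h x)"
    using d unfolding has_degree_def by auto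
  define ord where "ord = det_section_ord X D L h"
  define k where "k = (\<lambda>y. m y * ord (f y) + (if f y \<in> D then \<lfloor>real_of_int (m y) * w (f y)\<rfloor> else 0))"
  define w' where "w' = (\<lambda>y. frac (real_of_int (m y) * w (f y)))"
  have offY: "holomorphic_bundle_off Y ?B ?M"
    using parabolic_bundle_pullback[OF L] unfolding parabolic_bundle_def by simp
  have frame: "\<exists>\<nu>. frame_at Y ?B ?M y \<nu> \<and> has_order_at Y y (\<lambda>p. h (f p) / det (\<nu> p)) (k y)" for y
  proof (cases "f y \<in> D")
    case True
    then show ?thesis using rank_one_pullback(1)[OF L h True bspec[OF w True]] by (simp add: k_def ord_def)
  next
    case False
    then show ?thesis using pullback_frame_order[OF L h False] by (simp add: k_def ord_def)
  qed
  \<comment> \<open>A pulled back section has the computed order in one frame at each y, hence in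
    all frames there.\<close>
  have "mero_det_section Y ?B ?M (\<lambda>p. h (f p))"
    unfolding mero_det_section_def
  proof (intro allI impI)
    fix y \<tau> assume \<tau>: "frame_at Y ?B ?M y \<tau>"
    obtain \<nu> where \<nu>: "frame_at Y ?B ?M y \<nu>" "has_order_at Y y (\<lambda>p. h (f p) / det (\<nu> p)) (k y)"
      using frame[of y] by auto
    have o: "has_order_at Y y (\<lambda>p. h (f p) / det (\<tau> p)) (k y)"
      by (rule frame_change_order[OF Y offY \<nu>(1) \<tau> \<nu>(2)])
    have "\<exists>\<^sub>F p in at y. h (f p) \<noteq> 0"
      by (rule frequently_elim1[OF has_order_at_frequently[OF Y o]]) auto
    with has_order_at_imp_mero_at[OF Y o]
    show "mero_at Y y (\<lambda>p. h (f p) / det (\<tau> p)) \<and> (\<exists>\<^sub>F p in at y. h (f p) \<noteq> 0)" ..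
  qed
  moreover have ordY: "det_section_ord Y ?B ?M (\<lambda>p. h (f p)) y = k y" for y
  proof -
    obtain \<nu> where \<nu>: "frame_at Y ?B ?M y \<nu>" "has_order_at Y y (\<lambda>p. h (f p) / det (\<nu> p)) (k y)"
      using frame[of y] by auto
    show ?thesis by (rule det_section_ord_eq[OF Y offY \<nu>])
  qed
  ultimately have degY: "has_degree Y ?B ?M (\<Sum>y | k y \<noteq> 0. k y)"
    unfolding has_degree_def by (intro exI[of _ "\<lambda>p. h (f p)"] conjI) (simp_all add: ordY)
  have wY: "\<forall>y\<in>?B. has_weight_sum Y ?B ?M y (w' y)"
    unfolding w'_def using rank_one_pullback(2)[OF L h] w by simp
  define S where "S = {x. ord x \<noteq> 0} \<union> D"
  have S: "finite S" unfolding S_def ord_def using finite_divisor[OF X comX L h] D by simp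
  have fib: "finite (f -` {x})" for x by (rule finite_fibre[OF comY])
  define F where "F = f -` S"
  have F: "F = (\<Union>x\<in>S. f -` {x})" by (auto simp: F_def)
  have finF: "finite F" unfolding F using S fib by simp
  define v where "v = (\<lambda>x. real_of_int (ord x) + (if x \<in> D then w x else 0))"
  \<comment> \<open>The degree of f, taken over an arbitrary base point.\<close>
  define N where "N = (\<Sum>y\<in>f -` {undefined}. m y)"
  have N: "(\<Sum>y\<in>f -` {x}. m y) = N" for x unfolding N_def by (rule degree_constant[OF comY conX])
  have "(\<Sum>y | k y \<noteq> 0. k y) = (\<Sum>y\<in>F. k y)"
  proof (rule sum.mono_neutral_left[OF finF])
    show "{y. k y \<noteq> 0} \<subseteq> F" by (auto simp: k_def F_def S_def split: if_splits)
  qed auto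
  moreover have "(\<Sum>y\<in>?B. w' y) = (\<Sum>y\<in>F. if f y \<in> D then w' y else 0)"
    by (rule sum.mono_neutral_cong_left[OF finF]) (auto simp: F_def S_def)
  ultimately have "real_of_int (\<Sum>y | k y \<noteq> 0. k y) + (\<Sum>y\<in>?B. w' y) =
      (\<Sum>y\<in>F. real_of_int (k y) + (if f y \<in> D then w' y else 0))"
    by (simp add: sum.distrib)
  \<comment> \<open>Floor and fractional part recombine to \<open>m y * w (f y)\<close>.\<close>
  also have "\<dots> = (\<Sum>y\<in>F. real_of_int (m y) * v (f y))"
    by (rule sum.cong) (auto simp: k_def w'_def v_def frac_def algebra_simps)
  also have "\<dots> = (\<Sum>x\<in>S. \<Sum>y\<in>f -` {x}. real_of_int (m y) * v (f y))"
    unfolding F by (rule sum.UNION_disjoint[OF S]) (use fib in auto)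
  also have "\<dots> = (\<Sum>x\<in>S. real_of_int N * v x)"
  proof (rule sum.cong[OF refl])
    fix x
    have "(\<Sum>y\<in>f -` {x}. real_of_int (m y) * v (f y)) = (\<Sum>y\<in>f -` {x}. real_of_int (m y)) * v x"
      unfolding sum_distrib_right by (rule sum.cong) auto
    also have "(\<Sum>y\<in>f -` {x}. real_of_int (m y)) = real_of_int N" unfolding N[of x, symmetric] by simp
    finally show "(\<Sum>y\<in>f -` {x}. real_of_int (m y) * v (f y)) = real_of_int N * v x" .
  qed
  also have "\<dots> = real_of_int N * (\<Sum>x\<in>S. v x)" by (simp add: sum_distrib_left)
  also have "(\<Sum>x\<in>S. v x) = real_of_int (\<Sum>x\<in>S. ord x) + (\<Sum>x\<in>S. if x \<in> D then w x else 0)"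
    by (simp add: v_def sum.distrib)
  also have "(\<Sum>x\<in>S. ord x) = d"
    unfolding dh ord_def[symmetric] by (rule sum.mono_neutral_right[OF S]) (auto simp: S_def)
  also have "(\<Sum>x\<in>S. if x \<in> D then w x else 0) = (\<Sum>x\<in>D. w x)"
    by (rule sum.mono_neutral_cong_right[OF S]) (auto simp: S_def)
  finally have "0 = real_of_int (\<Sum>y | k y \<noteq> 0. k y) + (\<Sum>y\<in>?B. w' y)" using dw by simp
  then show ?thesis
    unfolding has_parabolic_degree_def
    using degY wY by (intro exI[of _ "\<Sum>y | k y \<noteq> 0. k y"] exI[of _ w'] conjI)
qed

section \<open>The trivial line bundle\<close>

text \<open>Stated for every x, also off D, because \<open>pullback_trivial_line_bundle\<close>
  identifies entire records and so compares the modules at all points.\<close>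

lemma adapted_frame_trivial:
  assumes D: "finite D"
  shows "adapted_frame X D (trivial_line_bundle X D) x (\<lambda>_. mat 1) (\<lambda>_. 0)"
proof -
  have inv: "matrix_inv (mat 1 :: complex^1^1) = mat 1" by (rule matrix_inv_eqI) simp_all
  have invt: "invertible (mat 1 :: complex^1^1)" by (simp add: invertible_det_nz)
  have "punctured_frame X D (trivial_line_bundle X D) x (\<lambda>_. mat 1)"
    unfolding punctured_frame_def
  proof (intro exI[of _ "- (D - {x})"] conjI ballI)
    show "open (- (D - {x}))" using D by (intro open_Compl finite_imp_closed) simp
    show "case W\<sigma> of (W, \<sigma>) \<Rightarrow> hol_matrix X (W \<inter> - (D - {x}) - {x}) (\<lambda>p. matrix_inv (\<sigma> p) ** mat 1)"
      if "W\<sigma> \<in> frames (trivial_line_bundle X D)" for W\<sigma>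
    proof -
      have W: "W\<sigma> = (- D, \<lambda>_. mat 1)" using that by (simp add: trivial_line_bundle_def)
      have "open (- D \<inter> - (D - {x}) - {x})"
        using D by (intro open_Int open_Diff open_Compl finite_imp_closed) auto
      then show ?thesis
        unfolding W prod.case by (simp add: hol_matrix_iff[OF X] hol_matrix_at_const[OF X])
    qed
  qed (use invt in auto)
  moreover have "(\<lambda>p. column i (mat 1)) \<in> stalk (trivial_line_bundle X D) x 0" for i :: 1
  proof -
    have "(\<lambda>p. 1) \<in> zpow_module X x 0" by (intro zpow_module_0I hol_at_const X)
    then show ?thesis by (simp add: trivial_line_bundle_def column_def mat_def)
  qed
  moreover have "stalk (trivial_line_bundle X D) x t \<subseteq> weighted_germs X x (\<lambda>_. mat 1) (\<lambda>_. 0) t" for t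
    by (auto simp: trivial_line_bundle_def weighted_germs_def inv)
  ultimately show ?thesis unfolding adapted_frame_def by simp
qed

lemma pullback_trivial_line_bundle:
  assumes D: "finite D"
  shows "parabolic_pullback Y X f (trivial_line_bundle X D) = trivial_line_bundle Y (f -` D)"
proof (rule parabolic_data.equality)
  have inv: "matrix_inv (mat 1 :: complex^1^1) = mat 1" by (rule matrix_inv_eqI) simp_all
  show "frames (parabolic_pullback Y X f (trivial_line_bundle X D)) = frames (trivial_line_bundle Y (f -` D))"
    unfolding frames_pullback by (auto simp: trivial_line_bundle_def o_def)
  show "stalk (parabolic_pullback Y X f (trivial_line_bundle X D)) = stalk (trivial_line_bundle Y (f -` D))"
  proof (intro ext)
    fix y s
    show "stalk (parabolic_pullback Y X f (trivial_line_bundle X D)) y s =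
        stalk (trivial_line_bundle Y (f -` D)) y s"
      unfolding stalk_pullback_weighted[OF adapted_frame_trivial[OF D]]
      by (auto simp: trivial_line_bundle_def weighted_germs_def inv)
  qed
qed simp

section \<open>Pullback of the form\<close>

lemma nondegenerate_parabolic_form_pullback:
  fixes E :: "('a, 'n::finite) parabolic_data"
  assumes comX: "compact (UNIV :: 'a set)" and conX: "connected (UNIV :: 'a set)"
    and comY: "compact (UNIV :: 'b set)" and D: "finite D"
    and form: "nondegenerate_parabolic_form X D E L \<phi>"
  shows "nondegenerate_parabolic_form Y (f -` D) (parabolic_pullback Y X f E)
    (parabolic_pullback Y X f L) (\<phi> \<circ> f)"
proof -
  let ?E = "parabolic_pullback Y X f E" and ?L = "parabolic_pullback Y X f L" and ?B = "f -` D"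
  have E: "parabolic_bundle X D E" and L: "parabolic_bundle X D L"
    and deg: "has_parabolic_degree X D L 0" and hom: "parabolic_hom X D (parabolic_tensor X E E) L \<phi>"
    and iso: "parabolic_iso X D E (parabolic_tensor X (parabolic_dual X E) L) (\<lambda>p. adjoint_matrix (\<phi> p))"
    using form unfolding nondegenerate_parabolic_form_def by simp_all
  have offE: "holomorphic_bundle_off X D E" and offL: "holomorphic_bundle_off X D L"
    using E L unfolding parabolic_bundle_def by simp_all
  note oE = holomorphic_bundle_offD(1)[OF offE] and oL = holomorphic_bundle_offD(1)[OF offL]
  have oEE: "open U" if "(U, \<tau>) \<in> frames (parabolic_tensor X E E)" for U \<tau>
    using that oE by (auto simp: parabolic_tensor_def)
  have oT: "open U" if "(U, \<tau>) \<in> frames (parabolic_tensor X (parabolic_dual X E) L)" for U \<tau>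
    using that oE oL by (auto simp: parabolic_tensor_def parabolic_dual_def)
  have framesT: "frames (parabolic_pullback Y X f (parabolic_tensor X (parabolic_dual X E) L)) =
      frames (parabolic_tensor Y (parabolic_dual Y ?E) ?L)"
    unfolding frames_pullback_tensor by (simp add: parabolic_tensor_def frames_pullback_dual)
  \<comment> \<open>The module of a tensor product depends only on the modules of its factors at the
    same point, so the comparison for the dual can be inserted into the first factor.\<close>
  have stalkT: "stalk (parabolic_pullback Y X f (parabolic_tensor X (parabolic_dual X E) L)) y s =
      stalk (parabolic_tensor Y (parabolic_dual Y ?E) ?L) y s" if y: "y \<in> ?B" for y s
  proof -
    obtain \<sigma> \<beta> where "adapted_frame X D E (f y) \<sigma> \<beta>"
      using adapted_frame_exists[OF X E, of "f y"] y by auto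
    from stalk_pullback_dual[OF this] show ?thesis
      unfolding stalk_pullback_tensor by (simp add: stalk_tensor tensor_generators_def)
  qed
  have "parabolic_hom Y ?B (parabolic_pullback Y X f (parabolic_tensor X E E)) ?L (\<lambda>p. \<phi> (f p))"
    by (rule parabolic_hom_pullback[OF oEE oL hom])
  then have homY: "parabolic_hom Y ?B (parabolic_tensor Y ?E ?E) ?L (\<phi> \<circ> f)"
    unfolding o_def by (rule iffD1[OF parabolic_hom_cong[OF frames_pullback_tensor refl stalk_pullback_tensor refl]])
  obtain \<psi> where homA: "parabolic_hom X D E (parabolic_tensor X (parabolic_dual X E) L) (\<lambda>p. adjoint_matrix (\<phi> p))"
    and \<psi>: "parabolic_hom X D (parabolic_tensor X (parabolic_dual X E) L) E \<psi>"
    and inv: "\<forall>p\<in>- D. \<psi> p ** adjoint_matrix (\<phi> p) = mat 1 \<and> adjoint_matrix (\<phi> p) ** \<psi> p = mat 1"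
    using iso unfolding parabolic_iso_def by auto
  have "parabolic_hom Y ?B ?E (parabolic_pullback Y X f (parabolic_tensor X (parabolic_dual X E) L))
      (\<lambda>p. adjoint_matrix (\<phi> (f p)))"
    by (rule parabolic_hom_pullback[OF oE oT homA])
  moreover have "parabolic_hom Y ?B ?E (parabolic_pullback Y X f (parabolic_tensor X (parabolic_dual X E) L)) A \<longleftrightarrow>
      parabolic_hom Y ?B ?E (parabolic_tensor Y (parabolic_dual Y ?E) ?L) A" for A
    by (rule parabolic_hom_cong[OF refl framesT refl stalkT])
  ultimately have homAY: "parabolic_hom Y ?B ?E (parabolic_tensor Y (parabolic_dual Y ?E) ?L)
      (\<lambda>p. adjoint_matrix ((\<phi> \<circ> f) p))"
    by simp
  have "parabolic_hom Y ?B (parabolic_pullback Y X f (parabolic_tensor X (parabolic_dual X E) L)) ?E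
      (\<lambda>p. \<psi> (f p))"
    by (rule parabolic_hom_pullback[OF oT oE \<psi>])
  moreover have "parabolic_hom Y ?B (parabolic_pullback Y X f (parabolic_tensor X (parabolic_dual X E) L)) ?E A \<longleftrightarrow>
      parabolic_hom Y ?B (parabolic_tensor Y (parabolic_dual Y ?E) ?L) ?E A" for A
    by (rule parabolic_hom_cong[OF framesT refl stalkT refl])
  ultimately have "parabolic_hom Y ?B (parabolic_tensor Y (parabolic_dual Y ?E) ?L) ?E (\<lambda>p. \<psi> (f p))"
    by simp
  then have "parabolic_iso Y ?B ?E (parabolic_tensor Y (parabolic_dual Y ?E) ?L)
      (\<lambda>p. adjoint_matrix ((\<phi> \<circ> f) p))"
    unfolding parabolic_iso_def using homAY inv by (intro conjI exI[of _ "\<lambda>p. \<psi> (f p)"]) auto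
  then show ?thesis
    unfolding nondegenerate_parabolic_form_def
    using parabolic_bundle_pullback[OF E] parabolic_bundle_pullback[OF L] homY
      has_parabolic_degree_zero_pullback[OF comX conX comY D L deg] by blast
qed

end

theorem proposition4p1:
  fixes X :: "'a::t2_space atlas" and Y :: "'b::t2_space atlas"
    and f :: "'b \<Rightarrow> 'a" and D :: "'a set"
    and E :: "('a, 'n::finite) parabolic_data" and L :: "('a, 1) parabolic_data"
    and \<phi> :: "'a \<Rightarrow> complex^('n \<times> 'n)^1"
  assumes "compact_connected_riemann_surface X" and "compact_connected_riemann_surface Y"
    and "holomorphic_map Y X f" and "\<not> f constant_on UNIV"
    and "finite D"
  shows
    "(parabolic_symplectic X D E L \<phi> \<longrightarrow>
        parabolic_symplectic Y (f -` D) (parabolic_pullback Y X f E) (parabolic_pullback Y X f L)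
          (\<phi> \<circ> f)) \<and>
     (parabolic_orthogonal X D E L \<phi> \<longrightarrow>
        parabolic_orthogonal Y (f -` D) (parabolic_pullback Y X f E) (parabolic_pullback Y X f L)
          (\<phi> \<circ> f)) \<and>
     (parabolic_orthogonal X D E (trivial_line_bundle X D) \<phi> \<longrightarrow>
        parabolic_orthogonal Y (f -` D) (parabolic_pullback Y X f E)
          (trivial_line_bundle Y (f -` D)) (\<phi> \<circ> f)) \<and>
     (parabolic_symplectic X D E (trivial_line_bundle X D) \<phi> \<longrightarrow>
        parabolic_symplectic Y (f -` D) (parabolic_pullback Y X f E)
          (trivial_line_bundle Y (f -` D)) (\<phi> \<circ> f))"
proof -
  have cX: "riemann_surface X" "compact (UNIV :: 'a set)" "connected (UNIV :: 'a set)"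
    and cY: "riemann_surface Y" "compact (UNIV :: 'b set)" "connected (UNIV :: 'b set)"
    using assms(1,2) unfolding compact_connected_riemann_surface_def by simp_all
  \<comment> \<open>Connectedness of the source enters here, to turn global nonconstancy into
    isolation of each point in its fibre.\<close>
  interpret nonconstant_map X Y f
  proof
    show "riemann_surface X" "riemann_surface Y" "holomorphic_map Y X f" by fact+
    show "\<forall>\<^sub>F p in at y. f p \<noteq> f y" for y
      by (rule eventually_neq_of_nonconstant[OF cX(1) cY(1) assms(3) cY(3) assms(4)])
  qed
  note form = nondegenerate_parabolic_form_pullback[OF cX(2,3) cY(2) assms(5)]
  have symplectic: "parabolic_symplectic Y (f -` D) (parabolic_pullback Y X f E)
      (parabolic_pullback Y X f M) (\<phi> \<circ> f)" if M: "parabolic_symplectic X D E M \<phi>" for M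
    unfolding parabolic_symplectic_def
  proof (intro conjI ballI allI)
    show "nondegenerate_parabolic_form Y (f -` D) (parabolic_pullback Y X f E)
        (parabolic_pullback Y X f M) (\<phi> \<circ> f)"
      by (rule form[OF conjunct1[OF M[unfolded parabolic_symplectic_def]]])
    fix p and u v :: "complex^'n" assume "p \<in> - (f -` D)"
    then have "f p \<in> - D" by simp
    from bspec[OF conjunct2[OF M[unfolded parabolic_symplectic_def]] this]
    show "(\<phi> \<circ> f) p *v tensor_vec v u = - ((\<phi> \<circ> f) p *v tensor_vec u v)"
      unfolding o_def by (elim allE)
  qed
  have orthogonal: "parabolic_orthogonal Y (f -` D) (parabolic_pullback Y X f E)
      (parabolic_pullback Y X f M) (\<phi> \<circ> f)" if M: "parabolic_orthogonal X D E M \<phi>" for M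
    unfolding parabolic_orthogonal_def
  proof (intro conjI ballI allI)
    show "nondegenerate_parabolic_form Y (f -` D) (parabolic_pullback Y X f E)
        (parabolic_pullback Y X f M) (\<phi> \<circ> f)"
      by (rule form[OF conjunct1[OF M[unfolded parabolic_orthogonal_def]]])
    fix p and u v :: "complex^'n" assume "p \<in> - (f -` D)"
    then have "f p \<in> - D" by simp
    from bspec[OF conjunct2[OF M[unfolded parabolic_orthogonal_def]] this]
    show "(\<phi> \<circ> f) p *v tensor_vec v u = (\<phi> \<circ> f) p *v tensor_vec u v"
      unfolding o_def by (elim allE)
  qed
  \<comment> \<open>The last two claims are the first two with the trivial bundle for L, since its
    pullback is equal to the trivial bundle on \<open>Y\<close>.\<close>
  show ?thesis
    using symplectic[of L] orthogonal[of L]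
      symplectic[of "trivial_line_bundle X D"] orthogonal[of "trivial_line_bundle X D"]
    unfolding pullback_trivial_line_bundle[OF assms(5)] by (intro conjI impI)
qed

end
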